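(* Let $G$ be a finite or infinite connected cubic graph. If $G$ has a vertex of type 2, then $D(G)\le 2$ or $G$ is isomorphic to $R^2_n$ or $R^3_n$ for some $n$. If $G$ has a vertex of type 3, then $D(G)\le 2$.
   Context: A graph is cubic if every vertex has valence 3. For a vertex $v$, the stabilizer $\mathrm{Aut}_v(G)$ induces a permutation group on the three neighbors of $v$; the type of $v$ is the order of this permutation group. $D(G)$ is the least number of colors in a vertex coloring of $G$ whose only color-preserving automorphism is the identity. For $n\ge1$, $T_n$ is the finite tree in which every vertex has valence 1 or 3 and every leaf has distance exactly $n$ from a fixed root. $R^2_n$ is obtained from $T_n$ by, for every pair of leaves $u,v$ with a common neighbor, adding two new vertices $x,y$ and edges $ux,xv,vy,yu,xy$; $R^3_n$ is obtained by instead adding four new vertices $x,y,z,w$ and edges $ux,xz,zv,vy,yw,wu,xy,zw$. *)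

theory Defs
  imports
    "Graph_Theory.Graph_Theory"
    "HOL-Combinatorics.Permutations"
    "HOL-Library.Extended_Nat"
    "HOL-Library.FuncSet"
begin

text \<open>
  A finite or infinite simple graph is a \<open>pair_bidirected_digraph\<close>: a vertex set together with a
  symmetric and irreflexive arc relation on it, where the arcs \<open>(u, v)\<close> and \<open>(v, u)\<close> represent the
  edge \<open>uv\<close>.
\<close>

definition valence :: "'a pair_pre_digraph \<Rightarrow> 'a \<Rightarrow> nat" where
  "valence G v = out_degree (with_proj G) v"

definition cubic :: "'a pair_pre_digraph \<Rightarrow> bool" where
  "cubic G \<longleftrightarrow> (\<forall>v \<in> pverts G. valence G v = 3)"

text \<open>Automorphisms are the identity outside the vertex set, so they correspond one-to-one to the
  adjacency preserving permutations of the vertex set.\<close>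

definition automorphisms :: "'a pair_pre_digraph \<Rightarrow> ('a \<Rightarrow> 'a) set" where
  "automorphisms G = {f. f permutes pverts G \<and>
     (\<forall>u \<in> pverts G. \<forall>v \<in> pverts G. (f u, f v) \<in> parcs G \<longleftrightarrow> (u, v) \<in> parcs G)}"

definition stabilizer :: "'a pair_pre_digraph \<Rightarrow> 'a \<Rightarrow> ('a \<Rightarrow> 'a) set" where
  "stabilizer G v = {f \<in> automorphisms G. f v = v}"

definition neighbors :: "'a pair_pre_digraph \<Rightarrow> 'a \<Rightarrow> 'a set" where
  "neighbors G v = parcs G `` {v}"

definition vertex_type :: "'a pair_pre_digraph \<Rightarrow> 'a \<Rightarrow> nat" where
  "vertex_type G v = card ((\<lambda>f. restrict f (neighbors G v)) ` stabilizer G v)"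

definition distinguishing :: "'a pair_pre_digraph \<Rightarrow> ('a \<Rightarrow> 'c) \<Rightarrow> bool" where
  "distinguishing G c \<longleftrightarrow>
     (\<forall>f \<in> automorphisms G. (\<forall>v \<in> pverts G. c (f v) = c v) \<longrightarrow> f = id)"

text \<open>The value is \<open>\<infinity>\<close> if no coloring with finitely many colors is distinguishing.\<close>

definition distinguishing_number :: "'a pair_pre_digraph \<Rightarrow> enat" where
  "distinguishing_number G =
     Inf {enat k | k. \<exists>c :: 'a \<Rightarrow> nat. c ` pverts G \<subseteq> {..<k} \<and> distinguishing G c}"

text \<open>The library's \<open>forest\<close> cannot be used for undirected graphs, since it counts the two opposite
  arcs of an edge as a cycle of length 2. Hence only cycles of length at least 3 are excluded.\<close>

definition undirected_tree :: "'a pair_pre_digraph \<Rightarrow> bool" where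
  "undirected_tree T \<longleftrightarrow> pair_bidirected_digraph T \<and> Digraph_Component.connected (with_proj T) \<and>
     \<not> (\<exists>p. pre_digraph.cycle (with_proj T) p \<and> 3 \<le> length p)"

definition leaf :: "'a pair_pre_digraph \<Rightarrow> 'a \<Rightarrow> bool" where
  "leaf T v \<longleftrightarrow> v \<in> pverts T \<and> valence T v = 1"

text \<open>Only meaningful for vertices in the same component.\<close>

definition graph_dist :: "'a pair_pre_digraph \<Rightarrow> 'a \<Rightarrow> 'a \<Rightarrow> nat" where
  "graph_dist G u v = (LEAST k. \<exists>p. pre_digraph.awalk (with_proj G) u p v \<and> length p = k)"

text \<open>\<open>is_T n T\<close> says that \<open>T\<close> is (a copy of) the tree \<open>T\<^sub>n\<close>, which is determined up to isomorphism.\<close>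

definition is_T :: "nat \<Rightarrow> 'a pair_pre_digraph \<Rightarrow> bool" where
  "is_T n T \<longleftrightarrow> finite (pverts T) \<and> undirected_tree T \<and>
     (\<forall>v \<in> pverts T. valence T v = 1 \<or> valence T v = 3) \<and>
     (\<exists>r \<in> pverts T. \<forall>v. leaf T v \<longrightarrow> graph_dist T r v = n)"

text \<open>The linear order on the vertices only serves to list every unordered pair once.\<close>

definition leaf_pairs :: "('a :: linorder) pair_pre_digraph \<Rightarrow> ('a \<times> 'a) set" where
  "leaf_pairs T = {(u, v). u < v \<and> leaf T u \<and> leaf T v \<and>
     (\<exists>w \<in> pverts T. (u, w) \<in> parcs T \<and> (v, w) \<in> parcs T)}"

datatype 'a rvertex = Old 'a | X "'a \<times> 'a" | Y "'a \<times> 'a" | Z "'a \<times> 'a" | W "'a \<times> 'a"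

definition undirected :: "('a \<times> 'a) set \<Rightarrow> ('a \<times> 'a) set" where
  "undirected A = A \<union> A\<inverse>"

definition R2 :: "('a :: linorder) pair_pre_digraph \<Rightarrow> 'a rvertex pair_pre_digraph" where
  "R2 T = \<lparr>
     pverts = Old ` pverts T \<union> (\<Union>e \<in> leaf_pairs T. {X e, Y e}),
     parcs = map_prod Old Old ` parcs T \<union>
       undirected (\<Union>(u, v) \<in> leaf_pairs T.
         let x = X (u, v); y = Y (u, v)
         in {(Old u, x), (x, Old v), (Old v, y), (y, Old u), (x, y)}) \<rparr>"

definition R3 :: "('a :: linorder) pair_pre_digraph \<Rightarrow> 'a rvertex pair_pre_digraph" where
  "R3 T = \<lparr>
     pverts = Old ` pverts T \<union> (\<Union>e \<in> leaf_pairs T. {X e, Y e, Z e, W e}),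
     parcs = map_prod Old Old ` parcs T \<union>
       undirected (\<Union>(u, v) \<in> leaf_pairs T.
         let x = X (u, v); y = Y (u, v); z = Z (u, v); w = W (u, v)
         in {(Old u, x), (x, z), (z, Old v), (Old v, y), (y, w), (w, Old u), (x, y), (z, w)}) \<rparr>"

text \<open>Finite trees have copies on the natural numbers, so it suffices to quantify over these.\<close>

definition isomorphic_to_R2 :: "'a pair_pre_digraph \<Rightarrow> nat \<Rightarrow> bool" where
  "isomorphic_to_R2 G n \<longleftrightarrow>
     (\<exists>T :: nat pair_pre_digraph. is_T n T \<and> digraph_iso (with_proj G) (with_proj (R2 T)))"

definition isomorphic_to_R3 :: "'a pair_pre_digraph \<Rightarrow> nat \<Rightarrow> bool" where
  "isomorphic_to_R3 G n \<longleftrightarrow>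
     (\<exists>T :: nat pair_pre_digraph. is_T n T \<and> digraph_iso (with_proj G) (with_proj (R3 T)))"

end

theory Submission
  imports Defs
begin

text \<open>
  Suppose that the coloring of a connected set \<open>D\<close> of vertices ensures that every color preserving
  automorphism fixes \<open>D\<close> pointwise. A vertex of \<open>D\<close> with neighbors outside of \<open>D\<close> has at most two of them,
  and giving them different colors enlarges \<open>D\<close>. So a seed \<open>D\<close> extends to the whole graph, and there is
  enough freedom to prescribe colors on some further vertices, or to use both colors on each member of an
  invariant family of disjoint pairs, which makes the seed recognizable.

  A vertex \<open>v\<close> of type 2 has a unique neighbor \<open>s v\<close> fixed by its stabilizer. The walk \<open>v\<close>, \<open>s v\<close>, \<open>s (s v)\<close>,
  \<open>\<dots>\<close> may go on forever, and its vertices then form a seed. It may reach an edge that is fixed from both of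
  its ends, and the orbit of this edge consists of disjoint pairs. Or it reaches a vertex \<open>r\<close> with
  transitive local group. Unless \<open>r\<close> is fixed by all automorphisms and cuts its neighbors from each other,
  suitable colors on the orbit of \<open>r\<close> give a seed. Otherwise the vertices from which the walk leads to \<open>r\<close>
  form a binary tree with levels around \<open>r\<close>. An infinite tree contains a ray as a seed. In a finite one,
  either some pair of siblings, or of neighbors below a leaf, can be singled out by coloring it
  monochromatically, or the leaves are joined as in \<open>R\<^sup>2\<^sub>n\<close> or \<open>R\<^sup>3\<^sub>n\<close>.

  A vertex \<open>r\<close> of type 3 is determined together with its neighbors by the colors of \<open>r\<close> and one neighbor,
  and the orbit of \<open>r\<close> can be used for the seed unless it is adjacent to a vertex of type 2. The graphs
  \<open>R\<^sup>2\<^sub>n\<close> and \<open>R\<^sup>3\<^sub>n\<close> have no vertices of type 3.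
\<close>

section \<open>Automorphisms and extension of colorings\<close>

text \<open>The obstacle is a vertex of type 6. Two colors leave two of its three neighbors alike,
  so one of the branches at it must be recognized from within: by a second member of the orbit of
  the root, by a uniquely colored vertex, or by a pair that alone is monochromatic. The only way
  around this is a connection between two branches, along which the alike neighbors are reached one
  by one. The exceptional graphs offer nothing of this kind. Their added vertices come in pairs of
  twins, \<open>x, y\<close> in the first family and \<open>x, w\<close> and \<open>z, y\<close> in
  the second, and every distinguishing coloring must separate twins. Two sibling leaves of equal
  color could then be exchanged together with what hangs on them, so siblings have to differ in
  color. The same holds on every higher level up to the root, where two of the three neighbors must
  agree. At a vertex of type 3 this problem is absent: an automorphism that fixes the vertex and one
  neighbor fixes the other two.\<close>

locale connected_cubic_graph =
  fixes G :: "'a pair_pre_digraph"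
  assumes bidirected: "pair_bidirected_digraph G"
    and connected: "Digraph_Component.connected (with_proj G)"
    and cubic: "cubic G"
begin

abbreviation V :: "'a set" where "V \<equiv> pverts G"
abbreviation N :: "'a \<Rightarrow> 'a set" where "N \<equiv> neighbors G"
abbreviation A :: "('a \<Rightarrow> 'a) set" where "A \<equiv> automorphisms G"

section \<open>Neighborhoods in a cubic graph\<close>

lemma N_iff: "u \<in> N v \<longleftrightarrow> (v, u) \<in> parcs G"
  by (simp add: neighbors_def)

lemma N_V: "u \<in> N v \<Longrightarrow> u \<in> V" "u \<in> N v \<Longrightarrow> v \<in> V"
proof -
  interpret pair_bidirected_digraph G by (rule bidirected)
  show "u \<in> N v \<Longrightarrow> u \<in> V" "u \<in> N v \<Longrightarrow> v \<in> V"
    by (auto simp: N_iff dest: in_arcsD1 in_arcsD2)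
qed

lemma N_irrefl: "v \<notin> N v"
proof -
  interpret pair_bidirected_digraph G by (rule bidirected)
  show ?thesis using pair_no_loops by (force simp: N_iff)
qed

lemma N_neq: "u \<in> N v \<Longrightarrow> u \<noteq> v"
  using N_irrefl by blast

lemma N_sym: "u \<in> N v \<longleftrightarrow> v \<in> N u"
proof -
  interpret pair_bidirected_digraph G by (rule bidirected)
  show ?thesis using pair_sym_arcs by (auto simp: N_iff symmetric_def dest: symD)
qed

lemma card_N: "v \<in> V \<Longrightarrow> card (N v) = 3"
proof -
  assume v: "v \<in> V"
  have "card (out_arcs (with_proj G) v) = 3"
    using cubic v by (simp add: cubic_def valence_def out_degree_def)
  moreover have "out_arcs (with_proj G) v = Pair v ` N v"
    by (auto simp: out_arcs_def N_iff)
  ultimately show ?thesis by (simp add: card_image inj_on_def)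
qed

lemma finite_N: "finite (N v)"
proof (cases "v \<in> V")
  case True
  then show ?thesis using card_N card.infinite by fastforce
next
  case False
  then show ?thesis using N_V(2) by (metis equals0I finite.emptyI)
qed

lemma N3:
  assumes "v \<in> V" "a \<in> N v"
  obtains b c where "N v = {a, b, c}" "a \<noteq> b" "a \<noteq> c" "b \<noteq> c"
proof -
  have "card (N v - {a}) = 2"
    using card_N[OF assms(1)] assms(2) finite_N by simp
  then obtain b c where "N v - {a} = {b, c}" "b \<noteq> c"
    by (auto simp: card_2_iff)
  moreover then have "N v = {a, b, c}" using assms(2) by blast
  ultimately show thesis using that by blast
qed

lemma N3':
  assumes "v \<in> V" "a \<in> N v" "b \<in> N v" "a \<noteq> b"
  obtains c where "N v = {a, b, c}" "a \<noteq> c" "b \<noteq> c"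
proof -
  obtain x y where "N v = {a, x, y}" "a \<noteq> x" "a \<noteq> y" "x \<noteq> y" using N3 assms by metis
  then show thesis using that[of x] that[of y] assms by auto
qed

lemma N3_eq:
  assumes "a \<in> N v" "b \<in> N v" "c \<in> N v" "a \<noteq> b" "a \<noteq> c" "b \<noteq> c"
  shows "N v = {a, b, c}"
proof -
  obtain d where "N v = {a, b, d}" using N3'[OF N_V(2)] assms by metis
  then show ?thesis using assms by auto
qed

text \<open>Connectedness of \<open>G\<close> enters the whole argument only in this form.\<close>

lemma closed_eq_V:
  assumes "D \<noteq> {}" "D \<subseteq> V" "\<And>p. p \<in> D \<Longrightarrow> N p \<subseteq> D"
  shows "D = V"
proof -
  interpret pair_bidirected_digraph G by (rule bidirected)
  have sc: "strongly_connected (with_proj G)"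
    using symmetric_connected_imp_strongly_connected[OF _ connected] pair_sym_arcs by simp
  obtain x where x: "x \<in> D" using assms(1) by blast
  have "y \<in> D" if "y \<in> V" for y
  proof -
    have "x \<rightarrow>\<^sup>*\<^bsub>with_proj G\<^esub> y" using sc that x assms(2) by (auto simp: strongly_connected_def)
    then show "y \<in> D"
    proof (induction rule: reachable_induct)
      case base then show ?case using x by simp
    next
      case (step a b)
      then show ?case using assms(3)[of a] by (auto simp: N_iff)
    qed
  qed
  then show ?thesis using assms(2) by blast
qed

section \<open>The automorphism group\<close>

lemma A_permutes: "f \<in> A \<Longrightarrow> f permutes V"
  by (simp add: automorphisms_def)

lemma A_inj: "f \<in> A \<Longrightarrow> f x = f y \<longleftrightarrow> x = y"
  using A_permutes permutes_inj by (metis injD)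

lemma A_V: "f \<in> A \<Longrightarrow> f x \<in> V \<longleftrightarrow> x \<in> V"
  using A_permutes permutes_in_image by metis

lemma A_N: "f \<in> A \<Longrightarrow> f x \<in> N (f v) \<longleftrightarrow> x \<in> N v"
proof -
  assume f: "f \<in> A"
  have "(f v, f x) \<in> parcs G \<longleftrightarrow> (v, x) \<in> parcs G" if "v \<in> V" "x \<in> V"
    using f that by (simp add: automorphisms_def)
  then show ?thesis using A_V[OF f] N_V by (metis N_iff)
qed

lemma A_id: "id \<in> A"
  by (simp add: automorphisms_def permutes_id)

lemma A_comp: "f \<in> A \<Longrightarrow> g \<in> A \<Longrightarrow> f \<circ> g \<in> A"
proof -
  assume *: "f \<in> A" "g \<in> A"
  have "(f (g u), f (g v)) \<in> parcs G \<longleftrightarrow> (u, v) \<in> parcs G" for u v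
    using A_N[OF *(1), of "g v" "g u"] A_N[OF *(2), of v u] by (simp add: N_iff)
  then show ?thesis using permutes_compose[OF A_permutes[OF *(2)] A_permutes[OF *(1)]]
    by (simp add: automorphisms_def)
qed

lemma A_surj: "f \<in> A \<Longrightarrow> \<exists>x. f x = y"
  using permutes_surj[OF A_permutes] by (metis surjD)

lemma A_N_image: "f \<in> A \<Longrightarrow> N (f v) = f ` N v"
proof (intro set_eqI iffI)
  fix x assume f: "f \<in> A"
  { assume x: "x \<in> N (f v)"
    obtain y where "x = f y" using A_surj[OF f] by metis
    then show "x \<in> f ` N v" using A_N[OF f] x by blast }
  assume "x \<in> f ` N v" then show "x \<in> N (f v)" using A_N[OF f] by blast
qed

lemma A_inv:
  assumes "f \<in> A"
  obtains g where "g \<in> A" "\<And>x. g (f x) = x" "\<And>x. f (g x) = x"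
proof -
  let ?g = "inv f"
  have p: "?g permutes V" using A_permutes assms permutes_inv by blast
  have 1: "?g (f x) = x" for x using A_permutes[OF assms] permutes_inverses(2) by metis
  have 2: "f (?g x) = x" for x using A_permutes[OF assms] permutes_inverses(1) by metis
  have "(?g u, ?g v) \<in> parcs G \<longleftrightarrow> (u, v) \<in> parcs G" for u v
    using A_N[OF assms, of "?g v" "?g u"] by (simp add: 2 N_iff)
  then have "?g \<in> A" using p by (simp add: automorphisms_def)
  then show thesis using that 1 2 by blast
qed

text \<open>Twins can be exchanged. This is the source of explicit automorphisms: in small dense
  configurations such a transposition contradicts an assumption on a local group.\<close>

lemma transpose_in_A:
  assumes "u \<in> V" "v \<in> V" "N u - {v} = N v - {u}"
  shows "Transposition.transpose u v \<in> A"
proof -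
  let ?f = "Transposition.transpose u v"
  have "?f x \<in> N (?f y) \<longleftrightarrow> x \<in> N y" for x y
  proof -
    have "x \<in> N u \<longleftrightarrow> x \<in> N v" if "x \<noteq> u" "x \<noteq> v" for x using assms(3) that by auto
    then show ?thesis using N_sym N_irrefl
      by (metis transpose_apply_first transpose_apply_other transpose_apply_second)
  qed
  then show ?thesis using assms(1,2)
    by (auto simp: automorphisms_def permutes_swap_id N_iff)
qed

lemma distinguishing_number_le_2I:
  fixes c :: "'a \<Rightarrow> bool"
  assumes "\<And>f. f \<in> A \<Longrightarrow> (\<And>x. x \<in> V \<Longrightarrow> c (f x) = c x) \<Longrightarrow> \<forall>x\<in>V. f x = x"
  shows "distinguishing_number G \<le> 2"
proof -
  let ?c = "\<lambda>x. if c x then 1 else (0::nat)"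
  have "f = id" if "f \<in> A" "\<forall>v\<in>V. ?c (f v) = ?c v" for f
  proof -
    have "c (f x) = c x" if "x \<in> V" for x using \<open>\<forall>v\<in>V. ?c (f v) = ?c v\<close> that
      by (auto split: if_splits)
    then have "\<forall>x\<in>V. f x = x" using assms that by blast
    then show "f = id" using A_permutes[OF that(1)] by (metis eq_id_iff permutes_not_in)
  qed
  then have "distinguishing G ?c" by (simp add: distinguishing_def)
  moreover have "?c ` V \<subseteq> {..<2}" by auto
  ultimately have "enat 2 \<in> {enat k | k. \<exists>c :: 'a \<Rightarrow> nat. c ` V \<subseteq> {..<k} \<and> distinguishing G c}"
    by blast
  then show ?thesis unfolding distinguishing_number_def
    by (simp add: numeral_eq_enat Inf_lower)
qed

text \<open>\<open>Q\<close> carries the prescribed colors \<open>q\<close>, and the pairs \<open>{x, y} \<in> PP\<close> outside of \<open>Q\<close> must receive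
  two different colors.\<close>

definition good_coloring :: "('a \<Rightarrow> 'a) set \<Rightarrow> 'a set \<Rightarrow> ('a \<Rightarrow> bool) \<Rightarrow> 'a set set \<Rightarrow> ('a \<Rightarrow> bool) \<Rightarrow> bool" where
  "good_coloring F Q q PP c \<longleftrightarrow> (\<forall>x\<in>Q. c x = q x) \<and>
    (\<forall>x y. {x, y} \<in> PP \<longrightarrow> x \<noteq> y \<longrightarrow> x \<notin> Q \<longrightarrow> y \<notin> Q \<longrightarrow> c x \<noteq> c y) \<and>
    (\<forall>f\<in>F. (\<forall>x\<in>V. c (f x) = c x) \<longrightarrow> (\<forall>x\<in>V. f x = x))"

lemma good_coloringD:
  assumes "good_coloring F Q q PP c"
  shows "x \<in> Q \<Longrightarrow> c x = q x"
    "{x, y} \<in> PP \<Longrightarrow> x \<noteq> y \<Longrightarrow> x \<notin> Q \<Longrightarrow> y \<notin> Q \<Longrightarrow> c x \<noteq> c y"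
    "f \<in> F \<Longrightarrow> (\<And>x. x \<in> V \<Longrightarrow> c (f x) = c x) \<Longrightarrow> \<forall>x\<in>V. f x = x"
  using assms unfolding good_coloring_def by (elim conjE, simp)+

text \<open>Zorn's lemma applied to the partial colorings whose domain is fixed pointwise by every color preserving
  \<open>f \<in> F\<close>. A domain \<open>D\<close> grows at the vertex \<open>p\<close> of \<open>step\<close>: since \<open>p\<close> has a neighbor in \<open>D\<close>, at most two of its
  neighbors are missing. Two missing ones get different colors; if \<open>Q\<close> or \<open>PP\<close> forbids this, then \<open>step\<close> or
  the invariance of \<open>PP\<close> shows that they are fixed anyway.\<close>

theorem extend_coloring:
  fixes q :: "'a \<Rightarrow> bool"
  assumes F: "F \<subseteq> A"
    and D0: "D0 \<subseteq> Q" "Q \<subseteq> V" "D0 \<noteq> {}" "\<And>x. x \<in> D0 \<Longrightarrow> N x \<inter> D0 \<noteq> {}"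
    and D0_fix: "\<And>f x. f \<in> F \<Longrightarrow> x \<in> D0 \<Longrightarrow> f x = x"
    and PPV: "\<And>x y. {x, y} \<in> PP \<Longrightarrow> x \<in> V"
    and PP_disj: "\<And>x y z. {x, y} \<in> PP \<Longrightarrow> {x, z} \<in> PP \<Longrightarrow> y = z"
    and PP_inv: "\<And>f x y. f \<in> F \<Longrightarrow> {x, y} \<in> PP \<Longrightarrow> {f x, f y} \<in> PP"
    and step: "\<And>D. D0 \<subseteq> D \<Longrightarrow> D \<subseteq> V \<Longrightarrow> D \<noteq> V \<Longrightarrow> (\<And>x. x \<in> D \<Longrightarrow> N x \<inter> D \<noteq> {}) \<Longrightarrow>
      \<exists>p\<in>D. N p - D \<noteq> {} \<and> (\<forall>u\<in>N p - D. \<forall>u'\<in>N p - D. u \<noteq> u' \<longrightarrow> u \<in> Q \<longrightarrow> u' \<in> Q \<longrightarrow>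
        q u = q u' \<longrightarrow> (\<forall>f\<in>F. (\<forall>x\<in>D. f x = x) \<longrightarrow> f u = u))"
  shows "\<exists>c. good_coloring F Q q PP c"
proof -
  \<comment> \<open>Forbidden patterns are finite sets of assignments, so the union of a chain
    contains one only if some member of the chain does.\<close>
  define bad where "bad = {{(x, True), (x, False)} | x. True} \<union> {{(x, \<not> q x)} | x. x \<in> Q}
    \<union> {{(x, \<beta>), (y, \<beta>)} | x y \<beta>. {x, y} \<in> PP \<and> x \<noteq> y \<and> x \<notin> Q \<and> y \<notin> Q}"
  \<comment> \<open>Quantifying over all total colorings that extend \<open>M\<close> makes the
    condition monotone: what a smaller \<open>M\<close> fixes stays fixed for a larger one.\<close>
  define fixes' where "fixes' M \<longleftrightarrow> (\<forall>c. (\<forall>x b. (x, b) \<in> M \<longrightarrow> c x = b) \<longrightarrow>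
    (\<forall>f\<in>F. (\<forall>x\<in>V. c (f x) = c x) \<longrightarrow> (\<forall>x\<in>fst ` M. f x = x)))" for M :: "('a \<times> bool) set"
  define M0 where "M0 = (\<lambda>x. (x, q x)) ` D0"
  define ok where "ok M \<longleftrightarrow> fst ` M \<subseteq> V \<and> M0 \<subseteq> M \<and> (\<forall>x\<in>fst ` M. N x \<inter> fst ` M \<noteq> {}) \<and>
    (\<forall>S\<in>bad. \<not> S \<subseteq> M) \<and> fixes' M" for M
  have okD: "fst ` M \<subseteq> V" "M0 \<subseteq> M" "\<And>x. x \<in> fst ` M \<Longrightarrow> N x \<inter> fst ` M \<noteq> {}"
    "\<And>S. S \<in> bad \<Longrightarrow> \<not> S \<subseteq> M" "fixes' M" if "ok M" for M
    using that unfolding ok_def by blast+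
  have fst_M0: "fst ` M0 = D0" unfolding M0_def by force
  have fin_bad: "finite S" if "S \<in> bad" for S using that unfolding bad_def by auto
  have ok0: "ok M0"
    unfolding ok_def
  proof (intro conjI ballI)
    show "fst ` M0 \<subseteq> V" using fst_M0 D0 by auto
    show "fixes' M0" unfolding fixes'_def fst_M0 using D0_fix by blast
    show "\<not> S \<subseteq> M0" if "S \<in> bad" for S
      using that D0(1) unfolding bad_def M0_def by auto
  qed (use fst_M0 D0 in auto)
  have chain: "ok (\<Union>C)" if C: "C \<noteq> {}" "subset.chain (Collect ok) C" for C
  proof -
    have okC: "ok M" if "M \<in> C" for M using C(2) that by (auto simp: subset.chain_def)
    show ?thesis unfolding ok_def
    proof (intro conjI ballI)
      show "fst ` \<Union>C \<subseteq> V" using okC unfolding ok_def by blast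
      show "M0 \<subseteq> \<Union>C" using okC C(1) unfolding ok_def by blast
      show "N x \<inter> fst ` \<Union>C \<noteq> {}" if "x \<in> fst ` \<Union>C" for x
      proof -
        obtain M where "M \<in> C" "x \<in> fst ` M" using \<open>x \<in> fst ` \<Union>C\<close> by blast
        then have "N x \<inter> fst ` M \<noteq> {}" using okD(3)[OF okC] by blast
        then show ?thesis using \<open>M \<in> C\<close> by blast
      qed
      show "\<not> S \<subseteq> \<Union>C" if "S \<in> bad" for S
      proof
        assume "S \<subseteq> \<Union>C"
        then obtain M where "M \<in> C" "S \<subseteq> M"
          using finite_subset_Union_chain[OF fin_bad[OF \<open>S \<in> bad\<close>] _ C] by blast
        then show False using okD(4)[OF okC that] by blast
      qed
      show "fixes' (\<Union>C)" unfolding fixes'_def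
      proof (intro allI impI ballI)
        fix c f x assume *: "\<forall>x b. (x, b) \<in> \<Union>C \<longrightarrow> c x = b" "f \<in> F" "\<forall>x\<in>V. c (f x) = c x"
          "x \<in> fst ` \<Union>C"
        then obtain M where M: "M \<in> C" "x \<in> fst ` M" by blast
        then have "\<forall>x b. (x, b) \<in> M \<longrightarrow> c x = b" using *(1) by blast
        have "fixes' M" using okD(5)[OF okC[OF M(1)]] .
        then show "f x = x" using \<open>\<forall>x b. (x, b) \<in> M \<longrightarrow> c x = b\<close> M(2) *(2,3)
          unfolding fixes'_def by blast
      qed
    qed
  qed
  obtain M where M: "ok M" and max: "\<And>X. ok X \<Longrightarrow> M \<subseteq> X \<Longrightarrow> X = M"
    using subset_Zorn_nonempty[of "Collect ok"] ok0 chain by auto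
  let ?D = "fst ` M"
  have sv: "\<not> ((x, True) \<in> M \<and> (x, False) \<in> M)" for x
    using okD(4)[OF M, of "{(x, True), (x, False)}"] unfolding bad_def by blast
  define c where "c x \<longleftrightarrow> (x, True) \<in> M" for x
  have cM: "c x = b" if "(x, b) \<in> M" for x b
    using that sv[of x] unfolding c_def by (cases b) auto
  have Mc: "(x, c x) \<in> M" if "x \<in> ?D" for x
    using that cM by force
  have fixD: "f x = x" if "\<forall>x b. (x, b) \<in> M \<longrightarrow> c' x = b" "f \<in> F" "\<forall>x\<in>V. c' (f x) = c' x" "x \<in> ?D"
    for c' f x
    using okD(5)[OF M] that unfolding fixes'_def by blast
  have cQ: "c x = q x" if "x \<in> Q" "x \<in> ?D" for x
  proof (rule ccontr)
    assume "c x \<noteq> q x"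
    then have "{(x, \<not> q x)} \<subseteq> M" using Mc[OF that(2)] by auto
    moreover have "{(x, \<not> q x)} \<in> bad" using that(1) unfolding bad_def by blast
    ultimately show False using okD(4)[OF M] by blast
  qed
  have cP: "c x \<noteq> c y" if "{x, y} \<in> PP" "x \<noteq> y" "x \<notin> Q" "y \<notin> Q" "x \<in> ?D" "y \<in> ?D" for x y
  proof
    assume "c x = c y"
    then have "{(x, c x), (y, c x)} \<subseteq> M" using Mc[of x] Mc[of y] that(5,6) by simp
    moreover have "{(x, c x), (y, c x)} \<in> bad" unfolding bad_def using that by blast
    ultimately show False using okD(4)[OF M] by blast
  qed
  have DV: "?D = V"
  proof (rule ccontr)
    assume neq: "?D \<noteq> V"
    have D: "D0 \<subseteq> ?D" "?D \<subseteq> V" "\<And>x. x \<in> ?D \<Longrightarrow> N x \<inter> ?D \<noteq> {}"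
      using okD(1,2,3)[OF M] fst_M0 by blast+
    obtain p where p: "p \<in> ?D" "N p - ?D \<noteq> {}" and pQ: "\<And>u u' f. u \<in> N p - ?D \<Longrightarrow> u' \<in> N p - ?D \<Longrightarrow>
        u \<noteq> u' \<Longrightarrow> u \<in> Q \<Longrightarrow> u' \<in> Q \<Longrightarrow> q u = q u' \<Longrightarrow> f \<in> F \<Longrightarrow> (\<forall>x\<in>?D. f x = x) \<Longrightarrow> f u = u"
      using step[OF D(1,2) neq D(3)] by metis
    define single where "single u \<longleftrightarrow> (\<forall>f\<in>F. (\<forall>x\<in>?D. f x = x) \<longrightarrow> f u = u)" for u
    \<comment> \<open>Maximality refutes every proper enlargement by neighbors of \<open>p\<close>
      that avoids the forbidden patterns and has its new vertices fixed. The two constructions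
      below, with one and with two new vertices, are such enlargements.\<close>
    have grow: False if M': "M \<subset> M'" "fst ` M' \<subseteq> V" "\<And>x. x \<in> fst ` M' \<Longrightarrow> x \<in> ?D \<or> x \<in> N p"
      "\<And>S. S \<in> bad \<Longrightarrow> \<not> S \<subseteq> M'"
      "\<And>c' f x. (\<forall>x b. (x, b) \<in> M' \<longrightarrow> c' x = b) \<Longrightarrow> f \<in> F \<Longrightarrow> (\<forall>x\<in>V. c' (f x) = c' x) \<Longrightarrow>
        (\<forall>x\<in>?D. f x = x) \<Longrightarrow> x \<in> fst ` M' \<Longrightarrow> x \<notin> ?D \<Longrightarrow> f x = x" for M'
    proof -
      have "ok M'" unfolding ok_def
      proof (intro conjI)
        show "M0 \<subseteq> M'" using okD(2)[OF M] M'(1) by blast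
        show "\<forall>x\<in>fst ` M'. N x \<inter> fst ` M' \<noteq> {}"
        proof
          fix x assume "x \<in> fst ` M'"
          then consider "x \<in> ?D" | "p \<in> N x" using M'(3) N_sym by metis
          then show "N x \<inter> fst ` M' \<noteq> {}" using D(3)[of x] M'(1) p(1) by cases blast+
        qed
        show "fixes' M'" unfolding fixes'_def
        proof (intro allI impI ballI)
          fix c' f x assume *: "\<forall>x b. (x, b) \<in> M' \<longrightarrow> c' x = b" "f \<in> F" "\<forall>x\<in>V. c' (f x) = c' x"
            "x \<in> fst ` M'"
          have "\<forall>x b. (x, b) \<in> M \<longrightarrow> c' x = b" using *(1) M'(1) by blast
          then have "\<forall>x\<in>?D. f x = x" using fixD *(2,3) by blast
          then show "f x = x" using M'(5)[of c' f x] * by blast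
        qed
      qed (use M' in auto)
      then show False using max[of M'] M'(1) by blast
    qed
    have single_step: False if u: "u \<in> N p - ?D" "single u" for u
    proof -
      \<comment> \<open>A vertex that is fixed anyway may take any color, so it takes the prescribed
        one or the opposite of its partner's. By \<open>PP_disj\<close> there is at most one partner
        to respect.\<close>
      define \<beta> where "\<beta> = (if u \<in> Q then q u else \<not> (\<exists>y\<in>?D. {u, y} \<in> PP \<and> c y))"
      let ?M = "insert (u, \<beta>) M"
      show False
      proof (rule grow[of ?M])
        show "M \<subset> ?M" using u by force
        show "fst ` ?M \<subseteq> V" using u D(2) N_V by auto
        show "x \<in> ?D \<or> x \<in> N p" if "x \<in> fst ` ?M" for x using that u by auto
        show "f x = x" if "f \<in> F" "\<forall>x\<in>?D. f x = x" "x \<in> fst ` ?M" "x \<notin> ?D" for f x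
          using that u(2) unfolding single_def by auto
        show "\<not> S \<subseteq> ?M" if S: "S \<in> bad" for S
        proof
          assume SM: "S \<subseteq> ?M"
          have nS: "\<not> S \<subseteq> M" using okD(4)[OF M S] .
          have nu: "(u, b) \<notin> M" for b using u(1) by force
          consider (a) x where "S = {(x, True), (x, False)}" | (b) x
            where "S = {(x, \<not> q x)}" "x \<in> Q"
            | (c) x y b where "S = {(x, b), (y, b)}" "{x, y} \<in> PP" "x \<noteq> y" "x \<notin> Q" "y \<notin> Q"
            using S unfolding bad_def by blast
          then show False
          proof cases
            case a
            then show ?thesis using SM nS nu by auto
          next
            case b
            then show ?thesis using SM nS nu unfolding \<beta>_def by auto
          next
            case c
            have *: False if "y' \<in> ?D" "{u, y'} \<in> PP" "u \<notin> Q" "c y' = \<beta>" for y'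
            proof -
              have "(\<exists>y\<in>?D. {u, y} \<in> PP \<and> c y) = c y'"
              proof
                assume "\<exists>y\<in>?D. {u, y} \<in> PP \<and> c y"
                then show "c y'" using PP_disj[OF that(2)] by metis
              qed (use that(1,2) in blast)
              then have "\<beta> = (\<not> c y')" unfolding \<beta>_def using that(3) by simp
              then show False using that(4) by simp
            qed
            consider "x = u" "b = \<beta>" "(y, \<beta>) \<in> M" | "y = u" "b = \<beta>" "(x, \<beta>) \<in> M"
              using SM nS c(1,3) nu by auto
            then show ?thesis
            proof cases
              case 1 then show ?thesis using *[of y] c cM[OF 1(3)] by (metis fst_conv image_eqI)
            next
              case 2 then show ?thesis using *[of x] c cM[OF 2(3)]
                by (metis fst_conv image_eqI insert_commute)
            qed
          qed
        qed
      qed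
    qed
    then have nsingle: "\<not> single u" if "u \<in> N p - ?D" for u using that by blast
    obtain u where u: "u \<in> N p - ?D" using p(2) by blast
    obtain e where e: "e \<in> N p \<inter> ?D" using D(3)[OF p(1)] by blast
    have pV: "p \<in> V" using p(1) D(2) by blast
    obtain u' where Np: "N p = {e, u, u'}" "e \<noteq> u'" "u \<noteq> u'"
      using N3'[OF pV, of e u] e u by blast
    have fN: "f u \<in> {u, u'} \<and> f u' \<in> {u, u', e}" if "f \<in> F" "\<forall>x\<in>?D. f x = x" for f
    proof -
      have fA: "f \<in> A" using that F by blast
      have "f p = p" "f e = e" using that p(1) e by auto
      then have "f u \<in> N p" "f u' \<in> N p" using A_N[OF fA, of _ p] Np by auto
      moreover have "f u \<noteq> e" using \<open>f e = e\<close> A_inj[OF fA, of u e] e u by auto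
      ultimately show ?thesis using Np by auto
    qed
    have u'D: "u' \<in> N p - ?D"
    proof (rule ccontr)
      assume "u' \<notin> N p - ?D"
      then have "u' \<in> ?D" using Np by auto
      then have "single u" unfolding single_def using fN A_inj F Np(3)
        by (metis insertE singletonD subsetD)
      then show False using nsingle u by blast
    qed
    have swap: "f u \<in> {u, u'} \<and> f u' \<in> {u, u'}" if "f \<in> F" "\<forall>x\<in>?D. f x = x" for f
    proof -
      have "f u' \<noteq> e" using that e u'D A_inj F by (metis DiffD2 IntD2 subsetD)
      then show ?thesis using fN[OF that] by auto
    qed
    have partner: "y \<notin> ?D" if "{w, y} \<in> PP" "w = u \<or> w = u'" for w y
    proof
      assume yD: "y \<in> ?D"
      have "single w" unfolding single_def
      proof (intro ballI impI)
        fix f assume f: "f \<in> F" "\<forall>x\<in>?D. f x = x"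
        have "{f w, y} \<in> PP" using PP_inv[OF f(1) that(1)] f(2) yD by auto
        then show "f w = w" using PP_disj[of y "f w" w] that(1) by (simp add: insert_commute)
      qed
      then show False using nsingle u u'D that(2) by auto
    qed
    have notQ: "\<not> (u \<in> Q \<and> u' \<in> Q \<and> q u = q u')"
    proof
      assume "u \<in> Q \<and> u' \<in> Q \<and> q u = q u'"
      then have "single u" unfolding single_def using pQ[OF u u'D Np(3)] by blast
      then show False using nsingle u by blast
    qed
    \<comment> \<open>If one of the two colors is prescribed, it determines the other; if both are,
      \<open>notQ\<close> says that they are opposite already.\<close>
    define \<beta> where "\<beta> = (if u \<in> Q then q u else if u' \<in> Q then \<not> q u' else True)"
    let ?M = "insert (u, \<beta>) (insert (u', \<not> \<beta>) M)"
    show False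
    proof (rule grow[of ?M])
      show "M \<subset> ?M" using u by force
      show "fst ` ?M \<subseteq> V" using u u'D D(2) N_V by auto
      show "x \<in> ?D \<or> x \<in> N p" if "x \<in> fst ` ?M" for x using that u u'D by auto
      show "f x = x" if c': "\<forall>x b. (x, b) \<in> ?M \<longrightarrow> c' x = b" and f: "f \<in> F" "\<forall>x\<in>V. c' (f x) = c' x"
        "\<forall>x\<in>?D. f x = x" and x: "x \<in> fst ` ?M" "x \<notin> ?D" for c' f x
      proof -
        have "c' u = \<beta>" "c' u' = (\<not> \<beta>)" using c' by auto
        moreover have "c' (f u) = c' u" "c' (f u') = c' u'" using f(2) u u'D N_V by auto
        ultimately have "f u = u" "f u' = u'" using swap[OF f(1,3)] by auto
        then show ?thesis using x by auto
      qed
      show "\<not> S \<subseteq> ?M" if S: "S \<in> bad" for S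
      proof
        assume SM: "S \<subseteq> ?M"
        have nS: "\<not> S \<subseteq> M" using okD(4)[OF M S] .
        have nu: "(u, b) \<notin> M" "(u', b) \<notin> M" for b using u u'D by force+
        consider (a) x where "S = {(x, True), (x, False)}" | (b) x where "S = {(x, \<not> q x)}" "x \<in> Q"
          | (c) x y b where "S = {(x, b), (y, b)}" "{x, y} \<in> PP" "x \<noteq> y" "x \<notin> Q" "y \<notin> Q"
          using S unfolding bad_def by blast
        then show False
        proof cases
          case a
          then show ?thesis using SM nS nu Np(3) by auto
        next
          case b
          then show ?thesis using SM nS nu Np(3) notQ unfolding \<beta>_def by (auto split: if_splits)
        next
          case c
          have yx: "{y, x} \<in> PP" using c(2) by (simp add: insert_commute)
          have *: "z \<in> ?D \<or> z = u \<or> z = u'" if "(z, b) \<in> ?M" for z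
          proof -
            have "z = u \<or> z = u' \<or> (z, b) \<in> M" using that by auto
            then show ?thesis using image_eqI[of z fst "(z, b)" M] by auto
          qed
          have "(x, b) \<in> ?M" "(y, b) \<in> ?M" using SM c(1) by auto
          then have "x \<in> ?D \<or> x = u \<or> x = u'" "y \<in> ?D \<or> y = u \<or> y = u'" using * by blast+
          then have "x \<in> ?D \<and> y \<in> ?D \<or> x = u \<and> y = u' \<or> x = u' \<and> y = u"
            using partner[OF c(2)] partner[OF yx] c(3) by blast
          then show ?thesis
          proof (elim disjE)
            assume *: "x \<in> ?D \<and> y \<in> ?D"
            then have "x \<noteq> u" "x \<noteq> u'" "y \<noteq> u" "y \<noteq> u'" using u u'D by auto
            then show False using SM c(1) nS by auto
          qed (use SM c(1) nu Np(3) in auto)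
        qed
      qed
    qed
  qed
  have h1: "c x = q x" if "x \<in> Q" for x using cQ that D0(2) DV by blast
  have h2: "c x \<noteq> c y" if xy: "{x, y} \<in> PP" "x \<noteq> y" "x \<notin> Q" "y \<notin> Q" for x y
  proof -
    have "{y, x} \<in> PP" using xy(1) by (simp add: insert_commute)
    then show ?thesis using cP[OF xy] DV PPV[OF xy(1)] PPV[of y x] by simp
  qed
  have h3: "\<forall>x\<in>V. f x = x" if "f \<in> F" "\<forall>x\<in>V. c (f x) = c x" for f
    using fixD[of c f] that cM DV by blast
  have "good_coloring F Q q PP c" unfolding good_coloring_def
  proof (intro conjI ballI allI impI)
    show "c x = q x" if "x \<in> Q" for x using h1 that .
    show "c x \<noteq> c y" if "{x, y} \<in> PP" "x \<noteq> y" "x \<notin> Q" "y \<notin> Q" for x y using h2 that .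
    show "f x = x" if "f \<in> F" "\<forall>x\<in>V. c (f x) = c x" "x \<in> V" for f x using h3 that by blast
  qed
  then show ?thesis by (rule exI[of "\<lambda>c. good_coloring F Q q PP c" c])
qed

section \<open>Types of vertices\<close>

lemma frontier:
  assumes "D \<noteq> {}" "D \<subseteq> V" "D \<noteq> V"
  obtains p where "p \<in> D" "N p - D \<noteq> {}"
  using closed_eq_V[OF assms(1,2)] assms(3) by blast

definition pinned :: "'a \<Rightarrow> 'a \<Rightarrow> bool" where
  "pinned v x \<longleftrightarrow> (\<forall>f\<in>A. f v = v \<longrightarrow> f x = x)"

text \<open>The vertices of type 1, 2, 3 are those with \<open>rigid\<close>, \<open>two\<close>, \<open>regular\<close>; a \<open>transitive\<close> vertex
  has type 3 or 6.\<close>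

definition rigid :: "'a \<Rightarrow> bool" where
  "rigid v \<longleftrightarrow> v \<in> V \<and> (\<forall>x\<in>N v. pinned v x)"

definition two :: "'a \<Rightarrow> bool" where
  "two v \<longleftrightarrow> v \<in> V \<and> (\<exists>x\<in>N v. pinned v x) \<and> (\<exists>x\<in>N v. \<not> pinned v x)"

definition transitive :: "'a \<Rightarrow> bool" where
  "transitive v \<longleftrightarrow> v \<in> V \<and> (\<forall>x\<in>N v. \<forall>y\<in>N v. \<exists>f\<in>A. f v = v \<and> f x = y)"

definition regular :: "'a \<Rightarrow> bool" where
  "regular v \<longleftrightarrow> transitive v \<and> (\<forall>f\<in>A. \<forall>x\<in>N v. f v = v \<longrightarrow> f x = x \<longrightarrow> (\<forall>y\<in>N v. f y = y))"

text \<open>Meaningful only for \<open>two v\<close>, where the fixed neighbor is unique.\<close>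

definition s :: "'a \<Rightarrow> 'a" where
  "s v = (THE x. x \<in> N v \<and> pinned v x)"

definition t :: "'a \<Rightarrow> 'a set" where
  "t v = N v - {s v}"

section \<open>Orbits, and how the local notions behave under automorphisms\<close>

definition orb :: "'a \<Rightarrow> 'a set" where
  "orb v = {f v | f. f \<in> A}"

lemma orb_refl: "v \<in> orb v"
  using A_id by (auto simp: orb_def intro!: exI[of _ id])

lemma orbI: "f \<in> A \<Longrightarrow> f v \<in> orb v"
  unfolding orb_def by blast

lemma orbE: "x \<in> orb v \<Longrightarrow> (\<And>f. f \<in> A \<Longrightarrow> x = f v \<Longrightarrow> P) \<Longrightarrow> P"
  unfolding orb_def by blast

lemma orb_A: "f \<in> A \<Longrightarrow> f x \<in> orb v \<longleftrightarrow> x \<in> orb v"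
proof
  assume f: "f \<in> A"
  { assume "f x \<in> orb v"
    then obtain h where h: "h \<in> A" "f x = h v" by (rule orbE)
    obtain g where g: "g \<in> A" "\<And>x. g (f x) = x" using A_inv[OF f] by metis
    have "x = (g \<circ> h) v" using g(2) h(2) by (metis comp_apply)
    then show "x \<in> orb v" using orbI A_comp g(1) h(1) by metis }
  { assume "x \<in> orb v"
    then obtain h where h: "h \<in> A" "x = h v" by (rule orbE)
    then have "f x = (f \<circ> h) v" by simp
    then show "f x \<in> orb v" using orbI A_comp f h(1) by metis }
qed

lemma orb_V: "v \<in> V \<Longrightarrow> orb v \<subseteq> V"
  unfolding orb_def using A_V by blast

lemma orb_sym: "x \<in> orb v \<longleftrightarrow> v \<in> orb x"
proof -
  have "v \<in> orb x" if x: "x \<in> orb v" for x v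
  proof -
    obtain f where f: "f \<in> A" "x = f v" using x by (rule orbE)
    then have "f v \<in> orb x" using orb_refl by simp
    then show ?thesis using orb_A[OF f(1)] by blast
  qed
  then show ?thesis by blast
qed

lemma orb_eq: "x \<in> orb v \<Longrightarrow> orb x = orb v"
proof -
  have "orb x \<subseteq> orb v" if "x \<in> orb v" for x v
    using orb_A that by (auto elim!: orbE[of _ x])
  moreover assume "x \<in> orb v"
  ultimately show ?thesis using orb_sym by blast
qed

lemma pinned_A: "f \<in> A \<Longrightarrow> pinned (f v) (f x) \<longleftrightarrow> pinned v x"
proof -
  have *: "pinned (f v) (f x)" if f: "f \<in> A" and p: "pinned v x" for f v x
    unfolding pinned_def
  proof (intro ballI impI)
    fix h assume h: "h \<in> A" "h (f v) = f v"
    obtain g where g: "g \<in> A" "\<And>x. g (f x) = x" "\<And>x. f (g x) = x" using A_inv[OF f] by metis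
    have "g \<circ> h \<circ> f \<in> A" using A_comp g(1) f h(1) by blast
    moreover have "(g \<circ> h \<circ> f) v = v" using g h by simp
    ultimately have "(g \<circ> h \<circ> f) x = x" using p unfolding pinned_def by blast
    then show "h (f x) = f x" using g(3) by (metis comp_apply)
  qed
  assume f: "f \<in> A"
  obtain g where g: "g \<in> A" "\<And>x. g (f x) = x" using A_inv[OF f] by metis
  show ?thesis using *[OF f, of v x] *[OF g(1), of "f v" "f x"] g(2) by metis
qed

lemma pinnedD: "pinned v x \<Longrightarrow> f \<in> A \<Longrightarrow> f v = v \<Longrightarrow> f x = x"
  unfolding pinned_def by blast

lemma rigidD: "rigid v \<Longrightarrow> x \<in> N v \<Longrightarrow> pinned v x"
  unfolding rigid_def by blast

lemma transitiveD:
  assumes "transitive v" "x \<in> N v" "y \<in> N v"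
  obtains f where "f \<in> A" "f v = v" "f x = y"
  using assms unfolding transitive_def by blast

lemma regularD:
  "regular v \<Longrightarrow> f \<in> A \<Longrightarrow> f v = v \<Longrightarrow> x \<in> N v \<Longrightarrow> f x = x \<Longrightarrow> y \<in> N v \<Longrightarrow> f y = y"
  unfolding regular_def by blast

text \<open>An element of the stabilizer that moves \<open>a\<close> and fixes \<open>x\<close> must
  exchange the two neighbors other than \<open>x\<close>. Neither of these is pinned, so
  \<open>x\<close> is the only candidate for \<open>s v\<close>.\<close>

lemma two_cases:
  assumes "two v"
  obtains a b g where "N v = {s v, a, b}" "s v \<noteq> a" "s v \<noteq> b" "a \<noteq> b" "pinned v (s v)"
    "g \<in> A" "g v = v" "g a = b" "g b = a"
proof -
  obtain x a where x: "v \<in> V" "x \<in> N v" "pinned v x" and a: "a \<in> N v" "\<not> pinned v a"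
    using assms unfolding two_def by blast
  then obtain g where g: "g \<in> A" "g v = v" "g a \<noteq> a" unfolding pinned_def by blast
  have "x \<noteq> a" using x a by blast
  then obtain b where b: "N v = {x, a, b}" "x \<noteq> b" "a \<noteq> b" using N3'[of v x a] x a by metis
  have gx: "g x = x" using pinnedD x(3) g by blast
  have gN: "g y \<in> N v" if "y \<in> N v" for y using A_N[OF g(1), of y v] that g(2) by simp
  have "g a \<noteq> x" using gx A_inj[OF g(1)] \<open>x \<noteq> a\<close> by metis
  then have ga: "g a = b" using gN[OF a(1)] b g(3) by auto
  have "g b \<noteq> x" using gx A_inj[OF g(1)] b(2) by metis
  moreover have "g b \<noteq> b" using ga A_inj[OF g(1)] b(3) by metis
  ultimately have gb: "g b = a" using gN[of b] b by auto
  have "\<not> pinned v b" using g gb b(3) unfolding pinned_def by metis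
  then have "s v = x" unfolding s_def using x a b by (intro the_equality) auto
  then show thesis using that[of a b g] b \<open>x \<noteq> a\<close> x(3) g ga gb by simp
qed

lemma two_V: "two v \<Longrightarrow> v \<in> V"
  unfolding two_def by blast

lemma s_N: "two v \<Longrightarrow> s v \<in> N v"
  by (metis insertI1 two_cases)

lemma s_pinned: "two v \<Longrightarrow> pinned v (s v)"
  by (metis two_cases)

lemma s_eqI: "two v \<Longrightarrow> x \<in> N v \<Longrightarrow> pinned v x \<Longrightarrow> s v = x"
proof -
  assume a: "two v" "x \<in> N v" "pinned v x"
  obtain a b g where "N v = {s v, a, b}" "a \<noteq> b" "g \<in> A" "g v = v" "g a = b" "g b = a"
    using two_cases[OF a(1)] by metis
  then show ?thesis using a(2,3) unfolding pinned_def by auto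
qed

lemma t_iff: "x \<in> t v \<longleftrightarrow> x \<in> N v \<and> x \<noteq> s v"
  unfolding t_def by auto

lemma t_cases:
  assumes "two v"
  obtains a b where "t v = {a, b}" "a \<noteq> b"
proof -
  obtain a b where "N v = {s v, a, b}" "s v \<noteq> a" "s v \<noteq> b" "a \<noteq> b"
    using two_cases[OF assms] by metis
  then have "t v = {a, b}" unfolding t_def by auto
  then show thesis using that \<open>a \<noteq> b\<close> by blast
qed

lemma t_cases':
  assumes "two v" "a \<in> t v"
  obtains b g where "t v = {a, b}" "a \<noteq> b" "N v = {s v, a, b}" "s v \<noteq> a" "s v \<noteq> b"
    "g \<in> A" "g v = v" "g a = b" "g b = a"
proof -
  obtain x y g where *: "N v = {s v, x, y}" "s v \<noteq> x" "s v \<noteq> y" "x \<noteq> y"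
    "g \<in> A" "g v = v" "g x = y" "g y = x"
    using two_cases[OF assms(1)] by metis
  have "t v = {x, y}" using * unfolding t_def by auto
  then show thesis using that[of x g] that[of y g] * assms(2) by (auto simp: insert_commute)
qed

lemma t_N: "x \<in> t v \<Longrightarrow> x \<in> N v"
  by (simp add: t_iff)

lemma N_two: "two v \<Longrightarrow> N v = insert (s v) (t v)"
  using s_N unfolding t_def by blast

lemma two_stab:
  assumes "two v" "f \<in> A" "f v = v" "a \<in> t v" "f a = a" "x \<in> N v"
  shows "f x = x"
proof -
  obtain b where b: "N v = {s v, a, b}" "a \<noteq> b" "s v \<noteq> b" using t_cases'[OF assms(1,4)] by metis
  have s: "f (s v) = s v" using s_pinned assms(1-3) pinnedD by blast
  have "f b \<in> N v" using A_N[OF assms(2), of b v] b(1) assms(3) by simp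
  moreover have "f b \<noteq> a" "f b \<noteq> s v" using A_inj[OF assms(2)] s b assms(5) by metis+
  ultimately have "f b = b" using b(1) by auto
  then show ?thesis using s assms(5,6) b(1) by auto
qed

lemma two_A: "f \<in> A \<Longrightarrow> two (f v) \<longleftrightarrow> two v"
  unfolding two_def by (simp add: A_N_image A_V pinned_A)

lemma transitive_A: "f \<in> A \<Longrightarrow> transitive v \<Longrightarrow> transitive (f v)"
proof -
  assume f: "f \<in> A" and v: "transitive v"
  obtain g where g: "g \<in> A" "\<And>x. g (f x) = x" using A_inv[OF f] by metis
  have "\<exists>h\<in>A. h (f v) = f v \<and> h (f x) = f y" if xy: "x \<in> N v" "y \<in> N v" for x y
  proof -
    obtain h where "h \<in> A" "h v = v" "h x = y" using transitiveD[OF v xy] by metis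
    then show ?thesis using f g A_comp by (intro bexI[of _ "f \<circ> h \<circ> g"]) auto
  qed
  then show ?thesis using v A_V[OF f] unfolding transitive_def A_N_image[OF f] by simp
qed

lemma regular_A: "f \<in> A \<Longrightarrow> regular v \<Longrightarrow> regular (f v)"
proof -
  assume f: "f \<in> A" and v: "regular v"
  obtain g where g: "g \<in> A" "\<And>x. g (f x) = x" "\<And>x. f (g x) = x" using A_inv[OF f] by metis
  have "h (f y) = f y" if "h \<in> A" "x \<in> N v" "h (f v) = f v" "h (f x) = f x" "y \<in> N v" for h x y
  proof -
    have "(g \<circ> h \<circ> f) y = y"
      using regularD[OF v, of "g \<circ> h \<circ> f" x y] A_comp that f g by simp
    then show ?thesis using g(3) by (metis comp_apply)
  qed
  then have "\<forall>h\<in>A. \<forall>x\<in>N (f v). h (f v) = f v \<longrightarrow> h x = x \<longrightarrow> (\<forall>y\<in>N (f v). h y = y)"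
    unfolding A_N_image[OF f] by blast
  moreover have "transitive v" using v unfolding regular_def by blast
  ultimately show ?thesis using transitive_A[OF f] unfolding regular_def by blast
qed

lemma rigid_A: "f \<in> A \<Longrightarrow> rigid (f v) \<longleftrightarrow> rigid v"
  unfolding rigid_def by (simp add: A_N_image A_V pinned_A)

lemma s_A: "f \<in> A \<Longrightarrow> two v \<Longrightarrow> s (f v) = f (s v)"
  using s_eqI[of "f v" "f (s v)"] by (simp add: two_A s_N s_pinned pinned_A A_N)

lemma t_A: "f \<in> A \<Longrightarrow> two v \<Longrightarrow> t (f v) = f ` t v"
  unfolding t_def by (auto simp: s_A A_N_image A_inj)

lemma t_A_iff: "f \<in> A \<Longrightarrow> two v \<Longrightarrow> f x \<in> t (f v) \<longleftrightarrow> x \<in> t v"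
  by (auto simp: t_A A_inj)

text \<open>Without a pinned neighbor, no orbit of the stabilizer on the three neighbors is a
  singleton. A partition of three points without singletons has one class, so the local group is
  transitive.\<close>

lemma trichotomy:
  assumes "v \<in> V"
  obtains "rigid v" | "two v" | "transitive v"
proof (cases "\<exists>x\<in>N v. pinned v x")
  case True
  then show thesis using that(1,2) assms unfolding rigid_def two_def by blast
next
  case False
  define R where "R x y \<longleftrightarrow> (\<exists>f\<in>A. f v = v \<and> f x = y)" for x y
  have sym: "R y x" if "R x y" for x y
    using that A_inv unfolding R_def by metis
  have tr: "R x z" if "R x y" "R y z" for x y z
  proof -
    obtain f g where "f \<in> A" "f v = v" "f x = y" "g \<in> A" "g v = v" "g y = z"
      using \<open>R x y\<close> \<open>R y z\<close> unfolding R_def by blast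
    then show ?thesis unfolding R_def using A_comp by (intro bexI[of _ "g \<circ> f"]) auto
  qed
  have rf: "R x x" for x unfolding R_def using A_id by (metis id_apply)
  have mv: "\<exists>y\<in>N v. y \<noteq> x \<and> R x y" if x: "x \<in> N v" for x
  proof -
    obtain f where f: "f \<in> A" "f v = v" "f x \<noteq> x" using False x unfolding pinned_def by blast
    then have "f x \<in> N v" using A_N[OF f(1), of x v] x by simp
    then show ?thesis using f unfolding R_def by blast
  qed
  have "N v \<noteq> {}" using card_N[OF assms] by auto
  then obtain a b c where N: "N v = {a, b, c}" using N3[OF assms] by (metis ex_in_conv)
  have ne: "a \<noteq> b" "a \<noteq> c" "b \<noteq> c" using card_N[OF assms] N
    by (auto simp: card_insert_if split: if_splits)
  have "R a b \<or> R a c" "R b a \<or> R b c" "R c a \<or> R c b"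
    using mv[of a] mv[of b] mv[of c] N by auto
  then have "R a b \<and> R a c" using sym tr by blast
  then have "R a y" if "y \<in> N v" for y using that N rf by auto
  then have "\<forall>x\<in>N v. \<forall>y\<in>N v. R x y" using tr[OF sym] by metis
  then show thesis using that(3) assms unfolding transitive_def R_def by blast
qed

lemma transitive_not_pinned: "transitive v \<Longrightarrow> x \<in> N v \<Longrightarrow> \<not> pinned v x"
proof
  assume v: "transitive v" "x \<in> N v" "pinned v x"
  obtain b where "b \<in> N v" "b \<noteq> x" using N3[of v x] v N_V by (metis insertCI)
  then show False using transitiveD[OF v(1,2)] v(3) pinnedD by metis
qed

lemma two_not_transitive: "two v \<Longrightarrow> \<not> transitive v"
  using transitive_not_pinned s_N s_pinned by blast

text \<open>The other two cases are excluded by counting: a rigid vertex has the trivial local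
  group, and a transitive one has at least three elements in it.\<close>

lemma two_if_vertex_type_2:
  assumes "v \<in> V" "vertex_type G v = 2"
  shows "two v"
proof -
  let ?R = "(\<lambda>f. restrict f (N v)) ` stabilizer G v"
  have card: "card ?R = 2" using assms(2) unfolding vertex_type_def .
  then have fin: "finite ?R" by (metis card.infinite zero_neq_numeral)
  have idS: "id \<in> stabilizer G v" using A_id by (simp add: stabilizer_def)
  show ?thesis
  proof (rule trichotomy[OF assms(1)])
    assume r: "rigid v"
    have "restrict f (N v) = restrict id (N v)" if "f \<in> stabilizer G v" for f
      using that rigidD[OF r] by (auto simp: stabilizer_def restrict_def pinned_def)
    then have "?R = {restrict id (N v)}" using idS by blast
    then show ?thesis using card by simp
  next
    assume tr: "transitive v"
    obtain x where x: "x \<in> N v" using card_N[OF assms(1)] by fastforce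
    have "N v \<subseteq> (\<lambda>f. f x) ` ?R"
    proof
      fix y assume "y \<in> N v"
      then obtain f where f: "f \<in> A" "f v = v" "f x = y" using transitiveD[OF tr x] by metis
      then have "restrict f (N v) \<in> ?R" "restrict f (N v) x = y"
        using x by (auto simp: stabilizer_def)
      then show "y \<in> (\<lambda>f. f x) ` ?R" by (metis image_eqI)
    qed
    then have "card (N v) \<le> card ?R" using surj_card_le[OF fin] by blast
    then show ?thesis using card card_N[OF assms(1)] by simp
  qed
qed

text \<open>Order 3 excludes the rigid and the \<open>two\<close> case, where the order is at most
  2. A transitive group of order 3 on three points is in bijection with the points by evaluation, so
  only the identity has a fixed point.\<close>

lemma regular_if_vertex_type_3:
  assumes "v \<in> V" "vertex_type G v = 3"
  shows "regular v"
proof -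
  let ?R = "(\<lambda>f. restrict f (N v)) ` stabilizer G v"
  have card: "card ?R = 3" using assms(2) unfolding vertex_type_def .
  then have fin: "finite ?R" by (metis card.infinite zero_neq_numeral)
  have idS: "id \<in> stabilizer G v" using A_id by (simp add: stabilizer_def)
  have fN: "f x \<in> N v" if "f \<in> stabilizer G v" "x \<in> N v" for f x
    using that A_N[of f x v] by (simp add: stabilizer_def)
  show ?thesis
  proof (rule trichotomy[OF assms(1)])
    assume r: "rigid v"
    have "restrict f (N v) = restrict id (N v)" if "f \<in> stabilizer G v" for f
      using that rigidD[OF r] by (auto simp: stabilizer_def restrict_def pinned_def)
    then have "?R = {restrict id (N v)}" using idS by blast
    then show ?thesis using card by simp
  next
    assume tw: "two v"
    obtain a b g where ab: "N v = {s v, a, b}" "s v \<noteq> a" "s v \<noteq> b" "a \<noteq> b" "pinned v (s v)"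
      using two_cases[OF tw] by metis
    have *: "f (s v) = s v \<and> (f a = a \<and> f b = b \<or> f a = b \<and> f b = a)"
      if f: "f \<in> stabilizer G v" for f
    proof -
      have fA: "f \<in> A" "f v = v" using f by (auto simp: stabilizer_def)
      have "f (s v) = s v" using pinnedD[OF ab(5) fA] .
      moreover have "f a \<noteq> s v" "f b \<noteq> s v" "f a \<noteq> f b" using calculation A_inj[OF fA(1)] ab
        by metis+
      ultimately show ?thesis using fN[OF f, of a] fN[OF f, of b] ab(1) by auto
    qed
    have "inj_on (\<lambda>f. f a) ?R"
    proof (intro inj_onI)
      fix f' g' assume "f' \<in> ?R" "g' \<in> ?R" and eq: "f' a = g' a"
      then obtain f g where fg: "f \<in> stabilizer G v" "g \<in> stabilizer G v"
        "f' = restrict f (N v)" "g' = restrict g (N v)" by blast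
      then have "f a = g a" using eq ab(1) by simp
      then have "f x = g x" if "x \<in> N v" for x
        using *[OF fg(1)] *[OF fg(2)] that ab by auto
      then show "f' = g'" using fg(3,4) by (auto simp: restrict_def)
    qed
    then have "card ?R = card ((\<lambda>f. f a) ` ?R)" using card_image by fastforce
    moreover have "\<forall>f\<in>stabilizer G v. f a = a \<or> f a = b" using * by blast
    then have "(\<lambda>f. f a) ` ?R \<subseteq> {a, b}" using ab(1) by auto
    then have "card ((\<lambda>f. f a) ` ?R) \<le> card {a, b}" by (intro card_mono) auto
    ultimately show ?thesis using card ab(4) by simp
  next
    assume tr: "transitive v"
    have "f y = y" if f: "f \<in> A" "x \<in> N v" "f v = v" "f x = x" "y \<in> N v" for f x y
    proof -
      have "N v \<subseteq> (\<lambda>f. f x) ` ?R"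
      proof
        fix y assume "y \<in> N v"
        then obtain f where f: "f \<in> A" "f v = v" "f x = y" using transitiveD[OF tr \<open>x \<in> N v\<close>]
          by metis
        then have "restrict f (N v) \<in> ?R" "restrict f (N v) x = y"
          using \<open>x \<in> N v\<close> by (auto simp: stabilizer_def)
        then show "y \<in> (\<lambda>f. f x) ` ?R" by (metis image_eqI)
      qed
      moreover have "(\<lambda>f. f x) ` ?R \<subseteq> N v" using fN \<open>x \<in> N v\<close> by auto
      ultimately have "(\<lambda>f. f x) ` ?R = N v" by blast
      then have "card ((\<lambda>f. f x) ` ?R) = card ?R" using card card_N[OF assms(1)] by simp
      then have "inj_on (\<lambda>f. f x) ?R" using eq_card_imp_inj_on[OF fin] by blast
      moreover have "restrict f (N v) \<in> ?R" "restrict id (N v) \<in> ?R" using f idS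
        by (auto simp: stabilizer_def)
      moreover have "restrict f (N v) x = restrict id (N v) x" using f by simp
      ultimately have "restrict f (N v) = restrict id (N v)" using inj_onD by metis
      then show ?thesis using f(5) by (metis id_apply restrict_apply')
    qed
    then show ?thesis using tr unfolding regular_def by blast
  qed
qed

section \<open>Single seeds\<close>

lemma N_subset_orb: "N r \<subseteq> orb w \<Longrightarrow> x \<in> orb r \<Longrightarrow> N x \<subseteq> orb w"
proof -
  assume *: "N r \<subseteq> orb w" "x \<in> orb r"
  obtain f where f: "f \<in> A" "x = f r" using *(2) by (rule orbE)
  have "f y \<in> orb w" if "y \<in> N r" for y using orb_A[OF f(1), of y w] subsetD[OF *(1) that] by simp
  then show ?thesis unfolding f(2) A_N_image[OF f(1)] by blast
qed

lemma regular_orb: "regular r \<Longrightarrow> x \<in> orb r \<Longrightarrow> regular x"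
  using regular_A by (auto elim!: orbE)

text \<open>In the coloring, \<open>r\<close> is the only black vertex of its orbit and \<open>a\<close> the only black neighbor of \<open>r\<close>.\<close>

lemma free_orbit:
  assumes r: "r \<in> V" and a: "a \<in> N r" "a \<notin> orb r"
    and ra: "\<And>f y. f \<in> A \<Longrightarrow> f r = r \<Longrightarrow> f a = a \<Longrightarrow> y \<in> N r \<Longrightarrow> f y = y"
    and H: "\<And>p e u u' f. u \<in> orb r \<Longrightarrow> u' \<in> orb r \<Longrightarrow> N p = {e, u, u'} \<Longrightarrow> e \<noteq> u \<Longrightarrow> e \<noteq> u' \<Longrightarrow>
      u \<noteq> u' \<Longrightarrow> f \<in> A \<Longrightarrow> f p = p \<Longrightarrow> f e = e \<Longrightarrow> f u = u"
  shows "distinguishing_number G \<le> 2"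
proof -
  define D0 where "D0 = insert r (N r)"
  define Q where "Q = orb r \<union> N r"
  define F where "F = {f \<in> A. f r = r \<and> (\<forall>x\<in>N r. f x = x)}"
  have NrV: "N r \<subseteq> V" using N_V by blast
  have "\<exists>c. good_coloring F Q (\<lambda>x. x = r \<or> x = a) {} c"
  proof (rule extend_coloring[where ?D0.0 = D0])
    show "D0 \<subseteq> Q" unfolding D0_def Q_def using orb_refl by blast
    show "Q \<subseteq> V" unfolding Q_def using orb_V[OF r] NrV by blast
    show "N x \<inter> D0 \<noteq> {}" if "x \<in> D0" for x
      using that a N_sym unfolding D0_def by blast
    fix D assume D: "D0 \<subseteq> D" "D \<subseteq> V" "D \<noteq> V" "\<And>x. x \<in> D \<Longrightarrow> N x \<inter> D \<noteq> {}"
    have "D \<noteq> {}" using D(1) unfolding D0_def by blast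
    then obtain p where p: "p \<in> D" "N p - D \<noteq> {}" using frontier D(2,3) by blast
    obtain e where e: "e \<in> N p" "e \<in> D" using D(4)[OF p(1)] by blast
    \<comment> \<open>Since \<open>N r\<close> belongs to \<open>D0\<close>, two missing vertices
      with prescribed colors both lie in the orbit of \<open>r\<close>; this is the situation
      covered by \<open>H\<close>.\<close>
    have "f u = u"
      if "u \<in> N p - D" "u' \<in> N p - D" "u \<noteq> u'" "u \<in> Q" "u' \<in> Q" "f \<in> F" "\<forall>x\<in>D. f x = x" for u u' f
    proof (rule H[of u u' p e f])
      show "u \<in> orb r" "u' \<in> orb r" using that D(1) unfolding Q_def D0_def by blast+
      show "N p = {e, u, u'}" using N3_eq[of e p u u'] e that by blast
    qed (use that p e in \<open>auto simp: F_def\<close>)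
    then show "\<exists>p\<in>D. N p - D \<noteq> {} \<and> (\<forall>u\<in>N p - D. \<forall>u'\<in>N p - D. u \<noteq> u' \<longrightarrow> u \<in> Q \<longrightarrow> u' \<in> Q \<longrightarrow>
        (u = r \<or> u = a) = (u' = r \<or> u' = a) \<longrightarrow> (\<forall>f\<in>F. (\<forall>x\<in>D. f x = x) \<longrightarrow> f u = u))"
      using p by blast
  qed (auto simp: F_def D0_def)
  then obtain c where c: "good_coloring F Q (\<lambda>x. x = r \<or> x = a) {} c" by blast
  note cQ = good_coloringD(1)[OF c] and cP = good_coloringD(2)[OF c] and cF = good_coloringD(3)[OF c]
  show ?thesis
  proof (rule distinguishing_number_le_2I[of c])
    fix f assume f: "f \<in> A" "\<And>x. x \<in> V \<Longrightarrow> c (f x) = c x"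
    have fo: "f r \<in> orb r" using orbI[OF f(1)] .
    have "c r" using cQ[of r] orb_refl unfolding Q_def by blast
    then have "c (f r)" using f(2) r by blast
    then have "f r = r \<or> f r = a" using cQ[of "f r"] fo unfolding Q_def by blast
    then have fr: "f r = r" using fo a(2) by metis
    have "c a" using cQ[of a] a(1) unfolding Q_def by blast
    then have "c (f a)" using f(2) a(1) NrV by blast
    moreover have faN: "f a \<in> N r" using A_N[OF f(1), of a r] fr a(1) by simp
    ultimately have "f a = r \<or> f a = a" using cQ[of "f a"] unfolding Q_def by blast
    then have "f a = a" using faN N_irrefl by metis
    then have "f \<in> F" unfolding F_def using ra[OF f(1) fr] f(1) fr by blast
    then show "\<forall>x\<in>V. f x = x" using cF f(2) by blast
  qed
qed

text \<open>Here \<open>G\<close> is a single orbit of regular vertices, so an automorphism that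
  fixes a vertex and one of its neighbors is the identity. Hence the color of every vertex may be
  prescribed: a black path \<open>w, r, d\<close> on a white background suffices, because its middle
  vertex can be recognized.\<close>

lemma regular_adjacent_equivalent:
  assumes r: "regular r" and w: "w \<in> N r" "w \<in> orb r"
  shows "distinguishing_number G \<le> 2"
proof -
  have rV: "r \<in> V" using w N_V by blast
  have tr: "transitive r" using r unfolding regular_def by blast
  have Nr: "N r \<subseteq> orb r"
  proof
    fix x assume "x \<in> N r"
    then obtain f where "f \<in> A" "f w = x" using transitiveD[OF tr w(1)] by metis
    then show "x \<in> orb r" using orb_A w(2) by blast
  qed
  have "N x \<subseteq> orb r" if "x \<in> orb r" for x using N_subset_orb[OF Nr that] .
  then have V: "orb r = V" using closed_eq_V[of "orb r"] orb_refl orb_V[OF rV] by blast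
  have reg: "regular x" if "x \<in> V" for x using regular_orb[OF r, of x] that V by blast
  obtain d e where N: "N r = {w, d, e}" "w \<noteq> d" "w \<noteq> e" "d \<noteq> e" using N3[OF rV w(1)] by metis
  have id: "f x = x" if "f \<in> A" "f r = r" "y \<in> N r" "f y = y" "x \<in> N r" for f x y
    using regularD[OF r] that by blast
  have fN: "f x \<in> N r" if "f \<in> A" "f r = r" "x \<in> N r" for f x
    using A_N[of f x r] that by simp
  \<comment> \<open>If \<open>w\<close> and \<open>d\<close> were adjacent, transitivity at
    \<open>r\<close> would make \<open>N r\<close> a triangle and \<open>G\<close> complete. Then
    exchanging the twins \<open>w\<close> and \<open>d\<close> fixes \<open>r\<close> and
    \<open>e\<close>, against regularity.\<close>
  have wd: "d \<notin> N w"
  proof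
    assume dw: "d \<in> N w"
    obtain g where g: "g \<in> A" "g r = r" "g w = e" using transitiveD[OF tr, of w e] N by auto
    have "g d \<noteq> d" using id[of g d w] g N by auto
    then have "g d = w" using fN[OF g(1,2), of d] g N A_inj[OF g(1), of d w] by auto
    then have ew: "w \<in> N e" using A_N[OF g(1), of d w] dw g(3) by simp
    obtain h where h: "h \<in> A" "h r = r" "h d = e" using transitiveD[OF tr, of d e] N by auto
    have "h w \<noteq> w" using id[of h w d] h N by auto
    then have "h w = d" using fN[OF h(1,2), of w] h N A_inj[OF h(1), of d w] by auto
    then have ed: "e \<in> N d" using A_N[OF h(1), of d w] dw h(3) by simp
    have rN: "r \<in> N w" "r \<in> N d" using N N_sym by blast+
    have "r \<noteq> w" "r \<noteq> d" "r \<noteq> e" using N N_irrefl by blast+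
    have "N w = {r, d, e}" using N3_eq[of r w d e] rN dw ew N_sym N(2-4) \<open>r \<noteq> w\<close> \<open>r \<noteq> d\<close> \<open>r \<noteq> e\<close>
      by blast
    moreover have "N d = {r, w, e}"
      using N3_eq[of r d w e] rN dw ed N_sym N(2-4) \<open>r \<noteq> w\<close> \<open>r \<noteq> d\<close> \<open>r \<noteq> e\<close> by blast
    ultimately have "N w - {d} = N d - {w}" using N \<open>r \<noteq> w\<close> \<open>r \<noteq> d\<close> by auto
    moreover have "w \<in> V" "d \<in> V" using N N_V by blast+
    ultimately have \<tau>: "Transposition.transpose w d \<in> A" using transpose_in_A by blast
    have "Transposition.transpose w d w = w"
      using id[OF \<tau>, of e w] N \<open>r \<noteq> w\<close> \<open>r \<noteq> d\<close> by auto
    then show False using N by simp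
  qed
  define F where "F = {f \<in> A. f r = r \<and> (\<forall>x\<in>N r. f x = x)}"
  have NrV: "N r \<subseteq> V" using N_V by blast
  let ?q = "\<lambda>x. x = r \<or> x = w \<or> x = d"
  have "\<exists>c. good_coloring F V (?q) {} c"
  proof (rule extend_coloring[where ?D0.0 = "insert r (N r)"])
    show "insert r (N r) \<subseteq> V" using rV NrV by blast
    show "N x \<inter> insert r (N r) \<noteq> {}" if "x \<in> insert r (N r)" for x
      using that w N_sym by blast
    fix D assume D: "insert r (N r) \<subseteq> D" "D \<subseteq> V" "D \<noteq> V" "\<And>x. x \<in> D \<Longrightarrow> N x \<inter> D \<noteq> {}"
    have "D \<noteq> {}" using D(1) by blast
    then obtain p where p: "p \<in> D" "N p - D \<noteq> {}" using frontier D(2,3) by blast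
    obtain e where e: "e \<in> N p" "e \<in> D" using D(4)[OF p(1)] by blast
    have "f u = u" if "u \<in> N p - D" "f \<in> F" "\<forall>x\<in>D. f x = x" for u f
      using regularD[OF reg, of p f e u] that p e D(2) unfolding F_def by blast
    then show "\<exists>p\<in>D. N p - D \<noteq> {} \<and> (\<forall>u\<in>N p - D. \<forall>u'\<in>N p - D. u \<noteq> u' \<longrightarrow> u \<in> V \<longrightarrow> u' \<in> V \<longrightarrow>
        ?q u = ?q u' \<longrightarrow> (\<forall>f\<in>F. (\<forall>x\<in>D. f x = x) \<longrightarrow> f u = u))"
      using p by blast
  qed (auto simp: F_def)
  then obtain c where c: "good_coloring F V (?q) {} c" by blast
  note cQ = good_coloringD(1)[OF c] and cP = good_coloringD(2)[OF c] and cF = good_coloringD(3)[OF c]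
  show ?thesis
  proof (rule distinguishing_number_le_2I[of c])
    fix f assume f: "f \<in> A" "\<And>x. x \<in> V \<Longrightarrow> c (f x) = c x"
    have q: "?q (f x)" if "?q x" for x
    proof -
      have "x \<in> V" using that rV NrV N by blast
      then show ?thesis using cQ[of x] cQ[of "f x"] f(2) A_V[OF f(1)] that by blast
    qed
    have adj: "f w \<in> N (f r)" "f d \<in> N (f r)" using A_N[OF f(1)] N by blast+
    have "w \<noteq> r" "d \<noteq> r" using N N_irrefl by blast+
    then have ne: "f w \<noteq> f r" "f d \<noteq> f r" "f w \<noteq> f d" using N(2) by (simp_all add: A_inj[OF f(1)])
    \<comment> \<open>The image of \<open>r\<close> is black and has two black neighbors;
      \<open>w\<close> and \<open>d\<close> have only one.\<close>
    have fr: "f r = r"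
    proof (rule ccontr)
      assume "f r \<noteq> r"
      then have "f r = w \<or> f r = d" using q[of r] by blast
      then show False
      proof
        assume *: "f r = w"
        then have "f w = d \<or> f d = d" using q[of w] q[of d] ne by metis
        then show False using adj * wd by metis
      next
        assume *: "f r = d"
        then have "f w = w \<or> f d = w" using q[of w] q[of d] ne by metis
        then show False using adj * wd N_sym by metis
      qed
    qed
    have "f w \<in> {w, d}" "f d \<in> {w, d}" using q[of w] q[of d] ne fr by auto
    moreover have "f e \<in> N r" using fN[OF f(1) fr] N by blast
    moreover have "f e \<noteq> f w" "f e \<noteq> f d" using N(2-4) by (auto simp: A_inj[OF f(1)])
    ultimately have "f e = e" using N ne by auto
    then have "f x = x" if "x \<in> N r" for x using id[OF f(1) fr, of e x] that N by blast
    then have "f \<in> F" unfolding F_def using f(1) fr by blast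
    then show "\<forall>x\<in>V. f x = x" using cF f(2) by blast
  qed
qed

text \<open>The map \<open>\<phi>\<close> forces all of \<open>N w\<close> into
  \<open>orb r\<close>, and \<open>N r\<close> lies in \<open>orb w\<close>, so every edge joins
  these two orbits. A vertex of \<open>orb w\<close> is always approached from a regular vertex,
  which allows all colors on \<open>orb w\<close> to be prescribed. The only black vertices there
  are \<open>w\<close> and \<open>d\<close>, and \<open>r\<close> is their unique common
  neighbor.\<close>

lemma regular_beside_irregular:
  assumes r: "regular r" and w: "w \<in> N r" "w \<notin> orb r"
    and \<phi>: "\<phi> \<in> A" "\<phi> w = w" "\<phi> r = r" and y: "y \<in> N w" "y \<in> orb r" "\<phi> y \<noteq> y"
  shows "distinguishing_number G \<le> 2"
proof -
  have rV: "r \<in> V" using w N_V by blast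
  have tr: "transitive r" using r unfolding regular_def by blast
  have Nr: "N r \<subseteq> orb w"
  proof
    fix x assume "x \<in> N r"
    then obtain f where "f \<in> A" "f w = x" using transitiveD[OF tr w(1)] by metis
    then show "x \<in> orb w" using orbI by blast
  qed
  have NO: "N x \<subseteq> orb w" if "x \<in> orb r" for x using N_subset_orb[OF Nr that] .
  have reg: "regular x" if "x \<in> orb r" for x using regular_orb[OF r that] .
  have rNw: "r \<in> N w" using w N_sym by blast
  have "\<phi> y \<in> N w" using A_N[OF \<phi>(1), of y w] y \<phi>(2) by simp
  have "y \<noteq> r" "\<phi> y \<noteq> r" using y \<phi> A_inj[OF \<phi>(1), of y r] by auto
  then have Nw: "N w = {r, y, \<phi> y}" using N3_eq[of r w y "\<phi> y"] rNw y \<open>\<phi> y \<in> N w\<close> by metis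
  have NwO: "N w \<subseteq> orb r" using Nw y(2) orb_refl orb_A[OF \<phi>(1)] by auto
  have NO': "N x \<subseteq> orb r" if "x \<in> orb w" for x using N_subset_orb[OF NwO that] .
  obtain d e where N: "N r = {w, d, e}" "w \<noteq> d" "w \<noteq> e" "d \<noteq> e" using N3[OF rV w(1)] by metis
  have id: "f x = x" if "f \<in> A" "f r = r" "z \<in> N r" "f z = z" "x \<in> N r" for f x z
    using regularD[OF r] that by blast
  have fN: "f x \<in> N r" if "f \<in> A" "f r = r" "x \<in> N r" for f x
    using A_N[of f x r] that by simp
  \<comment> \<open>By regularity \<open>\<phi>\<close> fixes \<open>d\<close>, so with one further
    common neighbor \<open>w\<close> and \<open>d\<close> share all of them. Exchanging these twins
    fixes \<open>r\<close> and \<open>e\<close> but moves \<open>w\<close>.\<close>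
  have one: "x = r" if x: "x \<in> N w" "x \<in> N d" for x
  proof (rule ccontr)
    assume xr: "x \<noteq> r"
    have \<phi>d: "\<phi> d = d" using id[OF \<phi>(1,3), of w d] \<phi>(2) N by blast
    have rd: "r \<in> N d" using N N_sym by blast
    have \<phi>\<phi>: "\<phi> (\<phi> y) = y"
    proof -
      have "\<phi> (\<phi> y) \<in> N w" using A_N[OF \<phi>(1), of "\<phi> y" w] \<open>\<phi> y \<in> N w\<close> \<phi>(2) by simp
      moreover have "\<phi> (\<phi> y) \<noteq> r" "\<phi> (\<phi> y) \<noteq> \<phi> y"
        using A_inj[OF \<phi>(1), of "\<phi> y" r] A_inj[OF \<phi>(1), of "\<phi> y" y] \<phi>(3) \<open>\<phi> y \<noteq> r\<close> y(3) by auto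
      ultimately show ?thesis using Nw by auto
    qed
    have "\<phi> x \<in> N d" using A_N[OF \<phi>(1), of x d] x(2) \<phi>d by simp
    then have "y \<in> N d" "\<phi> y \<in> N d" using x xr Nw \<phi>\<phi> by auto
    then have "N d = N w" using N3_eq[of r d y "\<phi> y"] rd \<open>y \<noteq> r\<close> \<open>\<phi> y \<noteq> r\<close> y(3) Nw by metis
    moreover have "w \<in> V" "d \<in> V" using N N_V by blast+
    ultimately have \<tau>: "Transposition.transpose w d \<in> A" using transpose_in_A[of w d] N_irrefl
      by auto
    have "r \<noteq> w" "r \<noteq> d" using N N_irrefl by blast+
    then have "Transposition.transpose w d w = w"
      using id[OF \<tau>, of e w] N by auto
    then show False using N by simp
  qed
  define F where "F = {f \<in> A. f r = r \<and> (\<forall>x\<in>N r. f x = x)}"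
  define Q where "Q = insert r (orb w)"
  have NrV: "N r \<subseteq> V" using N_V by blast
  let ?q = "\<lambda>x. x = r \<or> x = w \<or> x = d"
  have "\<exists>c. good_coloring F Q (?q) {} c"
  proof (rule extend_coloring[where ?D0.0 = "insert r (N r)"])
    show "insert r (N r) \<subseteq> Q" using Nr unfolding Q_def by blast
    show "Q \<subseteq> V" using rV orb_V[of w] N_V(1)[OF w(1)] unfolding Q_def by blast
    show "N x \<inter> insert r (N r) \<noteq> {}" if "x \<in> insert r (N r)" for x
      using that w N_sym by blast
    fix D assume D: "insert r (N r) \<subseteq> D" "D \<subseteq> V" "D \<noteq> V" "\<And>x. x \<in> D \<Longrightarrow> N x \<inter> D \<noteq> {}"
    have "D \<noteq> {}" using D(1) by blast
    then obtain p where p: "p \<in> D" "N p - D \<noteq> {}" using frontier D(2,3) by blast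
    obtain e where e: "e \<in> N p" "e \<in> D" using D(4)[OF p(1)] by blast
    have "f u = u" if u: "u \<in> N p - D" "u \<in> Q" "f \<in> F" "\<forall>x\<in>D. f x = x" for u f
    proof -
      have "u \<in> orb w" using u D(1) unfolding Q_def by blast
      then have "p \<in> orb r" using NO' u(1) N_sym by blast
      then show ?thesis using regularD[OF reg, of p f e u] u p e unfolding F_def by blast
    qed
    then show "\<exists>p\<in>D. N p - D \<noteq> {} \<and> (\<forall>u\<in>N p - D. \<forall>u'\<in>N p - D. u \<noteq> u' \<longrightarrow> u \<in> Q \<longrightarrow> u' \<in> Q \<longrightarrow>
        ?q u = ?q u' \<longrightarrow> (\<forall>f\<in>F. (\<forall>x\<in>D. f x = x) \<longrightarrow> f u = u))"
      using p by blast
  qed (auto simp: F_def)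
  then obtain c where c: "good_coloring F Q (?q) {} c" by blast
  note cQ = good_coloringD(1)[OF c] and cP = good_coloringD(2)[OF c] and cF = good_coloringD(3)[OF c]
  have rw: "r \<notin> orb w" using w(2) orb_sym by blast
  have wdO: "w \<in> orb w" "d \<in> orb w" using Nr N by blast+
  show ?thesis
  proof (rule distinguishing_number_le_2I[of c])
    fix f assume f: "f \<in> A" "\<And>x. x \<in> V \<Longrightarrow> c (f x) = c x"
    have q: "f x = w \<or> f x = d" if "x = w \<or> x = d" for x
    proof -
      have x: "x \<in> V" "x \<in> orb w" using that N N_V(1)[of x r] wdO by blast+
      have "f x \<in> orb w" using orb_A[OF f(1)] x(2) by blast
      then show ?thesis using cQ[of x] cQ[of "f x"] f(2)[OF x(1)] rw x that unfolding Q_def by blast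
    qed
    have "f w \<noteq> f d" using N(2) by (simp add: A_inj[OF f(1)])
    then have fwd: "f w = w \<and> f d = d \<or> f w = d \<and> f d = w" using q[of w] q[of d] by metis
    have "f r \<in> N (f w)" "f r \<in> N (f d)" using A_N[OF f(1)] N N_sym by blast+
    then have fr: "f r = r" using one fwd by metis
    have "f e \<in> N r" using fN[OF f(1) fr] N by blast
    moreover have "f e \<noteq> f w" "f e \<noteq> f d" using N(2-4) by (auto simp: A_inj[OF f(1)])
    ultimately have "f e = e" using N fwd by auto
    then have "f x = x" if "x \<in> N r" for x using id[OF f(1) fr, of e x] that N by blast
    then have "f \<in> F" unfolding F_def using f(1) fr by blast
    then show "\<forall>x\<in>V. f x = x" using cF f(2) by blast
  qed
qed

text \<open>All images of \<open>{v, w}\<close> are colored with two colors, apart from the black pair \<open>{v, w}\<close> itself and those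
  that meet \<open>D0\<close>.\<close>

lemma root_pair:
  assumes w: "w \<in> N v" and pin: "pinned v w" "pinned w v"
    and swap: "\<And>h. h \<in> A \<Longrightarrow> h v = w \<Longrightarrow> h w = v"
    and D0: "D0 \<subseteq> V" "v \<in> D0" "w \<in> D0" "\<And>x. x \<in> D0 \<Longrightarrow> N x \<inter> D0 \<noteq> {}"
    and Bl: "Bl \<subseteq> D0" "v \<in> Bl" "w \<in> Bl"
    and unique: "\<And>f. f \<in> A \<Longrightarrow> {f v, f w} \<noteq> {v, w} \<Longrightarrow> {f v, f w} \<inter> Bl \<noteq> {} \<Longrightarrow> {f v, f w} \<inter> (D0 - Bl) \<noteq> {}"
    and fixed: "\<And>f x. f \<in> A \<Longrightarrow> {f v, f w} = {v, w} \<Longrightarrow>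
      (\<And>x. x \<in> D0 \<Longrightarrow> f x \<in> D0 \<Longrightarrow> f x \<in> Bl \<longleftrightarrow> x \<in> Bl) \<Longrightarrow> x \<in> D0 \<Longrightarrow> f x = x"
  shows "distinguishing_number G \<le> 2"
proof -
  define PP where "PP = {{f v, f w} | f. f \<in> A}"
  define F where "F = {f \<in> A. \<forall>x\<in>D0. f x = x}"
  \<comment> \<open>This and the next two facts say that an image of the pair is determined by
    either of its members, in either role. Hence different images are disjoint, as
    \<open>PP_disj\<close> demands.\<close>
  have pair: "g w = f w" if "f \<in> A" "g \<in> A" "g v = f v" for f g
  proof -
    obtain h where h: "h \<in> A" "\<And>x. h (f x) = x" "\<And>x. f (h x) = x" using A_inv[OF \<open>f \<in> A\<close>] by metis
    have "(h \<circ> g) w = w" using pinnedD[OF pin(1) A_comp[OF h(1) \<open>g \<in> A\<close>]] that(3) h by simp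
    then show ?thesis using h(3) by (metis comp_apply)
  qed
  have pair': "g v = f v" if "f \<in> A" "g \<in> A" "g w = f w" for f g
  proof -
    obtain h where h: "h \<in> A" "\<And>x. h (f x) = x" "\<And>x. f (h x) = x" using A_inv[OF \<open>f \<in> A\<close>] by metis
    have "(h \<circ> g) v = v" using pinnedD[OF pin(2) A_comp[OF h(1) \<open>g \<in> A\<close>]] that(3) h by simp
    then show ?thesis using h(3) by (metis comp_apply)
  qed
  have cross: "g w = f v" if "f \<in> A" "g \<in> A" "g v = f w" for f g
  proof -
    obtain h where h: "h \<in> A" "\<And>x. h (f x) = x" "\<And>x. f (h x) = x" using A_inv[OF \<open>f \<in> A\<close>] by metis
    have "(h \<circ> g) w = v" using swap[OF A_comp[OF h(1) \<open>g \<in> A\<close>]] that(3) h by simp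
    then show ?thesis using h(3) by (metis comp_apply)
  qed
  have disj: "y = z" if xy: "{x, y} \<in> PP" "{x, z} \<in> PP" for x y z
  proof -
    obtain f g where fg: "f \<in> A" "g \<in> A" "{x, y} = {f v, f w}" "{x, z} = {g v, g w}"
      using xy unfolding PP_def by blast
    then have "x = f v \<and> y = f w \<or> x = f w \<and> y = f v" "x = g v \<and> z = g w \<or> x = g w \<and> z = g v"
      by (auto simp: doubleton_eq_iff)
    then show ?thesis using pair[OF fg(1,2)] pair'[OF fg(1,2)] cross[OF fg(1,2)] cross[OF fg(2,1)]
      by metis
  qed
  have "\<exists>c. good_coloring F D0 (\<lambda>x. x \<in> Bl) PP c"
  proof (rule extend_coloring[where ?D0.0 = D0])
    have vw: "v \<in> V" "w \<in> V" using w N_V by blast+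
    show "x \<in> V" if "{x, y} \<in> PP" for x y
      using that vw A_V unfolding PP_def by (auto simp: doubleton_eq_iff)
    show "y = z" if "{x, y} \<in> PP" "{x, z} \<in> PP" for x y z using disj that by blast
    show "{f x, f y} \<in> PP" if "f \<in> F" "{x, y} \<in> PP" for f x y
    proof -
      obtain g where g: "g \<in> A" "{x, y} = {g v, g w}" using \<open>{x, y} \<in> PP\<close> unfolding PP_def by blast
      have "{f x, f y} = f ` {x, y}" by simp
      also have "\<dots> = {(f \<circ> g) v, (f \<circ> g) w}" using g by simp
      finally show ?thesis unfolding PP_def using A_comp[of f g] g(1) that(1) unfolding F_def
        by blast
    qed
    fix D assume D: "D0 \<subseteq> D" "D \<subseteq> V" "D \<noteq> V" "\<And>x. x \<in> D \<Longrightarrow> N x \<inter> D \<noteq> {}"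
    have "D \<noteq> {}" using D(1) D0(2) by blast
    then obtain p where p: "p \<in> D" "N p - D \<noteq> {}" using frontier D(2,3) by blast
    then show "\<exists>p\<in>D. N p - D \<noteq> {} \<and> (\<forall>u\<in>N p - D. \<forall>u'\<in>N p - D. u \<noteq> u' \<longrightarrow> u \<in> D0 \<longrightarrow> u' \<in> D0 \<longrightarrow>
        (u \<in> Bl) = (u' \<in> Bl) \<longrightarrow> (\<forall>f\<in>F. (\<forall>x\<in>D. f x = x) \<longrightarrow> f u = u))"
      using D(1) by blast
  qed (use D0 in \<open>auto simp: F_def\<close>)
  then obtain c where c: "good_coloring F D0 (\<lambda>x. x \<in> Bl) PP c" by blast
  note cQ = good_coloringD(1)[OF c] and cP = good_coloringD(2)[OF c] and cF = good_coloringD(3)[OF c]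
  show ?thesis
  proof (rule distinguishing_number_le_2I[of c])
    fix f assume f: "f \<in> A" "\<And>x. x \<in> V \<Longrightarrow> c (f x) = c x"
    have vw: "v \<in> V" "w \<in> V" "v \<noteq> w" using w N_V N_irrefl by blast+
    have "c v" "c w" using cQ D0 Bl by auto
    then have cf: "c (f v)" "c (f w)" using f(2) vw by auto
    have "f v \<noteq> f w" using vw by (simp add: A_inj[OF f(1)])
    have "{f v, f w} = {v, w}"
    \<comment> \<open>Both members of the image are black. An image outside of \<open>D0\<close> has
      both colors, and one that meets the black part of \<open>D0\<close> has a white member in
      \<open>D0\<close> by \<open>unique\<close>.\<close>
    proof (rule ccontr)
      assume ne: "{f v, f w} \<noteq> {v, w}"
      have "{f v, f w} \<in> PP" unfolding PP_def using f(1) by blast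
      then have "f v \<in> D0 \<or> f w \<in> D0" using cP[of "f v" "f w"] cf \<open>f v \<noteq> f w\<close> by blast
      moreover have "x \<in> Bl" if "x \<in> D0" "x \<in> {f v, f w}" for x using cQ[OF that(1)] cf that(2)
        by blast
      ultimately have "{f v, f w} \<inter> Bl \<noteq> {}" by blast
      then have "{f v, f w} \<inter> (D0 - Bl) \<noteq> {}" using unique[OF f(1) ne] by blast
      then show False using \<open>\<And>x. x \<in> D0 \<Longrightarrow> x \<in> {f v, f w} \<Longrightarrow> x \<in> Bl\<close> by blast
    qed
    moreover have "f x \<in> Bl \<longleftrightarrow> x \<in> Bl" if "x \<in> D0" "f x \<in> D0" for x
      using cQ[OF that(1)] cQ[OF that(2)] f(2)[of x] that(1) D0(1) by blast
    ultimately have "f x = x" if "x \<in> D0" for x using fixed[OF f(1)] that by blast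
    then have "f \<in> F" unfolding F_def using f(1) by blast
    then show "\<forall>x\<in>V. f x = x" using cF f(2) by blast
  qed
qed

text \<open>The ends of the edge lie in different orbits, so an image that meets the edge fixes one
  end and, by pinning, the other. The black edge itself is therefore enough of a seed.\<close>

lemma inequivalent_pair:
  assumes w: "w \<in> N v" "pinned v w" "pinned w v" "w \<notin> orb v"
  shows "distinguishing_number G \<le> 2"
proof (rule root_pair[OF w(1-3), of "{v, w}" "{v, w}"])
  have no: "h v \<noteq> w" if "h \<in> A" for h using w(4) orbI[OF that] by metis
  then show "h w = v" if "h \<in> A" "h v = w" for h using that by blast
  have no': "h w \<noteq> v" if "h \<in> A" for h using w(4) orb_sym orbI[OF that] by metis
  show "{v, w} \<subseteq> V" using w N_V by blast
  show "N x \<inter> {v, w} \<noteq> {}" if "x \<in> {v, w}" for x using that w(1) N_sym by blast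
  have *: "f v = v \<and> f w = w" if "f \<in> A" "{f v, f w} \<inter> {v, w} \<noteq> {}" for f
    using that no no' pinnedD[OF w(2)] pinnedD[OF w(3)] by blast
  then show "{f v, f w} \<inter> ({v, w} - {v, w}) \<noteq> {}"
    if "f \<in> A" "{f v, f w} \<noteq> {v, w}" "{f v, f w} \<inter> {v, w} \<noteq> {}" for f using that by metis
  show "f x = x" if "f \<in> A" "{f v, f w} = {v, w}" "x \<in> {v, w}" for f x
  proof -
    have "f v = v \<and> f w = w" using *[OF \<open>f \<in> A\<close>] that(2) by blast
    then show ?thesis using that(3) by blast
  qed
qed auto

section \<open>Infinite trees and rays\<close>

text \<open>The case \<open>Q = D0\<close>: no missing vertex carries a prescribed color, so every
  frontier vertex can serve for the growth.\<close>

lemma extend_coloring_fixed: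
  assumes "D0 \<subseteq> V" "D0 \<noteq> {}" "\<And>x. x \<in> D0 \<Longrightarrow> N x \<inter> D0 \<noteq> {}"
    and "\<And>x y. {x, y} \<in> PP \<Longrightarrow> x \<in> V"
    and "\<And>x y z. {x, y} \<in> PP \<Longrightarrow> {x, z} \<in> PP \<Longrightarrow> y = z"
    and "\<And>f x y. f \<in> A \<Longrightarrow> {x, y} \<in> PP \<Longrightarrow> {f x, f y} \<in> PP"
  shows "\<exists>c. good_coloring {f \<in> A. \<forall>x\<in>D0. f x = x} D0 q PP c"
proof (rule extend_coloring[where ?D0.0 = D0])
  fix D assume D: "D0 \<subseteq> D" "D \<subseteq> V" "D \<noteq> V"
  then have "D \<noteq> {}" using assms(2) by blast
  then obtain p where p: "p \<in> D" "N p - D \<noteq> {}" using frontier D(2,3) by blast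
  then show "\<exists>p\<in>D. N p - D \<noteq> {} \<and> (\<forall>u\<in>N p - D. \<forall>u'\<in>N p - D. u \<noteq> u' \<longrightarrow> u \<in> D0 \<longrightarrow> u' \<in> D0 \<longrightarrow>
      q u = q u' \<longrightarrow> (\<forall>f\<in>{f \<in> A. \<forall>x\<in>D0. f x = x}. (\<forall>x\<in>D. f x = x) \<longrightarrow> f u = u))"
    using D(1) by blast
next
  show "y = z" if "{x, y} \<in> PP" "{x, z} \<in> PP" for x y z using assms(5) that .
  show "x \<in> V" if "{x, y} \<in> PP" for x y using assms(4) that .
  show "{f x, f y} \<in> PP" if "f \<in> {f \<in> A. \<forall>x\<in>D0. f x = x}" "{x, y} \<in> PP" for f x y
    using assms(6)[of f x y] that by simp
  show "N x \<inter> D0 \<noteq> {}" if "x \<in> D0" for x using assms(3) that .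
qed (use assms(1,2) in blast)+

text \<open>Pairs of siblings receive two colors, except along an infinite descending path: there the first pair is
  black and all later ones are white.\<close>

lemma infinite_binary_tree:
  assumes x0: "x0 \<in> Q" and two: "\<And>x. x \<in> Q \<Longrightarrow> two x"
    and down: "\<And>x a. x \<in> Q \<Longrightarrow> a \<in> t x \<Longrightarrow> a \<in> Q \<and> s a = x"
    and inv: "\<And>f x. f \<in> A \<Longrightarrow> x \<in> Q \<Longrightarrow> f x \<in> Q"
  shows "distinguishing_number G \<le> 2"
proof -
  define y where "y = rec_nat x0 (\<lambda>_ x. SOME a. a \<in> t x)"
  have y0: "y 0 = x0" and yS: "y (Suc i) = (SOME a. a \<in> t (y i))" for i
    unfolding y_def by simp_all
  have yQ: "y i \<in> Q" and yt: "y (Suc i) \<in> t (y i)" for i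
  proof -
    have *: "y i \<in> Q \<and> y (Suc i) \<in> t (y i)" for i
    proof (induction i)
      case 0
      have "t (y 0) \<noteq> {}" using t_cases[OF two[OF x0]] y0 by blast
      then show ?case using x0 y0 yS[of 0] some_in_eq by metis
    next
      case (Suc i)
      then have Q: "y (Suc i) \<in> Q" using down by blast
      have "t (y (Suc i)) \<noteq> {}" using t_cases[OF two[OF Q]] by blast
      then show ?case using Q yS[of "Suc i"] some_in_eq by metis
    qed
    show "y i \<in> Q" "y (Suc i) \<in> t (y i)" using * by blast+
  qed
  have sy: "s (y (Suc i)) = y i" for i using down yQ yt by blast
  have "\<exists>b. t (y i) = {y (Suc i), b} \<and> y (Suc i) \<noteq> b" for i
    using t_cases'[OF two[OF yQ] yt] by metis
  then obtain z where z: "\<And>i. t (y i) = {y (Suc i), z i}" "\<And>i. y (Suc i) \<noteq> z i" by metis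
  have zQ: "z i \<in> Q" and sz: "s (z i) = y i" for i using down[OF yQ[of i], of "z i"] z(1)[of i]
    by auto
  have low: "g (y (l :: nat)) = y l" if g: "g \<in> A" "g (y m) = y m" and lm: "l \<le> m" for g l m
    using lm
  proof (induction rule: inc_induct)
    case base then show ?case using g(2) .
  next
    case (step n)
    then show ?case using s_A[OF g(1) two[OF yQ[of "Suc n"]]] sy by simp
  qed
  have swap: "\<exists>g\<in>A. g (y i) = y i \<and> g (y (Suc i)) = z i \<and> g (z i) = y (Suc i)" for i
  proof -
    obtain b g where g: "t (y i) = {y (Suc i), b}" "g \<in> A" "g (y i) = y i" "g (y (Suc i)) = b" "g b = y (Suc i)"
      using t_cases'[OF two[OF yQ] yt] by metis
    then have "b = z i" using z[of i] by (auto simp: doubleton_eq_iff)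
    then show ?thesis using g by blast
  qed
  \<comment> \<open>An automorphism that exchanges the children of \<open>y l\<close> fixes
    \<open>y l\<close> and all its ancestors. If \<open>y l = y m\<close> with \<open>l < m\<close>,
    the child \<open>y (Suc l)\<close> would be one of these ancestors. The next two facts rest on
    the same exchange.\<close>
  have inj: "i = j" if "y i = y j" for i j
  proof (rule ccontr)
    assume "i \<noteq> j"
    then obtain l m where lm: "l < m" "y l = y m" using \<open>y i = y j\<close> by (metis linorder_neqE_nat)
    obtain g where g: "g \<in> A" "g (y l) = y l" "g (y (Suc l)) = z l" using swap by blast
    then have "g (y (Suc l)) = y (Suc l)" using low[of g m "Suc l"] lm by simp
    then show False using g(3) z(2) by metis
  qed
  have zy: "z i \<noteq> y j" for i j
  proof
    assume eq: "z i = y j"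
    show False
    proof (cases j)
      case 0
      obtain g where g: "g \<in> A" "g (y i) = y i" "g (z i) = y (Suc i)" using swap by blast
      then have "g (z i) = z i" using low[of g i 0] eq 0 by simp
      then show False using g(3) z(2) by metis
    next
      case (Suc l)
      then have "i = l" using sz[of i] sy[of l] eq inj by metis
      then show False using eq Suc z(2) by metis
    qed
  qed
  have y0z: "s (y 0) \<noteq> z i" for i
  proof
    assume eq: "s (y 0) = z i"
    obtain g where g: "g \<in> A" "g (y i) = y i" "g (z i) = y (Suc i)" using swap by blast
    then have "g (y 0) = y 0" using low[of g i 0] by simp
    then have "g (z i) = z i" using s_A[OF g(1) two[OF yQ[of 0]]] eq by simp
    then show False using g(3) z(2) by metis
  qed
  have zinj: "i = j" if "z i = z j" for i j using that sz inj by metis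
  define D0 where "D0 = range y \<union> range z"
  define q where "q x \<longleftrightarrow> x = y 1 \<or> x = z 0" for x
  define PP where "PP = {t x | x. x \<in> Q}"
  have DV: "D0 \<subseteq> V" unfolding D0_def using yQ zQ two two_V by blast
  have PPs: "s a = x \<and> a \<in> Q" if "{a, b} = t x" "x \<in> Q" for a b x
    using down[OF that(2), of a] that(1) by blast
  have "\<exists>c. good_coloring {f \<in> A. \<forall>x\<in>D0. f x = x} D0 q PP c"
  proof (rule extend_coloring_fixed)
    show "N x \<inter> D0 \<noteq> {}" if "x \<in> D0" for x
    proof -
      have "y i \<in> N (z i)" "y (Suc i) \<in> N (y i)" for i
        using z(1)[of i] t_N[of "z i" "y i"] t_N[OF yt] N_sym by blast+
      then show ?thesis using that unfolding D0_def by blast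
    qed
    show "a \<in> V" if "{a, b} \<in> PP" for a b using that PPs two two_V unfolding PP_def by blast
    show "b = b'" if "{a, b} \<in> PP" "{a, b'} \<in> PP" for a b b'
    proof -
      obtain x x' where x: "x \<in> Q" "{a, b} = t x" "x' \<in> Q" "{a, b'} = t x'"
        using \<open>{a, b} \<in> PP\<close> \<open>{a, b'} \<in> PP\<close> unfolding PP_def by blast
      then have "x = x'" using PPs by metis
      then have "{a, b} = {a, b'}" using x by simp
      then show ?thesis by (metis doubleton_eq_iff)
    qed
    show "{f a, f b} \<in> PP" if "f \<in> A" "{a, b} \<in> PP" for f a b
    proof -
      obtain x where x: "x \<in> Q" "{a, b} = t x" using \<open>{a, b} \<in> PP\<close> unfolding PP_def by blast
      have "{f a, f b} = t (f x)" using t_A[OF \<open>f \<in> A\<close> two[OF x(1)]] x(2)[symmetric] by simp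
      then show ?thesis unfolding PP_def using inv[OF \<open>f \<in> A\<close> x(1)] by blast
    qed
  qed (use DV in \<open>auto simp: D0_def\<close>)
  then obtain c where c: "good_coloring {f \<in> A. \<forall>x\<in>D0. f x = x} D0 q PP c" by blast
  note cQ = good_coloringD(1)[OF c] and cP = good_coloringD(2)[OF c] and cF = good_coloringD(3)[OF c]
  have cy: "c (y i) = q (y i)" and cz: "c (z i) = q (z i)" for i
    using cQ unfolding D0_def by blast+
  show ?thesis
  proof (rule distinguishing_number_le_2I[of c])
    fix f assume f: "f \<in> A" "\<And>x. x \<in> V \<Longrightarrow> c (f x) = c x"
    have tf: "t (f (y i)) = {f (y (Suc i)), f (z i)}" for i
      using t_A[OF f(1) two[OF yQ[of i]]] z(1)[of i] by simp
    have ne: "f (y (Suc i)) \<noteq> f (z i)" for i using z(2) by (simp add: A_inj[OF f(1)])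
    have inP: "{f (y (Suc i)), f (z i)} \<in> PP" for i
      unfolding PP_def tf[symmetric] using inv[OF f(1) yQ[of i]] by blast
    have cf: "c (f (y i)) = q (y i)" "c (f (z i)) = q (z i)" for i
      using f(2) cy cz two_V two yQ zQ by metis+
    have sf: "s (f (y (Suc i))) = f (y i)" "s (f (z i)) = f (y i)" for i
      using s_A[OF f(1) two[OF yQ[of "Suc i"]]] s_A[OF f(1) two[OF zQ[of i]]] sy sz by simp_all
    \<comment> \<open>The image of the first pair is a black pair of siblings, so it meets
      \<open>D0\<close>; the black vertices of \<open>D0\<close> are exactly the children of
      \<open>y 0\<close>.\<close>
    have f0: "f (y 0) = y 0"
    proof -
      have q1: "c (f (y 1))" "c (f (z 0))" using cf(1)[of 1] cf(2)[of 0] unfolding q_def by simp_all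
      then obtain a where a: "a = f (y 1) \<or> a = f (z 0)" "a \<in> D0"
        using cP[OF inP[of 0] ne] by auto
      then have "q a" using cQ q1 by metis
      then have "s a = y 0" using sy[of 0] sz[of 0] unfolding q_def by auto
      then show ?thesis using a(1) sf(1)[of 0] sf(2)[of 0] by auto
    qed
    have fy: "f (y i) = y i" for i
    proof (induction i)
      case 0 show ?case by (rule f0)
    next
      case (Suc i)
      have "f (y (Suc i)) \<in> t (y i)" using tf[of i] Suc by auto
      then consider "f (y (Suc i)) = y (Suc i)" | (b) "f (y (Suc i)) = z i" using z(1)[of i]
        by blast
      then show ?case
      proof cases
        \<comment> \<open>The children of \<open>y (Suc i)\<close> are both white, so their images
          form a white pair below \<open>z i\<close>, which has to meet \<open>D0\<close>. But no
          vertex of \<open>D0\<close> has \<open>z i\<close> as its parent.\<close>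
        case b
        have "\<not> q (y (Suc (Suc i)))" "\<not> q (z (Suc i))"
          unfolding q_def using inj[of "Suc (Suc i)" 1] zy zinj[of "Suc i" 0]
            by (metis One_nat_def Suc_inject nat.distinct(1))+
        then have "c (f (y (Suc (Suc i)))) = c (f (z (Suc i)))" using cf by simp
        then obtain a where a: "a = f (y (Suc (Suc i))) \<or> a = f (z (Suc i))" "a \<in> D0"
          using cP[OF inP[of "Suc i"] ne] by auto
        then have sa: "s a = z i" using sf[of "Suc i"] b by metis
        from a(2) consider j where "a = y j" | j where "a = z j" unfolding D0_def by blast
        then show ?thesis
        proof cases
          case 1
          then show ?thesis using sa sy zy y0z by (metis not0_implies_Suc)
        next
          case 2
          then show ?thesis using sa sz zy by metis
        qed
      qed
    qed
    have "f (z i) = z i" for i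
    proof -
      have "f (z i) \<in> t (y i)" using tf[of i] fy by auto
      then show ?thesis using ne[of i] fy[of "Suc i"] z(1)[of i] by auto
    qed
    then have "f \<in> {f \<in> A. \<forall>x\<in>D0. f x = x}" using f(1) fy unfolding D0_def by blast
    then show "\<forall>x\<in>V. f x = x" using cF f(2) by blast
  qed
qed

text \<open>If two vertices of the ray are equivalent, the orbits beyond the first of them form a
  family closed under taking children, which is an infinite binary tree. Otherwise the orbits act as
  levels. The ray is colored black and the siblings along it white, so that a ray entering it from
  the side shows a white vertex. Rays that never meet it form merging classes, and each class is
  spoiled by one representative that is white from level 1 on.\<close>

lemma infinite_ascent:
  assumes two: "\<And>i. two (x i)" and sx: "\<And>i. s (x i) = x (Suc i)" and xt: "\<And>i. x i \<in> t (x (Suc i))"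
  shows "distinguishing_number G \<le> 2"
proof -
  have two': "two u" if "u \<in> orb (x m)" for u m using that two two_A by (auto elim: orbE)
  have down: "a \<in> orb (x m) \<and> s a = u" if u: "u \<in> orb (x (Suc m))" and a: "a \<in> t u" for u m a
  proof -
    obtain f where f: "f \<in> A" "u = f (x (Suc m))" using u by (rule orbE)
    have fx: "f (x m) \<in> t u" "s (f (x m)) = u" "f (x m) \<in> orb (x m)"
      using f t_A_iff[OF f(1) two] xt s_A[OF f(1) two] sx orbI by simp_all
    obtain b g where g: "t u = {f (x m), b}" "g \<in> A" "g u = u" "g (f (x m)) = b"
      using t_cases'[OF two'[OF u] fx(1)] by metis
    have "b \<in> orb (x m)" using orb_A[OF g(2)] fx(3) g(4) by blast
    moreover have "s b = u" using s_A[OF g(2) two'[OF fx(3)]] fx(2) g by simp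
    ultimately show ?thesis using a g(1) fx by auto
  qed
  have up: "s u \<in> orb (x (Suc m))" if u: "u \<in> orb (x m)" for u m
  proof -
    obtain f where f: "f \<in> A" "u = f (x m)" using u by (rule orbE)
    then show ?thesis using s_A[OF f(1) two] sx orbI by simp
  qed
  show ?thesis
  proof (cases "\<exists>i j. i < j \<and> x i \<in> orb (x j)")
    case True
    then obtain i j where ij: "i < j" "x i \<in> orb (x j)" by blast
    \<comment> \<open>Children in level \<open>i\<close> are harmless although \<open>i\<close> is
      left out: \<open>orb (x i)\<close> equals \<open>orb (x j)\<close>, which is in the
      union.\<close>
    define Q where "Q = (\<Union>k\<in>{i<..}. orb (x k))"
    show ?thesis
    proof (rule infinite_binary_tree[of "x j" Q])
      show "x j \<in> Q" unfolding Q_def using ij(1) orb_refl by blast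
      show "two u" if "u \<in> Q" for u using that two' unfolding Q_def by blast
      show "f u \<in> Q" if "f \<in> A" "u \<in> Q" for f u using that orb_A unfolding Q_def by blast
      show "a \<in> Q \<and> s a = u" if "u \<in> Q" "a \<in> t u" for u a
      proof -
        obtain k where k: "k > i" "u \<in> orb (x k)" using \<open>u \<in> Q\<close> unfolding Q_def by blast
        then obtain m where m: "k = Suc m" "m \<ge> i"
          by (metis Suc_le_eq less_imp_Suc_add add_Suc_right le_add1 less_Suc_eq_le)
        have a: "a \<in> orb (x m) \<and> s a = u" using down k(2) m(1) \<open>a \<in> t u\<close> by blast
        have "orb (x m) \<subseteq> Q"
        proof (cases "m = i")
          case True
          then show ?thesis using orb_eq[OF ij(2)] ij(1) unfolding Q_def by blast
        next
          case False
          then have "m \<in> {i<..}" using m(2) by simp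
          then show ?thesis unfolding Q_def by blast
        qed
        then show ?thesis using a by blast
      qed
    qed
  next
    case False
    have lev: "i = j" if "u \<in> orb (x i)" "u \<in> orb (x j)" for u i j
    proof -
      have "x i \<in> orb (x j)" "x j \<in> orb (x i)" using that orb_eq orb_refl by metis+
      then show ?thesis using False by (metis linorder_neqE_nat)
    qed
    define S where "S i = (s ^^ i)" for i :: nat
    have S0: "S 0 u = u" and SS: "S (Suc i) u = s (S i u)" for i u unfolding S_def by simp_all
    have So: "S i u \<in> orb (x i)" if "u \<in> orb (x 0)" for i u
      using that by (induction i) (auto simp: S0 SS up)
    have Sx: "S i (x 0) = x i" for i by (induction i) (auto simp: S0 SS sx)
    define mg where "mg u u' \<longleftrightarrow> (\<exists>i. S i u = S i u')" for u u'
    have Sadd: "S (j + i) u = S j (S i u)" for i j u unfolding S_def by (simp add: funpow_add)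
    have mono: "S j u = S j u'" if "S i u = S i u'" "i \<le> j" for i j u u'
      using that Sadd[of "j - i" i] by simp
    have mg_tr: "mg u u''" if mm: "mg u u'" "mg u' u''" for u u' u''
    proof -
      obtain i j where "S i u = S i u'" "S j u' = S j u''" using mm unfolding mg_def by blast
      then have "S (max i j) u = S (max i j) u''" using mono
        by (metis max.cobounded1 max.cobounded2)
      then show ?thesis unfolding mg_def by blast
    qed
    have mg_sym: "mg u' u" if "mg u u'" for u u' using that unfolding mg_def by metis
    have mg_refl: "mg u u" for u unfolding mg_def by blast
    \<comment> \<open>One representative per merging class: by \<open>\<rho>_eq\<close> the choice
      depends only on the class.\<close>
    define \<rho> where "\<rho> u = (SOME u'. u' \<in> orb (x 0) \<and> mg u u')" for u
    have \<rho>: "\<rho> u \<in> orb (x 0)" "mg u (\<rho> u)" if "u \<in> orb (x 0)" for u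
      using someI[of "\<lambda>u'. u' \<in> orb (x 0) \<and> mg u u'" u] that mg_refl unfolding \<rho>_def by blast+
    have \<rho>_eq: "\<rho> u = \<rho> u'" if "mg u u'" for u u'
    proof -
      have "(\<lambda>z. z \<in> orb (x 0) \<and> mg u z) = (\<lambda>z. z \<in> orb (x 0) \<and> mg u' z)"
        using that mg_tr mg_sym by blast
      then show ?thesis unfolding \<rho>_def by simp
    qed
    have "\<exists>b. t (x (Suc i)) = {x i, b} \<and> x i \<noteq> b" for i
      using t_cases'[OF two xt] by metis
    then obtain x' where x': "\<And>i. t (x (Suc i)) = {x i, x' i}" "\<And>i. x i \<noteq> x' i" by metis
    have x'o: "x' i \<in> orb (x i)" "s (x' i) = x (Suc i)" for i
      using down[OF orb_refl, of "x' i" i] x'(1)[of i] by auto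
    have x'x: "x' i \<noteq> x j" for i j
      using lev[of "x j" i j] x'o(1) orb_refl x'(2) by metis
    define D0 where "D0 = range x \<union> range x'"
    \<comment> \<open>Level 0 is left out because \<open>down\<close> describes the lower neighbors
      only of vertices in later levels.\<close>
    define R where "R = {S j (\<rho> u) | u j. u \<in> orb (x 0) \<and> \<not> mg u (x 0) \<and> j \<ge> 1}"
    define Q where "Q = D0 \<union> R"
    define q where "q u \<longleftrightarrow> u \<in> range x" for u
    define F where "F = {f \<in> A. \<forall>x\<in>D0. f x = x}"
    have oV: "orb (x i) \<subseteq> V" for i using orb_V two_V[OF two] by blast
    have "\<exists>c. good_coloring F Q q {} c"
    proof (rule extend_coloring[where ?D0.0 = D0])
      show "F \<subseteq> A" unfolding F_def by blast
      show "D0 \<subseteq> Q" unfolding Q_def by blast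
      show "Q \<subseteq> V"
      proof -
        have "R \<subseteq> V" unfolding R_def using So \<rho>(1) oV by blast
        moreover have "D0 \<subseteq> V" unfolding D0_def using x'o(1) oV two_V[OF two] by blast
        ultimately show ?thesis unfolding Q_def by blast
      qed
      show "N u \<inter> D0 \<noteq> {}" if "u \<in> D0" for u
      proof -
        have "x (Suc i) \<in> N (x i)" "x (Suc i) \<in> N (x' i)" for i
          using xt t_N N_sym x'(1)[of i] by blast+
        then show ?thesis using that unfolding D0_def by blast
      qed
      fix D assume D: "D0 \<subseteq> D" "D \<subseteq> V" "D \<noteq> V" "\<And>x. x \<in> D \<Longrightarrow> N x \<inter> D \<noteq> {}"
      have "D \<noteq> {}" using D(1) unfolding D0_def by blast
      then obtain p where p: "p \<in> D" "N p - D \<noteq> {}" using frontier D(2,3) by blast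
      obtain e where e: "e \<in> N p" "e \<in> D" using D(4)[OF p(1)] by blast
      have "f u = u"
        if u: "u \<in> N p - D" "u' \<in> N p - D" "u \<noteq> u'" "u \<in> Q" "u' \<in> Q" "f \<in> F" "\<forall>x\<in>D. f x = x" for u u' f
      proof -
        have fA: "f \<in> A" "f p = p" using u p unfolding F_def by blast+
        have "u \<in> R" "u' \<in> R" using u D(1) unfolding Q_def by blast+
        then obtain z i z' j
          where R: "u = S i (\<rho> z)" "z \<in> orb (x 0)" "i \<ge> 1" "u' = S j (\<rho> z')" "z' \<in> orb (x 0)" "j \<ge> 1"
          unfolding R_def by blast
        obtain i' j' where ij: "i = Suc i'" "j = Suc j'" using R(3,6) by (cases i; cases j) auto
        have uo: "u \<in> orb (x i)" "u' \<in> orb (x j)" using So R \<rho>(1) by blast+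
        have up: "p \<in> t u \<and> s p = u \<or> p = s u" "p \<in> t u' \<and> s p = u' \<or> p = s u'"
          using down[of u i' p] down[of u' j' p] uo ij u(1,2) N_sym[of u p] N_sym[of u' p] t_iff
            by blast+
        have pin: "f y = y" if "p \<in> t y \<and> s p = y" "y \<in> {u, u'}" for y
        proof -
          have "two p" using that down[of y] two' uo ij by blast
          then show ?thesis using s_A[OF fA(1), of p] fA(2) that(1) by simp
        qed
        show ?thesis
        \<comment> \<open>If \<open>p\<close> is a child of \<open>u\<close> or of
          \<open>u'\<close>, that vertex is \<open>s p\<close> and is fixed; with it and
          \<open>e\<close> fixed, so is the third neighbor. If both are children of
          \<open>p\<close>, they lie on representatives of the same class in the same level and
          coincide.\<close>
        proof (cases "s p = u \<and> p \<in> t u")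
          case True then show ?thesis using pin by blast
        next
          case F1: False
          show ?thesis
          proof (cases "s p = u' \<and> p \<in> t u'")
            case True
            then have tp: "two p" using down[of u'] two' uo ij by blast
            have "e \<noteq> u'" using e u by blast
            then show ?thesis using two_stab[OF tp fA, of e u] t_iff True e u by blast
          next
            case False
            then have "s u = s u'" using up F1 by blast
            then have eq: "S (Suc i) (\<rho> z) = S (Suc j) (\<rho> z')" using R SS by simp
            then have "i = j" using lev So \<rho>(1) R(2,5) by (metis Suc_inject)
            then have "mg (\<rho> z) (\<rho> z')" using eq unfolding mg_def by blast
            then have "mg z z'" using \<rho>(2) R(2,5) mg_tr mg_sym by blast
            then show ?thesis using \<rho>_eq \<open>i = j\<close> R u(3) by metis
          qed
        qed
      qed
      then show "\<exists>p\<in>D. N p - D \<noteq> {} \<and> (\<forall>u\<in>N p - D. \<forall>u'\<in>N p - D. u \<noteq> u' \<longrightarrow> u \<in> Q \<longrightarrow> u' \<in> Q \<longrightarrow>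
        q u = q u' \<longrightarrow> (\<forall>f\<in>F. (\<forall>x\<in>D. f x = x) \<longrightarrow> f u = u))"
        using p by blast
    qed (auto simp: F_def D0_def)
    then obtain c where c: "good_coloring F Q q {} c" by blast
    note cQ = good_coloringD(1)[OF c] and cF = good_coloringD(3)[OF c]
    have cx: "c (x i)" and cx': "\<not> c (x' i)" for i
      using cQ[of "x i"] cQ[of "x' i"] x'x unfolding Q_def D0_def q_def by auto
    have cR: "\<not> c (S j (\<rho> u))" if "u \<in> orb (x 0)" "\<not> mg u (x 0)" "j \<ge> 1" for u j
    proof -
      have "S j (\<rho> u) \<noteq> x k" for k
      proof
        assume eq: "S j (\<rho> u) = x k"
        then have "j = k" using lev So[OF \<rho>(1)[OF that(1)], of j] orb_refl by metis
        then have "mg (\<rho> u) (x 0)" using eq Sx unfolding mg_def by metis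
        then show False using \<rho>(2)[OF that(1)] mg_tr that(2) by blast
      qed
      then show ?thesis using cQ[of "S j (\<rho> u)"] that unfolding Q_def R_def q_def by blast
    qed
    show ?thesis
    proof (rule distinguishing_number_le_2I[of c])
      fix f assume f: "f \<in> A" "\<And>x. x \<in> V \<Longrightarrow> c (f x) = c x"
      define z where "z = f (x 0)"
      have zo: "z \<in> orb (x 0)" unfolding z_def using orbI f(1) by blast
      have Sz: "S i z = f (x i)" for i
        by (induction i) (auto simp: S0 SS z_def s_A[OF f(1) two] sx)
      have cz: "c (S i z)" for i using Sz cx f(2) two_V[OF two] by simp
      \<comment> \<open>The image of the ray is black throughout, whereas the representative of a
        foreign class, into which it would run, is white from level 1 on.\<close>
      have m: "mg z (x 0)"
      proof (rule ccontr)
        assume nm: "\<not> mg z (x 0)"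
        obtain i where "S i z = S i (\<rho> z)" using \<rho>(2)[OF zo] unfolding mg_def by blast
        then have "S (Suc i) z = S (Suc i) (\<rho> z)" using SS by metis
        then show False using cz[of "Suc i"] cR[OF zo nm, of "Suc i"] by auto
      qed
      define i where "i = (LEAST i. S i z = x i)"
      have ex: "\<exists>i. S i z = x i" using m Sx unfolding mg_def by metis
      then have i: "S i z = x i" unfolding i_def by (rule LeastI_ex)
      \<comment> \<open>At the first common vertex the image of the ray would come in through the
        sibling \<open>x' k\<close>, which is white.\<close>
      have "i = 0"
      proof (rule ccontr)
        assume "i \<noteq> 0"
        then obtain k where k: "i = Suc k" using not0_implies_Suc by blast
        have nk: "S k z \<noteq> x k" using not_less_Least[of k "\<lambda>i. S i z = x i"] k unfolding i_def
          by auto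
        have so: "S k z \<in> orb (x k)" using So[OF zo] .
        have "s (S k z) = x (Suc k)" using i k SS by simp
        then have "S k z \<in> N (x (Suc k))" using s_N[OF two'[OF so]] N_sym by metis
        moreover have "S k z \<noteq> s (x (Suc k))"
          using sx so lev[of "S k z" k "Suc (Suc k)"] orb_refl
            by (metis n_not_Suc_n Suc_n_not_le_n le_SucI order_refl)
        ultimately have "S k z \<in> t (x (Suc k))" using t_iff by blast
        then have "S k z = x' k" using x'(1)[of k] nk by blast
        then show False using cz[of k] cx' by simp
      qed
      then have f0: "f (x 0) = x 0" using i S0 unfolding z_def by simp
      have fx: "f (x i) = x i" for i
        using Sz[of i] Sx f0 unfolding z_def by simp
      have "f (x' i) = x' i" for i
      proof -
        have "f (x' i) \<in> t (f (x (Suc i)))" using t_A_iff[OF f(1) two] x'(1)[of i] by blast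
        moreover have "f (x' i) \<noteq> f (x i)" using x'(2)[of i] by (simp add: A_inj[OF f(1)])
        ultimately show ?thesis using fx x'(1)[of i] by auto
      qed
      then have "f \<in> F" unfolding F_def D0_def using f(1) fx by blast
      then show "\<forall>x\<in>V. f x = x" using cF f(2) by blast
    qed
  qed
qed

end

section \<open>Reversed edges between vertices of type 2\<close>

text \<open>The edge \<open>vw\<close> is fixed from both of its ends and reversed by \<open>h\<close>.\<close>

locale semi_edge = connected_cubic_graph +
  fixes v w a b a' b' :: 'a and h :: "'a \<Rightarrow> 'a"
  assumes two_v: "two v" and sv: "s v = w" and h: "h \<in> A" "h v = w" "h w = v" "h a = a'" "h b = b'"
    and tv: "t v = {a, b}" and tw: "t w = {a', b'}" and ab: "a \<noteq> b"
    and disj: "{a, b} \<inter> {a', b'} = {}"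
begin

lemma two_w: "two w"
  using two_A[OF h(1), of v] h two_v by simp

lemma sw: "s w = v"
  using s_A[OF h(1) two_v] sv h by simp

lemma ab': "a' \<noteq> b'"
  using A_inj[OF h(1), of a b] h ab by simp

lemma Nv: "N v = {w, a, b}"
  using N_two[OF two_v] sv tv by simp

lemma Nw: "N w = {v, a', b'}"
  using N_two[OF two_w] sw tw by simp

lemma distinct6: "distinct [v, w, a, b, a', b']"
proof -
  have "a \<noteq> w" "b \<noteq> w" using t_iff[of _ v] tv sv by auto
  moreover have "a' \<noteq> v" "b' \<noteq> v" using t_iff[of _ w] tw sw by auto
  moreover have "v \<noteq> w" "a \<noteq> v" "b \<noteq> v" using Nv N_irrefl[of v] by auto
  moreover have "a' \<noteq> w" "b' \<noteq> w" using Nw N_irrefl[of w] by auto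
  ultimately show ?thesis using ab ab' disj by auto
qed

lemma flip:
  obtains g where "g \<in> A" "g v = v" "g w = w" "g a = b" "g b = a"
proof -
  have "a \<in> t v" using tv by simp
  then obtain c g where g: "t v = {a, c}" "a \<noteq> c" "g \<in> A" "g v = v" "g a = c" "g c = a"
    using t_cases'[OF two_v] by metis
  then have "c = b" using tv by (auto simp: doubleton_eq_iff)
  moreover have "g w = w" using pinnedD[OF s_pinned[OF two_v]] g sv by simp
  ultimately show thesis using that[of g] g by simp
qed

lemma pin: "pinned v w" "pinned w v"
  using s_pinned[OF two_v] s_pinned[OF two_w] sv sw by simp_all

lemma fix_v:
  assumes "f \<in> A" "f v = v"
  shows "f w = w" "f a = a \<and> f b = b \<or> f a = b \<and> f b = a" "f a' = a' \<and> f b' = b' \<or> f a' = b' \<and> f b' = a'"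
proof -
  show fw: "f w = w" using pinnedD[OF pin(1)] assms .
  have "f ` t v = t v" "f ` t w = t w" using t_A[OF assms(1)] two_v two_w assms(2) fw by metis+
  then show "f a = a \<and> f b = b \<or> f a = b \<and> f b = a" "f a' = a' \<and> f b' = b' \<or> f a' = b' \<and> f b' = a'"
    unfolding tv tw by (auto simp: doubleton_eq_iff)
qed

lemma swap_v:
  assumes "f \<in> A" "f v = w"
  shows "f w = v" "f a = a' \<and> f b = b' \<or> f a = b' \<and> f b = a'" "f a' = a \<and> f b' = b \<or> f a' = b \<and> f b' = a"
proof -
  have "s (f v) = f (s v)" using s_A[OF assms(1) two_v] .
  then show fw: "f w = v" using assms(2) sv sw by simp
  have "f ` t v = t w" "f ` t w = t v" using t_A[OF assms(1)] two_v two_w assms(2) fw by metis+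
  then show "f a = a' \<and> f b = b' \<or> f a = b' \<and> f b = a'" "f a' = a \<and> f b' = b \<or> f a' = b \<and> f b' = a"
    unfolding tv tw by (auto simp: doubleton_eq_iff)
qed

lemma orb_v:
  assumes "y \<in> orb v"
  shows "two y" "s y \<in> orb v" "s (s y) = y"
proof -
  obtain f where f: "f \<in> A" "y = f v" using assms by (rule orbE)
  show "two y" using two_A[OF f(1)] two_v f(2) by simp
  have sy: "s y = f w" using s_A[OF f(1) two_v] f(2) sv by simp
  then show "s (s y) = y" using s_A[OF f(1) two_w] f(2) sw by simp
  have "w \<in> orb v" using orbI[OF h(1), of v] h by simp
  then show "s y \<in> orb v" using sy orb_A[OF f(1)] by simp
qed

text \<open>The images of the edge are the pairs \<open>{y, s y}\<close> with \<open>y\<close> in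
  \<open>orb v\<close>. So \<open>root_pair\<close> only asks that each further black vertex of this
  orbit has a white partner in the seed, and \<open>f\<close> either fixes the edge or reverses
  it.\<close>

lemma blacks:
  assumes D0: "D0 \<subseteq> V" "v \<in> D0" "w \<in> D0" "\<And>x. x \<in> D0 \<Longrightarrow> N x \<inter> D0 \<noteq> {}"
    and Bl: "Bl \<subseteq> D0" "v \<in> Bl" "w \<in> Bl"
    and unique: "\<And>y. y \<in> Bl \<Longrightarrow> y \<in> orb v \<Longrightarrow> y \<noteq> v \<Longrightarrow> y \<noteq> w \<Longrightarrow> s y \<in> D0 - Bl"
    and stay: "\<And>f x. f \<in> A \<Longrightarrow> f v = v \<Longrightarrow> f w = w \<Longrightarrow>
      (\<And>x. x \<in> D0 \<Longrightarrow> f x \<in> D0 \<Longrightarrow> f x \<in> Bl \<longleftrightarrow> x \<in> Bl) \<Longrightarrow> x \<in> D0 \<Longrightarrow> f x = x"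
    and noswap: "\<And>f x. f \<in> A \<Longrightarrow> f v = w \<Longrightarrow> f w = v \<Longrightarrow>
      (\<And>x. x \<in> D0 \<Longrightarrow> f x \<in> D0 \<Longrightarrow> f x \<in> Bl \<longleftrightarrow> x \<in> Bl) \<Longrightarrow> False"
  shows "distinguishing_number G \<le> 2"
proof (rule root_pair[of w v D0 Bl])
  show "w \<in> N v" using Nv by simp
  show "k w = v" if "k \<in> A" "k v = w" for k using swap_v(1) that .
  show "{f v, f w} \<inter> (D0 - Bl) \<noteq> {}"
    if f: "f \<in> A" "{f v, f w} \<noteq> {v, w}" "{f v, f w} \<inter> Bl \<noteq> {}" for f
  proof -
    have ss: "s (f v) = f w" "s (f w) = f v"
      using s_A[OF f(1) two_v] s_A[OF f(1) two_w] sv sw by simp_all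
    have o: "f v \<in> orb v" "f w \<in> orb v" using orb_v(2)[of "f v"] orbI[OF f(1)] ss by auto
    have *: "y \<noteq> v \<and> y \<noteq> w" if "y = f v \<or> y = f w" for y
    proof (rule ccontr)
      assume "\<not> (y \<noteq> v \<and> y \<noteq> w)"
      then have "{y, s y} = {v, w}" using sv sw by auto
      moreover have "{y, s y} = {f v, f w}" using that ss by auto
      ultimately show False using f(2) by simp
    qed
    then show ?thesis using f(3) unique[of "f v"] unique[of "f w"] o ss by auto
  qed
  show "f x = x"
    if f: "f \<in> A" "{f v, f w} = {v, w}" and col: "\<And>x. x \<in> D0 \<Longrightarrow> f x \<in> D0 \<Longrightarrow> f x \<in> Bl \<longleftrightarrow> x \<in> Bl"
    and x: "x \<in> D0" for f x
  proof -
    have "f v = v \<and> f w = w \<or> f v = w \<and> f w = v" using f(2) by (auto simp: doubleton_eq_iff)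
    then show ?thesis using stay[OF f(1) _ _ col x] noswap[OF f(1) _ _ col] by blast
  qed
  show "N x \<inter> D0 \<noteq> {}" if "x \<in> D0" for x using D0(4) that .
  show "pinned v w" "pinned w v" by (rule pin)+
  show "D0 \<subseteq> V" "v \<in> D0" "w \<in> D0" by (rule D0)+
  show "Bl \<subseteq> D0" "v \<in> Bl" "w \<in> Bl" by (rule Bl)+
qed

text \<open>One black vertex below each end determines how \<open>f\<close> acts on all six
  vertices, up to the reversal that matches \<open>a\<close> with \<open>a'\<close>. Excluding this
  reversal is what remains in each application.\<close>

lemma coloring_blacks2:
  assumes D0: "D0 \<subseteq> V" "{v, w, a, b, a', b'} \<subseteq> D0" "\<And>x. x \<in> D0 \<Longrightarrow> N x \<inter> D0 \<noteq> {}"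
    and Bl: "Bl \<subseteq> D0" "v \<in> Bl" "w \<in> Bl" "a \<in> Bl" "a' \<in> Bl" "b \<notin> Bl" "b' \<notin> Bl"
    and unique: "\<And>y. y \<in> Bl \<Longrightarrow> y \<in> orb v \<Longrightarrow> y \<noteq> v \<Longrightarrow> y \<noteq> w \<Longrightarrow> s y \<in> D0 - Bl"
    and stay: "\<And>f x. f \<in> A \<Longrightarrow> f v = v \<Longrightarrow> f w = w \<Longrightarrow> f a = a \<Longrightarrow> f b = b \<Longrightarrow> f a' = a' \<Longrightarrow> f b' = b' \<Longrightarrow>
      (\<And>x. x \<in> D0 \<Longrightarrow> f x \<in> D0 \<Longrightarrow> f x \<in> Bl \<longleftrightarrow> x \<in> Bl) \<Longrightarrow> x \<in> D0 \<Longrightarrow> f x = x"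
    and noswap: "\<And>f x. f \<in> A \<Longrightarrow> f v = w \<Longrightarrow> f w = v \<Longrightarrow> f a = a' \<Longrightarrow> f b = b' \<Longrightarrow> f a' = a \<Longrightarrow> f b' = b \<Longrightarrow>
      (\<And>x. x \<in> D0 \<Longrightarrow> f x \<in> D0 \<Longrightarrow> f x \<in> Bl \<longleftrightarrow> x \<in> Bl) \<Longrightarrow> False"
  shows "distinguishing_number G \<le> 2"
proof (rule blacks[of D0 Bl])
  fix f assume f: "f \<in> A" and col: "\<And>x. x \<in> D0 \<Longrightarrow> f x \<in> D0 \<Longrightarrow> f x \<in> Bl \<longleftrightarrow> x \<in> Bl"
  { fix x assume fv: "f v = v" "f w = w" and x: "x \<in> D0"
    have "f a = a" "f b = b" "f a' = a'" "f b' = b'"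
      using fix_v(2,3)[OF f fv(1)] col[of a] col[of a'] Bl D0(2) by auto
    then show "f x = x" using stay[OF f fv _ _ _ _ col x] by blast }
  { assume fv: "f v = w" "f w = v"
    have "f a = a'" "f b = b'" "f a' = a" "f b' = b"
      using swap_v(2,3)[OF f fv(1)] col[of a] col[of a'] Bl D0(2) by auto
    then show False using noswap[OF f fv _ _ _ _ col] by blast }
next
  show "N x \<inter> D0 \<noteq> {}" if "x \<in> D0" for x using D0(3) that .
  show "s y \<in> D0 - Bl" if "y \<in> Bl" "y \<in> orb v" "y \<noteq> v" "y \<noteq> w" for y using unique that .
  show "D0 \<subseteq> V" by (rule D0)
  show "v \<in> D0" "w \<in> D0" using D0(2) by simp_all
  show "Bl \<subseteq> D0" "v \<in> Bl" "w \<in> Bl" by (rule Bl)+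
qed

text \<open>Every neighbor of a vertex in \<open>orb v\<close> plays the role of \<open>w\<close>,
  \<open>a\<close> or \<open>b\<close>, and each of these pins it. So members of the orbit are fixed
  as soon as a neighbor is, and \<open>free_orbit\<close> applies.\<close>

lemma pinned_case:
  assumes "pinned a v"
  shows "distinguishing_number G \<le> 2"
proof (rule free_orbit[of v a])
  show "v \<in> V" using two_V[OF two_v] .
  show "a \<in> N v" using Nv by simp
  obtain g where g: "g \<in> A" "g v = v" "g a = b" using flip by metis
  have pb: "pinned b v" using pinned_A[OF g(1), of a v] assms g by simp
  show "a \<notin> orb v"
  proof
    assume a: "a \<in> orb v"
    have "s a = v" using s_eqI[OF orb_v(1)[OF a] _ assms] Nv N_sym by blast
    then show False using orb_v(3)[OF a] sv distinct6 by simp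
  qed
  show "f y = y" if "f \<in> A" "f v = v" "f a = a" "y \<in> N v" for f y
    using fix_v[OF that(1,2)] that ab Nv by auto
  show "f u = u" if u: "u \<in> orb v" "N p = {e, u, u'}" "f \<in> A" "f p = p" for p e u u' f
  proof -
    obtain k where k: "k \<in> A" "u = k v" using u(1) by (rule orbE)
    have "p \<in> N u" using u(2) N_sym by blast
    then have "p \<in> {k w, k a, k b}" using A_N_image[OF k(1), of v] k(2) Nv by simp
    then have "pinned p u" using pinned_A[OF k(1)] k(2) assms pb pin(2) by auto
    then show ?thesis using pinnedD u by blast
  qed
qed

lemma N_V6: "{v, w, a, b, a', b'} \<subseteq> V"
proof -
  have "a \<in> N v" "b \<in> N v" "a' \<in> N w" "b' \<in> N w" using Nv Nw by simp_all
  then show ?thesis using two_V[OF two_v] two_V[OF two_w] N_V(1) by simp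
qed

lemma N6: "w \<in> N v" "v \<in> N w" "v \<in> N a" "v \<in> N b" "w \<in> N a'" "w \<in> N b'"
  using N_sym[of v a] N_sym[of v b] N_sym[of w a'] N_sym[of w b'] Nv Nw by simp_all

text \<open>Since \<open>a'\<close> follows \<open>a\<close>, a single black vertex \<open>a\<close>
  below the edge fixes all six vertices. It also prevents the reversal, as there is no black vertex
  below \<open>w\<close>. If \<open>a\<close> belongs to \<open>orb v\<close>, it needs the white
  partner \<open>s a\<close>.\<close>

lemma dependent_case:
  assumes np: "\<not> pinned a v" and dep: "\<And>f. f \<in> A \<Longrightarrow> f v = v \<Longrightarrow> f a = a \<Longrightarrow> f a' = a'"
  shows "distinguishing_number G \<le> 2"
proof -
  define D0 where "D0 = {v, w, a, b, a', b'} \<union> (if a \<in> orb v then {s a} else {})"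
  have nb: "a \<notin> N w" using Nw distinct6 by auto
  have sa: "s a \<notin> {v, w, a}" "s a \<in> N a" "two a" if "a \<in> orb v"
  proof -
    show ta: "two a" using orb_v(1)[OF that] .
    show "s a \<in> N a" using s_N[OF ta] .
    then have "s a \<noteq> a" "s a \<noteq> w" using N_irrefl nb N_sym by metis+
    moreover have "s a \<noteq> v" using s_pinned[OF ta] np by metis
    ultimately show "s a \<notin> {v, w, a}" by blast
  qed
  show ?thesis
  proof (rule blacks[of D0 "{v, w, a}"])
    show "D0 \<subseteq> V" using N_V6 sa(2) N_V(1) unfolding D0_def by auto
    show "N x \<inter> D0 \<noteq> {}" if "x \<in> D0" for x
    proof -
      have "a \<in> N (s a)" if "a \<in> orb v" using sa(2)[OF that] N_sym by blast
      then show ?thesis using that N6 unfolding D0_def by (auto split: if_splits)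
    qed
    show "s y \<in> D0 - {v, w, a}" if "y \<in> {v, w, a}" "y \<in> orb v" "y \<noteq> v" "y \<noteq> w" for y
      using that sa(1) unfolding D0_def by auto
    fix f assume f: "f \<in> A" and col: "\<And>x. x \<in> D0 \<Longrightarrow> f x \<in> D0 \<Longrightarrow> f x \<in> {v, w, a} \<longleftrightarrow> x \<in> {v, w, a}"
    { fix x assume fv: "f v = v" "f w = w" and x: "x \<in> D0"
      have "f a = a" "f b = b" using fix_v(2)[OF f fv(1)] col[of a] distinct6 unfolding D0_def
        by auto
      moreover have "f a' = a'" "f b' = b'"
        using dep[OF f fv(1)] calculation fix_v(3)[OF f fv(1)] ab' by auto
      moreover have "f (s a) = s a" if "a \<in> orb v"
        using s_A[OF f sa(3)[OF that]] calculation by simp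
      ultimately show "f x = x" using fv x unfolding D0_def by (auto split: if_splits) }
    { assume fv: "f v = w"
      show False using swap_v(2)[OF f fv] col[of a] distinct6 unfolding D0_def by auto }
  qed (auto simp: D0_def)
qed

text \<open>Now \<open>a\<close> and \<open>a'\<close> must both be black, and one more black vertex
  has to break the reversal while its counterpart at the other end is white. It is
  \<open>s b\<close> unless \<open>s b = a\<close>; in that case it is the second common neighbor
  \<open>v'\<close> of \<open>a\<close> and \<open>b\<close>.\<close>

lemma two_case:
  assumes np: "\<not> pinned a v" and k: "k \<in> A" "k v = v" "k a = a" "k a' \<noteq> a'" and ta: "two a"
  shows "distinguishing_number G \<le> 2"
proof -
  have d: "v \<noteq> w" "v \<noteq> a" "v \<noteq> b" "v \<noteq> a'" "v \<noteq> b'" "w \<noteq> a" "w \<noteq> b" "w \<noteq> a'" "w \<noteq> b'" "a \<noteq> b" "a \<noteq> a'" "a \<noteq> b'"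
    "b \<noteq> a'" "b \<noteq> b'" "a' \<noteq> b'" using distinct6 by auto
  have k': "k w = w" "k b = b" "k a' = b'" "k b' = a'" using fix_v[OF k(1,2)] k(3,4) d by auto
  obtain g where g: "g \<in> A" "g v = v" "g w = w" "g a = b" "g b = a" using flip by metis
  have tb: "two b" using two_A[OF g(1), of a] ta g by simp
  have ta': "two a'" using two_A[OF h(1), of a] ta h by simp
  have tb': "two b'" using two_A[OF h(1), of b] tb h by simp
  have hs: "h (s a) = s a'" "h (s b) = s b'" using s_A[OF h(1) ta] s_A[OF h(1) tb] h by simp_all
  have gs: "g (s a) = s b" "g (s b) = s a" using s_A[OF g(1) ta] s_A[OF g(1) tb] g by simp_all
  have va: "v \<in> t a" using t_iff N6 s_pinned[OF ta] np by metis
  have vb: "v \<in> t b" using t_A_iff[OF g(1) ta, of v] va g by simp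
  have sav: "s a \<noteq> v" "s b \<noteq> v" using va vb t_iff by metis+
  have sa'w: "s a' \<noteq> w" "s b' \<noteq> w" using sav hs h A_inj[OF h(1)] by metis+
  have Na: "k x = x" if "x \<in> N a" for x using two_stab[OF ta k(1,3) va k(2) that] .
  have Nb: "k x = x" if "x \<in> N b" for x using two_stab[OF tb k(1) k'(2) vb k(2) that] .
  have nab: "a' \<notin> N a" "b' \<notin> N a" "a' \<notin> N b" "b' \<notin> N b" using Na Nb k' d by metis+
  have nw: "w \<notin> N a" "w \<notin> N b" "v \<notin> N a'" "v \<notin> N b'" using Nv Nw N_sym d
    by (metis insertE singletonD)+
  have sN: "s a \<in> N a" "s b \<in> N b" "s a' \<in> N a'" "s b' \<in> N b'" using s_N ta tb ta' tb' by blast+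
  have kinj: "x = y" if "k x = k y" for x y using that A_inj[OF k(1)] by simp
  have hab: "h a' = a \<and> h b' = b \<or> h a' = b \<and> h b' = a" using swap_v(3)[OF h(1,2)] .
  show ?thesis
  proof (cases "s b = a")
    case False
    have sab: "s a \<noteq> b" using False gs g by metis
    have sb: "s b \<noteq> v" "s b \<noteq> w" "s b \<noteq> a" "s b \<noteq> b" "s b \<noteq> a'" "s b \<noteq> b'"
      using sav False sN nw nab N_neq by blast+
    have sb': "s b' \<noteq> v" "s b' \<noteq> w" "s b' \<noteq> a" "s b' \<noteq> b" "s b' \<noteq> b'"
      using sa'w sN nw nab N_neq N_sym by blast+
    have sb'a': "s b' \<noteq> a'" using hs h A_inj[OF h(1), of "s b" a] False by metis
    \<comment> \<open>Applying \<open>k\<close> and \<open>h\<close> to a coincidence would make all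
      of \<open>a\<close>, \<open>b\<close>, \<open>a'\<close>, \<open>b'\<close> neighbors of one
      vertex.\<close>
    have ssne: "s b \<noteq> s b'"
    proof
      assume eq: "s b = s b'"
      have "k (s b) = s b" using Nb sN by blast
      then have "s a' = s b" using s_A[OF k(1) tb'] k' eq by metis
      moreover have hy: "h (s b) = s b" using hs eq by simp
      moreover have "s (h a') = h (s a')" "s (h b') = h (s b')" using s_A[OF h(1)] ta' tb'
        by simp_all
      ultimately have "s a = s b" using hab eq by metis
      then have "a \<in> N (s b)" "b \<in> N (s b)" "b' \<in> N (s b)" "a' \<in> N (s b)"
        using sN eq \<open>s a' = s b\<close> N_sym by metis+
      then have "N (s b) = {a, b, b'}" using N3_eq d by blast
      then show False using \<open>a' \<in> N (s b)\<close> d by simp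
    qed
    \<comment> \<open>This makes \<open>b\<close> the white partner of the black vertex
      \<open>s b\<close>. Otherwise \<open>b\<close> is in \<open>t (s b)\<close>, and some
      automorphism takes \<open>v\<close> to \<open>s b\<close> and fixes \<open>b\<close>. It then
      fixes \<open>s b\<close> too, which contradicts injectivity.\<close>
    have bo: "b \<in> orb v" if so: "s b \<in> orb v"
    proof (rule ccontr)
      assume nb: "b \<notin> orb v"
      obtain \<kappa> where \<kappa>: "\<kappa> \<in> A" "s b = \<kappa> v" using so by (rule orbE)
      have bN: "b \<in> N (s b)" using sN N_sym by blast
      have "b \<noteq> s (s b)" using orb_v(2)[OF so] nb by metis
      then have "b \<in> t (\<kappa> v)" using bN t_iff \<kappa>(2) by metis
      then have "b \<in> {\<kappa> a, \<kappa> b}" using t_A[OF \<kappa>(1) two_v] tv by simp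
      moreover have "\<kappa> (g b) = \<kappa> a" "\<kappa> (g v) = \<kappa> v" using g by simp_all
      ultimately obtain \<mu> where \<mu>: "\<mu> \<in> A" "\<mu> v = s b" "\<mu> b = b"
        using \<kappa> A_comp[OF \<kappa>(1) g(1)] by (metis comp_apply insertE singletonD)
      then have "\<mu> (s b) = s b" using s_A[OF \<mu>(1) tb] by simp
      then have "s b = v" using \<mu>(2) A_inj[OF \<mu>(1)] by metis
      then show False using sav by blast
    qed
    have a'o: "a' \<in> orb v \<longleftrightarrow> a \<in> orb v" "b \<in> orb v \<longleftrightarrow> a \<in> orb v"
      using orb_A[OF h(1), of a] orb_A[OF g(1), of a] h g by simp_all
    have sinj: "x = y" if "x \<in> orb v" "y \<in> orb v" "s x = s y" for x y using orb_v(3) that by metis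
    let ?S = "if a \<in> orb v then {s a, s a'} else {}"
    let ?D = "{v, w, a, b, a', b', s b, s b'} \<union> ?S"
    let ?B = "{v, w, a, a', s b}"
    show ?thesis
    proof (rule coloring_blacks2[of ?D ?B])
      show "?D \<subseteq> V" using N_V6 sN N_V(1) by auto
      show "N x \<inter> ?D \<noteq> {}" if "x \<in> ?D" for x
      proof -
        have "a \<in> N (s a)" "a' \<in> N (s a')" "b \<in> N (s b)" "b' \<in> N (s b')" using sN N_sym by blast+
        then show ?thesis using that N6 by (auto split: if_splits)
      qed
      show "b \<notin> ?B" "b' \<notin> ?B" using d sb by auto
      show "s y \<in> ?D - ?B" if y: "y \<in> ?B" "y \<in> orb v" "y \<noteq> v" "y \<noteq> w" for y
      proof -
        consider (1) "y = a" | (2) "y = a'" | (3) "y = s b" using y by blast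
        then show ?thesis
        proof cases
          case 1
          then have "s a \<noteq> s b" using sinj[of a b] y(2) a'o d by metis
          then have "s a \<notin> ?B" using sav sN nw nab N_neq by blast
          then show ?thesis using 1 y(2) by auto
        next
          case 2
          then have "s a' \<noteq> s b" using sinj[of a' b] y(2) a'o d by metis
          moreover have "s a' \<noteq> a" using nab sN N_sym by metis
          ultimately have "s a' \<notin> ?B" using sa'w sN nw N_neq by blast
          then show ?thesis using 2 y(2) a'o by auto
        next
          case 3
          then have "s y = b" using orb_v(3)[OF bo] y(2) by simp
          then show ?thesis using d sb by auto
        qed
      qed
      fix f assume f: "f \<in> A" and col: "\<And>x. x \<in> ?D \<Longrightarrow> f x \<in> ?D \<Longrightarrow> f x \<in> ?B \<longleftrightarrow> x \<in> ?B"
      { fix x assume fv: "f v = v" "f w = w" "f a = a" "f b = b" "f a' = a'" "f b' = b'" and x: "x \<in> ?D"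
        have "f (s a) = s a" "f (s b) = s b" "f (s a') = s a'" "f (s b') = s b'"
          using s_A[OF f] ta tb ta' tb' fv by metis+
        then show "f x = x" using fv x by (auto split: if_splits) }
      { assume fv: "f v = w" "f b = b'"
        have "f (s b) = s b'" using s_A[OF f tb] fv by simp
        then show False using col[of "s b"] sb' sb'a' ssne by auto }
    qed (use d in auto)
  next
    case sba: True
    then have sab: "s a = b" using gs g by metis
    obtain v' e where v': "t a = {v, v'}" "v \<noteq> v'" "e \<in> A" "e a = a" "e v = v'"
      using t_cases'[OF ta va] by metis
    have "e b = b" using s_A[OF v'(3) ta] v'(4) sab by simp
    then have v'b: "v' \<in> N b" using A_N[OF v'(3), of v b] N6 v'(5) by simp
    have v'a: "v' \<in> N a" using v'(1) t_N by blast
    define w' where "w' = h v'"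
    have hta: "t a' = {w, w'}" using t_A[OF h(1) ta] h v'(1) unfolding w'_def by simp
    have w'a: "w' \<in> N a'" using hta t_N by blast
    have w'b: "w' \<in> N b'" using A_N[OF h(1), of v' b] v'b h unfolding w'_def by simp
    have hb: "s a' = b'" "s b' = a'" using hs sab sba h by metis+
    have v'd: "v' \<noteq> v" "v' \<noteq> w" "v' \<noteq> a" "v' \<noteq> b" "v' \<noteq> a'" "v' \<noteq> b'"
      using v'(2) v'a v'b nw nab N_neq by blast+
    have w'd: "w' \<noteq> w" "w' \<noteq> v" "w' \<noteq> a" "w' \<noteq> b" "w' \<noteq> a'" "w' \<noteq> b'"
      using v'd h A_inj[OF h(1), of v' v] w'a w'b nw nab N_neq N_sym unfolding w'_def by metis+
    have vw': "v' \<noteq> w'"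
    proof
      assume "v' = w'"
      then have *: "a \<in> N v'" "b \<in> N v'" "a' \<in> N v'" "b' \<in> N v'" using v'a v'b w'a w'b N_sym
        by metis+
      then have "N v' = {a, b, a'}" using N3_eq d by blast
      then show False using *(4) d by simp
    qed
    have v'o: "v' \<in> orb v" using orbI[OF v'(3), of v] v'(5) by simp
    have tv': "two v'" "s (s v') = v'" using orb_v v'o by blast+
    have sv': "s v' \<noteq> v" "s v' \<noteq> w" "s v' \<noteq> a" "s v' \<noteq> a'" "s v' \<noteq> v'"
    proof -
      show "s v' \<noteq> v'" using s_N[OF tv'(1)] N_neq by blast
      show "s v' \<noteq> v" "s v' \<noteq> w" using tv'(2) sv sw v'd by metis+
      show "s v' \<noteq> a" "s v' \<noteq> a'" using tv'(2) sab hb v'd by metis+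
    qed
    let ?D = "{v, w, a, b, a', b', v', w', s v'}"
    let ?B = "{v, w, a, a', v'}"
    show ?thesis
    proof (rule coloring_blacks2[of ?D ?B])
      show "?D \<subseteq> V" using N_V6 v'a w'a s_N[OF tv'(1)] N_V(1) by auto
      show "N x \<inter> ?D \<noteq> {}" if "x \<in> ?D" for x
      proof -
        have "a \<in> N v'" "a' \<in> N w'" "v' \<in> N (s v')" using v'a w'a s_N[OF tv'(1)] N_sym by blast+
        then show ?thesis using that N6 by auto
      qed
      show "b \<notin> ?B" "b' \<notin> ?B" using d v'd by auto
      show "s y \<in> ?D - ?B" if y: "y \<in> ?B" "y \<in> orb v" "y \<noteq> v" "y \<noteq> w" for y
        using y sab hb sv' d v'd by auto
      fix f assume f: "f \<in> A" and col: "\<And>x. x \<in> ?D \<Longrightarrow> f x \<in> ?D \<Longrightarrow> f x \<in> ?B \<longleftrightarrow> x \<in> ?B"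
      { fix x assume fv: "f v = v" "f w = w" "f a = a" "f b = b" "f a' = a'" "f b' = b'" and x: "x \<in> ?D"
        have "f v' = v'" using two_stab[OF ta f fv(3) va fv(1) v'a] .
        moreover have "w \<in> t a'" using hta by blast
        then have "f w' = w'" using two_stab[OF ta' f fv(5) _ fv(2) w'a] by blast
        moreover have "f (s v') = s v'" using s_A[OF f tv'(1)] \<open>f v' = v'\<close> by simp
        ultimately show "f x = x" using fv x by auto }
      { assume fv: "f v = w" "f a = a'"
        have "f ` t a = t a'" using t_A[OF f ta] fv by simp
        then have "f v' = w'" using v'(1,2) hta fv w'd(1) by (auto simp: doubleton_eq_iff)
        then show False using col[of v'] w'd vw' by auto }
    qed (use d in auto)
  qed
qed

text \<open>Transitivity puts all neighbors of \<open>a\<close> and \<open>a'\<close> into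
  \<open>orb v\<close>, so any of them that is black needs a white partner. The reversal is broken
  one step further down, by colors on \<open>v2, v3\<close> against \<open>H v2, H v3\<close>. How
  many of these must be fixed by color depends on what is fixed with \<open>v\<close>,
  \<open>a\<close>, \<open>a'\<close> already.\<close>

lemma transitive_case:
  assumes k: "k \<in> A" "k v = v" "k a = a" "k a' \<noteq> a'" and ta: "transitive a"
  shows "distinguishing_number G \<le> 2"
proof -
  have d: "v \<noteq> w" "v \<noteq> a" "v \<noteq> b" "v \<noteq> a'" "v \<noteq> b'" "w \<noteq> a" "w \<noteq> b" "w \<noteq> a'" "w \<noteq> b'" "a \<noteq> b" "a \<noteq> a'" "a \<noteq> b'"
    "b \<noteq> a'" "b \<noteq> b'" "a' \<noteq> b'" using distinct6 by auto
  have k': "k w = w" "k b = b" "k a' = b'" "k b' = a'" using fix_v[OF k(1,2)] k(3,4) d by auto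
  obtain g where g: "g \<in> A" "g v = v" "g w = w" "g a = b" "g b = a" using flip by metis
  obtain H where H: "H \<in> A" "H v = w" "H w = v" "H a = a'" "H a' = a" "H b = b'" "H b' = b"
  proof (cases "h a' = a")
    case True
    then show thesis using that[of h] h swap_v(3)[OF h(1,2)] d by metis
  next
    case False
    then have "h a' = b" "h b' = a" using swap_v(3)[OF h(1,2)] by auto
    then show thesis using that[of "h \<circ> k"] A_comp[OF h(1) k(1)] h k k' by simp
  qed
  have orbN: "y \<in> orb v" if y: "y \<in> N a" for y
  proof -
    obtain f where "f \<in> A" "f v = y" using transitiveD[OF ta N6(3) y] by metis
    then show ?thesis using orbI by blast
  qed
  have HN: "H y \<in> N a'" if "y \<in> N a" for y using A_N[OF H(1), of y a] H(4) that by simp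
  have ta': "transitive a'" and tb: "transitive b"
    using transitive_A[OF h(1) ta] transitive_A[OF g(1) ta] h g by simp_all
  have tb': "transitive b'" using transitive_A[OF h(1) tb] h by simp
  have no: "a \<notin> orb v" "b \<notin> orb v" "a' \<notin> orb v" "b' \<notin> orb v"
    using orb_v(1) two_not_transitive ta ta' tb tb' by blast+
  have orbN': "y \<in> orb v" if y: "y \<in> N a'" for y
  proof -
    have "w \<in> orb v" using orbI[OF h(1), of v] h by simp
    moreover obtain f where "f \<in> A" "f w = y" using transitiveD[OF ta' N6(5) y] by metis
    ultimately show ?thesis using orb_A by blast
  qed
  have sym: "x = y" if "x \<in> orb v" "y \<in> orb v" "s x = s y" for x y using orb_v(3) that by metis
  have nw: "w \<notin> N a" "v \<notin> N a'" using Nv Nw N_sym d by (metis insertE singletonD)+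
  obtain v2 v3 where N: "N a = {v, v2, v3}" "v \<noteq> v2" "v \<noteq> v3" "v2 \<noteq> v3"
    using N3[OF _ N6(3)] N6(3) N_V(2) by metis
  have N': "N a' = {w, H v2, H v3}" using A_N_image[OF H(1), of a] H N by simp
  have Hne: "w \<noteq> H v2" "w \<noteq> H v3" "H v2 \<noteq> H v3" using A_inj[OF H(1)] H(2) N(2-4) by metis+
  \<comment> \<open>Otherwise \<open>v2\<close> and \<open>v3\<close> both have
    \<open>{a, a'}\<close> as lower neighbors. An automorphism that fixes \<open>a\<close> and takes
    \<open>v2\<close> to \<open>v\<close> takes \<open>a'\<close> to \<open>b\<close>. It takes
    \<open>v3\<close> to \<open>v2\<close> or \<open>v3\<close> again, whose lower neighbors would
    then also be \<open>{a, b}\<close>.\<close>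
  have not_both: "\<not> (v2 \<in> N a' \<and> v3 \<in> N a')"
  proof
    assume both: "v2 \<in> N a' \<and> v3 \<in> N a'"
    have tx: "t x = {a, a'}" if x: "x = v2 \<or> x = v3" for x
    proof -
      have xN: "x \<in> N a" "x \<in> N a'" "two x" using x N both orb_v(1) orbN by auto
      have "s x \<noteq> a" "s x \<noteq> a'" using orb_v(2)[OF orbN[OF xN(1)]] no by metis+
      then have "a \<in> t x" "a' \<in> t x" using xN N_sym t_iff by metis+
      then show ?thesis using t_cases[OF xN(3)] d(11) by (metis insertE singletonD doubleton_eq_iff)
    qed
    obtain \<kappa> where \<kappa>: "\<kappa> \<in> A" "\<kappa> a = a" "\<kappa> v2 = v" using transitiveD[OF ta _ N6(3), of v2] N by auto
    have two2: "two v2" "two v3" using orb_v(1) orbN N by auto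
    have "{a, \<kappa> a'} = {a, b}" using t_A[OF \<kappa>(1) two2(1)] tx \<kappa> tv by simp
    then have \<kappa>a': "\<kappa> a' = b" using A_inj[OF \<kappa>(1), of a' a] \<kappa>(2) d by (auto simp: doubleton_eq_iff)
    have "\<kappa> v3 \<in> N a" using A_N[OF \<kappa>(1), of v3 a] \<kappa>(2) N by simp
    moreover have "\<kappa> v3 \<noteq> v" using A_inj[OF \<kappa>(1), of v3 v2] \<kappa>(3) N by simp
    ultimately have "t (\<kappa> v3) = {a, a'}" using tx N by auto
    moreover have "t (\<kappa> v3) = {a, b}" using t_A[OF \<kappa>(1) two2(2)] tx \<kappa> \<kappa>a' by simp
    ultimately show False using d by (auto simp: doubleton_eq_iff)
  qed
  have inN: "v2 \<in> N a" "v3 \<in> N a" using N by auto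
  have o23: "v2 \<in> orb v" "v3 \<in> orb v" "H v2 \<in> orb v" "H v3 \<in> orb v" using orbN orbN' inN HN
    by blast+
  have inA: "a \<in> N v2" "a \<in> N v3" "a' \<in> N (H v2)" "a' \<in> N (H v3)" using inN HN N_sym by blast+
  have snb: "s y \<noteq> v" "s y \<noteq> w" "s y \<noteq> a" "s y \<noteq> a'" "s y \<noteq> b" "s y \<noteq> b'" "s y \<noteq> y" "y \<in> N (s y)" "s y \<in> V" "two y"
    if "y \<in> orb v" "y \<noteq> v" "y \<noteq> w" for y
  proof -
    show ty: "two y" using orb_v(1) that by blast
    show "s y \<noteq> v" "s y \<noteq> w" using orb_v(3)[OF that(1)] sv sw that by metis+
    show "s y \<noteq> a" "s y \<noteq> a'" "s y \<noteq> b" "s y \<noteq> b'" using orb_v(2)[OF that(1)] no by metis+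
    show "s y \<noteq> y" "y \<in> N (s y)" "s y \<in> V" using s_N[OF ty] N_neq N_sym N_V by blast+
  qed
  have v23: "v2 \<noteq> w" "v3 \<noteq> w" "H v2 \<noteq> v" "H v3 \<noteq> v" using nw inN HN by metis+
  show ?thesis
  proof (cases "\<forall>f\<in>A. f v = v \<longrightarrow> f a = a \<longrightarrow> f a' = a' \<longrightarrow> f v2 = v2")
    case True
    have fixNa: "f y = y" if f: "f \<in> A" "f v = v" "f a = a" "f a' = a'" and y: "y \<in> N a" for f y
    proof -
      have 2: "f v2 = v2" using True f by blast
      have "f v3 \<in> N a" using A_N[OF f(1), of v3 a] f(3) inN by simp
      moreover have "f v3 \<noteq> f v" "f v3 \<noteq> f v2" using A_inj[OF f(1)] N by metis+
      ultimately have "f v3 = v3" using N f(2) 2 by auto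
      then show ?thesis using y N f 2 by auto
    qed
    have fixNa': "f y = y" if f: "f \<in> A" "f v = v" "f a = a" "f a' = a'" and y: "y \<in> N a'" for f y
    proof -
      obtain L where L: "L \<in> A" "\<And>x. L (H x) = x" "\<And>x. H (L x) = x" using A_inv[OF H(1)] by metis
      have Lf: "L \<circ> f \<circ> H \<in> A" using A_comp L(1) f(1) H(1) by blast
      have "f w = w" using fix_v(1)[OF f(1,2)] .
      then have "(L \<circ> f \<circ> H) v = v" "(L \<circ> f \<circ> H) a = a" "(L \<circ> f \<circ> H) a' = a'"
        using H f L(2)[of v] L(2)[of a] L(2)[of a'] by simp_all
      moreover have "L y \<in> N a" using A_N[OF H(1), of "L y" a] L(3) H(4) y by simp
      ultimately have "(L \<circ> f \<circ> H) (L y) = L y" using fixNa[OF Lf] by blast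
      then show ?thesis using L(3) by (metis comp_apply)
    qed
    obtain x where x: "x = v2 \<or> x = v3" "x \<notin> N a'" using not_both by blast
    have xs: "x \<in> N a" "x \<in> orb v" "x \<noteq> v" "x \<noteq> w" "x \<noteq> a" "x \<noteq> a'" "x \<noteq> b" "x \<noteq> b'"
      using x inN o23 N(2,3) v23 no by auto
    let ?D = "{v, w, a, b, a', b', s x} \<union> N a \<union> N a'"
    let ?B = "{v, w, a, a', x}"
    show ?thesis
    proof (rule coloring_blacks2[of ?D ?B])
      show "?D \<subseteq> V" using N_V6 N_V(1) snb(9)[OF xs(2-4)] by auto
      show "N y \<inter> ?D \<noteq> {}" if "y \<in> ?D" for y
      proof -
        have "a \<in> N y" if "y \<in> N a" for y using that N_sym by blast
        moreover have "a' \<in> N y" if "y \<in> N a'" for y using that N_sym by blast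
        ultimately show ?thesis using that N6 snb(8)[OF xs(2-4)] xs(1) by blast
      qed
      show "?B \<subseteq> ?D" using xs(1) by blast
      show "b \<notin> ?B" "b' \<notin> ?B" using d xs by auto
      show "s y \<in> ?D - ?B" if y: "y \<in> ?B" "y \<in> orb v" "y \<noteq> v" "y \<noteq> w" for y
      proof -
        have "y = x" using y no by blast
        then show ?thesis using snb[OF xs(2-4)] by auto
      qed
      fix f assume f: "f \<in> A" and col: "\<And>x. x \<in> ?D \<Longrightarrow> f x \<in> ?D \<Longrightarrow> f x \<in> ?B \<longleftrightarrow> x \<in> ?B"
      { fix y assume fv: "f v = v" "f w = w" "f a = a" "f b = b" "f a' = a'" "f b' = b'" and y: "y \<in> ?D"
        have "f (s x) = s x" using s_A[OF f snb(10)[OF xs(2-4)]] fixNa[OF f fv(1,3,5) xs(1)] by simp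
        then show "f y = y" using fv y fixNa[OF f fv(1,3,5)] fixNa'[OF f fv(1,3,5)] by auto }
      { assume fv: "f v = w" "f a = a'"
        have fx: "f x \<in> N a'" using A_N[OF f, of x a] fv xs(1) by simp
        then have "f x \<in> ?B" using col[of x] xs(1) by blast
        moreover have "f x \<noteq> w" using A_inj[OF f, of x v] fv xs by simp
        moreover have "f x \<noteq> a" "f x \<noteq> a'" using orbN'[OF fx] no by blast+
        ultimately show False using fx nw(2) x(2) by auto }
    qed auto
  next
    case False
    \<comment> \<open>This \<open>m\<close> exchanges \<open>v2\<close> and \<open>v3\<close> while
      fixing \<open>a'\<close>, so by \<open>not_both\<close> neither of them is adjacent to
      \<open>a'\<close>.\<close>
    then obtain m where m: "m \<in> A" "m v = v" "m a = a" "m a' = a'" "m v2 \<noteq> v2" by blast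
    have "m v2 \<in> N a" "m v3 \<in> N a" using A_N[OF m(1), of _ a] m(3) inN by auto
    moreover have "m v2 \<noteq> v" "m v3 \<noteq> v" "m v2 \<noteq> m v3" using A_inj[OF m(1)] m(2) N by metis+
    ultimately have m23: "m v2 = v3" "m v3 = v2" using N m(5) by auto
    have mN': "m y \<in> N a'" if "y \<in> N a'" for y using A_N[OF m(1), of y a'] m(4) that by simp
    have out: "v2 \<notin> N a'" "v3 \<notin> N a'" using mN' m23 not_both by metis+
    then have ne4: "v2 \<noteq> H v2" "v2 \<noteq> H v3" "v3 \<noteq> H v2" "v3 \<noteq> H v3" using N' by auto
    let ?w2 = "H v2" and ?w3 = "H v3"
    have dd: "a \<noteq> v2" "a \<noteq> v3" "a \<noteq> ?w2" "a \<noteq> ?w3" "a' \<noteq> v2" "a' \<noteq> v3" "a' \<noteq> ?w2" "a' \<noteq> ?w3"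
      "b \<noteq> v2" "b \<noteq> v3" "b \<noteq> ?w2" "b \<noteq> ?w3" "b' \<noteq> v2" "b' \<noteq> v3" "b' \<noteq> ?w2" "b' \<noteq> ?w3"
      using no o23 by metis+
    have sV: "s v2 \<in> V" "s v3 \<in> V" "s ?w2 \<in> V" "s ?w3 \<in> V" "v2 \<in> V" "v3 \<in> V" "?w2 \<in> V" "?w3 \<in> V"
      using snb(9) o23 N(2,3) v23 Hne inN HN N_V(1) by metis+
    have Ns: "v2 \<in> N (s v2)" "v3 \<in> N (s v3)" "?w2 \<in> N (s ?w2)" "?w3 \<in> N (s ?w3)"
      using snb(8) o23 N(2,3) v23 Hne by metis+
    have two4: "two v2" "two v3" "two ?w2" "two ?w3" using orb_v(1) o23 by blast+
    show ?thesis
    proof (cases "\<forall>f\<in>A. f v = v \<longrightarrow> f a = a \<longrightarrow> f a' = a' \<longrightarrow> f v2 = v2 \<longrightarrow> f ?w2 = ?w2")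
      case True
      let ?D = "{v, w, a, b, a', b', v2, v3, ?w2, ?w3, s v2}"
      let ?B = "{v, w, a, a', v2}"
      show ?thesis
      proof (rule coloring_blacks2[of ?D ?B])
        show "?D \<subseteq> V" using N_V6 sV by auto
        show "N y \<inter> ?D \<noteq> {}" if "y \<in> ?D" for y
          using that N6 inA Ns by auto
        show "b \<notin> ?B" "b' \<notin> ?B" using d dd by auto
        show "s y \<in> ?D - ?B" if y: "y \<in> ?B" "y \<in> orb v" "y \<noteq> v" "y \<noteq> w" for y
        proof -
          have "y = v2" using y no by blast
          then show ?thesis using snb[OF o23(1) N(2)[symmetric] v23(1)] by auto
        qed
        fix f assume f: "f \<in> A" and col: "\<And>x. x \<in> ?D \<Longrightarrow> f x \<in> ?D \<Longrightarrow> f x \<in> ?B \<longleftrightarrow> x \<in> ?B"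
        { fix y assume fv: "f v = v" "f w = w" "f a = a" "f b = b" "f a' = a'" "f b' = b'" and y: "y \<in> ?D"
          have "f v2 \<in> N a" "f v3 \<in> N a" using A_N[OF f, of _ a] fv(3) inN by auto
          moreover have "f v2 \<noteq> v" "f v3 \<noteq> v" "f v2 \<noteq> f v3" using A_inj[OF f] fv(1) N by metis+
          ultimately have "f v2 = v2 \<and> f v3 = v3 \<or> f v2 = v3 \<and> f v3 = v2" using N by auto
          then have f23: "f v2 = v2" "f v3 = v3" using col[of v2] N(3,4) v23 dd by auto
          then have fw2: "f ?w2 = ?w2" using True f fv by blast
          have "f ?w3 \<in> N a'" using A_N[OF f, of ?w3 a'] fv(5) N' by simp
          moreover have "f ?w3 \<noteq> w" "f ?w3 \<noteq> ?w2" using A_inj[OF f] fv(2) fw2 Hne by metis+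
          ultimately have "f ?w3 = ?w3" using N' by auto
          moreover have "f (s v2) = s v2" using s_A[OF f two4(1)] f23 by simp
          ultimately show "f y = y" using fv y f23 fw2 by auto }
        { assume fv: "f v = w" "f a = a'"
          have "f v2 \<in> N a'" using A_N[OF f, of v2 a] fv inN by simp
          moreover have "f v2 \<noteq> w" using A_inj[OF f, of v2 v] fv N by simp
          ultimately have "f v2 = ?w2 \<or> f v2 = ?w3" using N' by auto
          then show False using col[of v2] ne4 v23 Hne dd by auto }
      qed auto
    next
      case False
      then obtain n where n: "n \<in> A" "n v = v" "n a = a" "n a' = a'" "n v2 = v2" "n ?w2 \<noteq> ?w2"
        by blast
      have nw': "n w = w" using fix_v(1)[OF n(1,2)] .
      have "n ?w2 \<in> N a'" "n ?w3 \<in> N a'" using A_N[OF n(1), of _ a'] n(4) N' by auto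
      moreover have "n ?w2 \<noteq> w" "n ?w3 \<noteq> w" "n ?w2 \<noteq> n ?w3" using A_inj[OF n(1)] nw' Hne by metis+
      ultimately have nw23: "n ?w2 = ?w3" "n ?w3 = ?w2" using N' n(6) by auto
      have "n v3 \<in> N a" using A_N[OF n(1), of v3 a] n(3) inN by simp
      moreover have "n v3 \<noteq> v" "n v3 \<noteq> v2" using A_inj[OF n(1)] n(2,5) N by metis+
      ultimately have nv3: "n v3 = v3" using N by auto
      have ns: "n (s v2) = s v2" "n (s v3) = s v3"
        using s_A[OF n(1) two4(1)] s_A[OF n(1) two4(2)] n(5) nv3 by simp_all
      have notw: "s v2 \<noteq> ?w2" "s v2 \<noteq> ?w3" "s v3 \<noteq> ?w2" "s v3 \<noteq> ?w3" using ns nw23 n(6) Hne(3)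
        by metis+
      have Hs: "H (s v2) = s ?w2" "H (s v3) = s ?w3" using s_A[OF H(1) two4(1)] s_A[OF H(1) two4(2)]
        by simp_all
      \<comment> \<open>An automorphism that fixes \<open>a\<close> and takes \<open>v3\<close> to
        \<open>v\<close> would otherwise take \<open>v2\<close> to \<open>w\<close>, which is not
        adjacent to \<open>a\<close>.\<close>
      have s23: "s v3 \<noteq> v2"
      proof
        assume eq: "s v3 = v2"
        obtain \<kappa> where \<kappa>: "\<kappa> \<in> A" "\<kappa> a = a" "\<kappa> v3 = v" using transitiveD[OF ta inN(2) N6(3)]
          by metis
        have "s v = \<kappa> v2" using s_A[OF \<kappa>(1) two4(2)] \<kappa>(3) eq by simp
        then have "w \<in> N a" using A_N[OF \<kappa>(1), of v2 a] \<kappa>(2) inN sv by simp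
        then show False using nw by blast
      qed
      have sw32: "s ?w3 \<noteq> ?w2" using s23 Hs(2) A_inj[OF H(1), of "s v3" v2] by metis
      have sws: "s ?w2 \<noteq> v2" "s ?w2 \<noteq> v3" "s ?w3 \<noteq> v2" "s ?w3 \<noteq> v3"
        using notw orb_v(3) o23 by metis+
      have sinj: "s v2 \<noteq> s v3" "s v2 \<noteq> s ?w2" "s v2 \<noteq> s ?w3" "s v3 \<noteq> s ?w2" "s v3 \<noteq> s ?w3" "s ?w2 \<noteq> s ?w3"
        using sym o23 N(4) ne4 Hne(3) by metis+
      note S = snb[OF o23(1) N(2)[symmetric] v23(1)] snb[OF o23(2) N(3)[symmetric] v23(2)]
        snb[OF o23(3) v23(3) Hne(1)[symmetric]] snb[OF o23(4) v23(4) Hne(2)[symmetric]]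
      \<comment> \<open>Below \<open>a\<close> and below \<open>a'\<close> the choices are
        independent, so \<open>v2\<close> and \<open>H v2\<close> are both black. The reversal
        matching them takes the black vertex \<open>s v3\<close> to the white vertex
        \<open>s (H v3)\<close>.\<close>
      let ?D = "{v, w, a, b, a', b', v2, v3, ?w2, ?w3, s v2, s v3, s ?w2, s ?w3}"
      let ?B = "{v, w, a, a', v2, ?w2, s v3}"
      show ?thesis
      proof (rule coloring_blacks2[of ?D ?B])
        show "?D \<subseteq> V" using N_V6 sV by auto
        show "N y \<inter> ?D \<noteq> {}" if "y \<in> ?D" for y
          using that N6 inA Ns by auto
        show "b \<notin> ?B" "b' \<notin> ?B" using d dd S by auto
        show "s y \<in> ?D - ?B" if y: "y \<in> ?B" "y \<in> orb v" "y \<noteq> v" "y \<noteq> w" for y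
        proof -
          consider "y = v2" | "y = ?w2" | "y = s v3" using y no by blast
          then show ?thesis
          proof cases
            case 1 then show ?thesis using S notw sinj by auto
          next
            case 2 then show ?thesis using S sws sinj by auto
          next
            case 3
            then have "s y = v3" using orb_v(3)[OF o23(2)] by simp
            then show ?thesis using N(3,4) v23 ne4 dd S by auto
          qed
        qed
        fix f assume f: "f \<in> A" and col: "\<And>x. x \<in> ?D \<Longrightarrow> f x \<in> ?D \<Longrightarrow> f x \<in> ?B \<longleftrightarrow> x \<in> ?B"
        have nb: "v3 \<notin> ?B" "?w3 \<notin> ?B" "s ?w3 \<notin> ?B"
          using N(3,4) v23 ne4 dd S Hne notw sws sw32 sinj by auto
        { fix y assume fv: "f v = v" "f w = w" "f a = a" "f b = b" "f a' = a'" "f b' = b'" and y: "y \<in> ?D"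
          have "f v2 \<in> N a" "f v3 \<in> N a" using A_N[OF f, of _ a] fv(3) inN by auto
          moreover have "f v2 \<noteq> v" "f v3 \<noteq> v" "f v2 \<noteq> f v3" using A_inj[OF f] fv(1) N by metis+
          ultimately have "f v2 = v2 \<and> f v3 = v3 \<or> f v2 = v3 \<and> f v3 = v2" using N by auto
          then have f23: "f v2 = v2" "f v3 = v3" using col[of v2] nb by auto
          have "f ?w2 \<in> N a'" "f ?w3 \<in> N a'" using A_N[OF f, of _ a'] fv(5) N' by auto
          moreover have "f ?w2 \<noteq> w" "f ?w3 \<noteq> w" "f ?w2 \<noteq> f ?w3" using A_inj[OF f] fv(2) Hne
            by metis+
          ultimately have "f ?w2 = ?w2 \<and> f ?w3 = ?w3 \<or> f ?w2 = ?w3 \<and> f ?w3 = ?w2" using N' by auto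
          then have fw: "f ?w2 = ?w2" "f ?w3 = ?w3" using col[of ?w2] nb by auto
          have "f (s v2) = s v2" "f (s v3) = s v3" "f (s ?w2) = s ?w2" "f (s ?w3) = s ?w3"
            using s_A[OF f] two4 f23 fw by metis+
          then show "f y = y" using fv y f23 fw by auto }
        { assume fv: "f v = w" "f a = a'"
          have "f v2 \<in> N a'" "f v3 \<in> N a'" using A_N[OF f, of _ a] fv inN by auto
          moreover have "f v2 \<noteq> w" "f v3 \<noteq> w" "f v2 \<noteq> f v3" using A_inj[OF f] fv(1) N by metis+
          ultimately have "f v2 = ?w2 \<and> f v3 = ?w3 \<or> f v2 = ?w3 \<and> f v3 = ?w2" using N' by auto
          then have "f v3 = ?w3" using col[of v2] nb by auto
          then have "f (s v3) = s ?w3" using s_A[OF f two4(2)] by simp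
          then show False using col[of "s v3"] nb by auto }
      qed auto
    qed
  qed
qed

theorem semi_edge: "distinguishing_number G \<le> 2"
proof (cases "pinned a v")
  case True then show ?thesis by (rule pinned_case)
next
  case np: False
  show ?thesis
  proof (cases "\<forall>f\<in>A. f v = v \<longrightarrow> f a = a \<longrightarrow> f a' = a'")
    case True then show ?thesis using dependent_case[OF np] by blast
  next
    case False
    then obtain k where k: "k \<in> A" "k v = v" "k a = a" "k a' \<noteq> a'" by blast
    have aV: "a \<in> V" using N_V6 by blast
    show ?thesis
    proof (rule trichotomy[OF aV])
      assume "rigid a"
      then show ?thesis using rigidD N6(3) np by blast
    next
      assume "two a" then show ?thesis using two_case[OF np k] by blast
    next
      assume "transitive a" then show ?thesis using transitive_case[OF k] by blast
    qed
  qed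
qed

end

section \<open>Vertices with full local group\<close>

context connected_cubic_graph
begin

text \<open>The stabilizer of \<open>v\<close> fixes \<open>s v\<close> and moves one member of
  \<open>t v\<close> to the other, so \<open>t v\<close> and \<open>t (s v)\<close> are disjoint or
  equal. The disjoint case is the setting of \<open>semi_edge\<close>.\<close>

lemma semi_edge_dichotomy:
  assumes v: "two v" "two (s v)" "s (s v) = v" "s v \<in> orb v"
  obtains "distinguishing_number G \<le> 2" | "t v = t (s v)"
proof (cases "t v \<inter> t (s v) = {}")
  case False
  then obtain a where a: "a \<in> t v" "a \<in> t (s v)" by blast
  obtain b g where g: "t v = {a, b}" "a \<noteq> b" "g \<in> A" "g v = v" "g a = b"
    using t_cases'[OF v(1) a(1)] by metis
  have "g (s v) = s v" using s_A[OF g(3) v(1)] g(4) by simp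
  then have "b \<in> t (s v)" using t_A_iff[OF g(3) v(2), of a] a(2) g(5) by simp
  moreover obtain c where "t (s v) = {a, c}" using t_cases'[OF v(2) a(2)] by metis
  ultimately have "t v = t (s v)" using g(1,2) by auto
  then show thesis by (rule that(2))
next
  case True
  obtain h where h: "h \<in> A" "s v = h v" using v(4) by (rule orbE)
  have hw: "h (s v) = v" using s_A[OF h(1) v(1)] v(3) h(2) by simp
  obtain a b where ab: "t v = {a, b}" "a \<noteq> b" using t_cases[OF v(1)] by metis
  have t2: "t (s v) = {h a, h b}" using t_A[OF h(1) v(1)] h(2) ab(1) by simp
  have dj: "{a, b} \<inter> {h a, h b} = {}" using True unfolding ab(1) t2 .
  interpret semi_edge G v "s v" a b "h a" "h b" h
    by unfold_locales (rule refl v(1) h(1) h(2)[symmetric] hw ab t2 dj)+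
  show thesis using semi_edge by (rule that(1))
qed

text \<open>\<open>(avoid B)\<^sup>*\<close> relates the vertices that are connected in \<open>G - B\<close> (and every vertex to itself).\<close>

definition avoid :: "'a set \<Rightarrow> ('a \<times> 'a) set" where
  "avoid B = {(x, y). y \<in> N x \<and> x \<notin> B \<and> y \<notin> B}"

lemma avoid_exit:
  assumes "(x, y) \<in> (avoid B)\<^sup>*" "x \<in> D" "y \<notin> D"
  obtains p p' where "p \<in> D" "p' \<notin> D" "p' \<in> N p" "p \<notin> B" "p' \<notin> B"
proof -
  have "y \<in> D \<or> (\<exists>p p'. p \<in> D \<and> p' \<notin> D \<and> (p, p') \<in> avoid B)"
    using assms(1) by (induction rule: rtrancl_induct) (use assms(2) in blast)+
  then show thesis using that assms(3) unfolding avoid_def by blast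
qed

lemma avoid_sym: "(x, y) \<in> (avoid B)\<^sup>* \<Longrightarrow> (y, x) \<in> (avoid B)\<^sup>*"
proof -
  have "sym (avoid B)" unfolding avoid_def sym_def using N_sym by blast
  then show "(x, y) \<in> (avoid B)\<^sup>* \<Longrightarrow> (y, x) \<in> (avoid B)\<^sup>*" using sym_rtrancl symD by metis
qed

lemma avoid_A:
  assumes f: "f \<in> A" "f ` B = B" and p: "(x, y) \<in> (avoid B)\<^sup>*"
  shows "(f x, f y) \<in> (avoid B)\<^sup>*"
  using p
proof (induction rule: rtrancl_induct)
  case (step y z)
  have B: "f u \<in> B \<longleftrightarrow> u \<in> B" for u using f A_inj[OF f(1)] by (metis imageE imageI)
  have "(f y, f z) \<in> avoid B" using step(2) A_N[OF f(1)] B unfolding avoid_def by simp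
  then show ?case using step(3) by (meson rtrancl.rtrancl_into_rtrancl)
qed simp

lemma avoid_step: "(x, y) \<in> (avoid B)\<^sup>* \<Longrightarrow> y \<notin> B \<Longrightarrow> z \<in> N y \<Longrightarrow> z \<notin> B \<Longrightarrow> (x, z) \<in> (avoid B)\<^sup>*"
  by (rule rtrancl.rtrancl_into_rtrancl) (simp_all add: avoid_def)

end

text \<open>Here \<open>r\<close> has type 6: all permutations of its neighbors are induced by automorphisms.\<close>

locale six_root = connected_cubic_graph +
  fixes r
  assumes root: "transitive r" "\<not> regular r"
    and root_N: "\<And>x. x \<in> N r \<Longrightarrow> two x \<and> s x = r"
begin

lemma rV: "r \<in> V"
  using root(1) unfolding transitive_def by blast

lemma orb_N: "u \<in> orb r \<Longrightarrow> x \<in> N u \<Longrightarrow> two x \<and> s x = u"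
proof -
  assume u: "u \<in> orb r" "x \<in> N u"
  obtain f where f: "f \<in> A" "u = f r" using u(1) by (rule orbE)
  then obtain y where y: "y \<in> N r" "x = f y" using A_N_image[OF f(1), of r] u(2) by blast
  then show ?thesis using root_N[OF y(1)] two_A[OF f(1)] s_A[OF f(1)] f(2) by simp
qed

lemma orb_not_two: "u \<in> orb r \<Longrightarrow> \<not> two u"
  using two_not_transitive transitive_A root(1) by (metis orbE)

text \<open>Some element of the local group fixes a neighbor without being trivial. Conjugation
  moves its fixed point to \<open>x\<close>.\<close>

lemma swap_root:
  assumes "x \<in> N r" "y \<in> N r" "z \<in> N r" "x \<noteq> y" "x \<noteq> z" "y \<noteq> z"
  obtains f where "f \<in> A" "f r = r" "f x = x" "f y = z" "f z = y"
proof -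
  obtain g x0 y0 where g: "g \<in> A" "g r = r" "x0 \<in> N r" "g x0 = x0" "y0 \<in> N r" "g y0 \<noteq> y0"
    using root unfolding regular_def by blast
  obtain h where h: "h \<in> A" "h r = r" "h x0 = x" using transitiveD[OF root(1) g(3) assms(1)]
    by metis
  obtain k where k: "k \<in> A" "\<And>u. k (h u) = u" "\<And>u. h (k u) = u" using A_inv[OF h(1)] by metis
  define f where "f = h \<circ> g \<circ> k"
  have f: "f \<in> A" "f r = r" "f x = x"
    unfolding f_def using A_comp h g k k(2)[of r] k(2)[of x0] by simp_all
  have "f (h y0) \<noteq> h y0" unfolding f_def using k(2) g(6) A_inj[OF h(1)] by simp
  moreover have "h y0 \<in> N r" using A_N[OF h(1), of y0 r] h(2) g(5) by simp
  moreover have N: "N r = {x, y, z}" using N3_eq assms by blast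
  ultimately have "f y \<noteq> y \<or> f z \<noteq> z" using f(3) by auto
  moreover have "f y \<in> N r" "f z \<in> N r" using A_N[OF f(1), of _ r] f(2) assms by auto
  moreover have "f y \<noteq> x" "f z \<noteq> x" "f y \<noteq> f z" using f(3) A_inj[OF f(1)] assms by metis+
  ultimately have "f y = z" "f z = y" using N by auto
  then show thesis using that f by blast
qed

text \<open>Exchanging \<open>r\<close> with a twin fixes \<open>v\<close>, hence also
  \<open>s v\<close>, which is \<open>r\<close>.\<close>

lemma no_twin:
  assumes "p \<in> V" "p \<noteq> r" "v \<in> N r" "v \<noteq> p" "N r - {p} = N p - {r}"
  shows False
proof -
  have \<tau>: "Transposition.transpose r p \<in> A" using transpose_in_A[OF rV assms(1,5)] .
  have "v \<noteq> r" using assms(3) N_neq by blast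
  then have "Transposition.transpose r p v = v" using assms(4) by simp
  then have "Transposition.transpose r p (s v) = s v" using s_A[OF \<tau>, of v] root_N[OF assms(3)]
    by simp
  then show False using root_N[OF assms(3)] assms(2) by simp
qed

text \<open>The orbit of \<open>r\<close> is white except for \<open>r\<close>, and among the
  neighbors only \<open>v1\<close> is black. Since \<open>v2\<close> and \<open>v3\<close> are
  alike, growth cannot take them together at \<open>r\<close>, and the connection between the
  branches is the way to them from elsewhere.\<close>

lemma crossing:
  assumes v: "v1 \<in> N r" "v2 \<in> N r" "v1 \<noteq> v2" and cross: "(v1, v2) \<in> (avoid {r})\<^sup>*"
  shows "distinguishing_number G \<le> 2"
proof -
  obtain v3 where N: "N r = {v1, v2, v3}" "v1 \<noteq> v3" "v2 \<noteq> v3" using N3'[OF rV v] by metis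
  have vr: "v1 \<noteq> r" "v2 \<noteq> r" "v3 \<noteq> r" using N N_neq by blast+
  define Q where "Q = orb r \<union> N r"
  define F where "F = {f \<in> A. f r = r \<and> f v1 = v1}"
  let ?q = "\<lambda>x. x = r \<or> x = v1"
  obtain \<phi> where \<phi>: "\<phi> \<in> A" "\<phi> r = r" "\<phi> v2 = v2" "\<phi> v1 = v3" "\<phi> v3 = v1"
    using swap_root[of v2 v1 v3] N v(3) by auto
  have "\<exists>c. good_coloring F Q ?q {} c"
  proof (rule extend_coloring[where ?D0.0 = "{r, v1}"])
    show "{r, v1} \<subseteq> Q" unfolding Q_def using orb_refl v by blast
    show "Q \<subseteq> V" unfolding Q_def using orb_V[OF rV] N_V by blast
    show "N x \<inter> {r, v1} \<noteq> {}" if "x \<in> {r, v1}" for x using that v(1) N_sym by blast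
    fix D assume D: "{r, v1} \<subseteq> D" "D \<subseteq> V" "D \<noteq> V" "\<And>x. x \<in> D \<Longrightarrow> N x \<inter> D \<noteq> {}"
    let ?good = "\<lambda>p. N p - D \<noteq> {} \<and> (\<forall>u\<in>N p - D. \<forall>u'\<in>N p - D. u \<noteq> u' \<longrightarrow> u \<in> Q \<longrightarrow> u' \<in> Q \<longrightarrow>
        ?q u = ?q u' \<longrightarrow> (\<forall>f\<in>F. (\<forall>x\<in>D. f x = x) \<longrightarrow> f u = u))"
    show "\<exists>p\<in>D. ?good p"
    proof (rule ccontr)
      assume ng: "\<not> (\<exists>p\<in>D. ?good p)"
      \<comment> \<open>Missing members of the orbit of \<open>r\<close> cause no trouble, being
        \<open>s p\<close> for their neighbors \<open>p\<close>. So growth is stuck only if every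
        frontier vertex misses exactly \<open>v2\<close> and \<open>v3\<close>.\<close>
      have two_left: "N p - D = {v2, v3}" if p: "p \<in> D" "N p - D \<noteq> {}" for p
      proof -
        have "\<not> ?good p" using ng p(1) by blast
        then obtain u u' f where u: "u \<in> N p - D" "u' \<in> N p - D" "u \<noteq> u'" "u \<in> Q" "u' \<in> Q"
          and f: "f \<in> F" "\<forall>x\<in>D. f x = x" "f u \<noteq> u" using p(2) by blast
        obtain e where e: "e \<in> N p" "e \<in> D" using D(4)[OF p(1)] by blast
        have Np: "N p = {e, u, u'}" using N3_eq[of e p u u'] e u by blast
        have fp: "f \<in> A" "f p = p" "f e = e" using f p(1) e unfolding F_def by blast+
        have nu: "u \<notin> orb r"
        proof
          assume "u \<in> orb r"
          then have "two p" "s p = u" using orb_N[of u p] u(1) N_sym by blast+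
          then show False using s_A[OF fp(1), of p] fp(2) f(3) by simp
        qed
        have nu': "u' \<notin> orb r"
        proof
          assume "u' \<in> orb r"
          then have *: "two p" "s p = u'" using orb_N[of u' p] u(2) N_sym by blast+
          then have "e \<in> t p" using e u(2) t_iff by blast
          then show False using two_stab[OF *(1) fp(1,2) _ fp(3), of u] u(1) f(3) by blast
        qed
        have "{u, u'} \<subseteq> {v2, v3}" using u nu nu' N(1) D(1) unfolding Q_def by blast
        then have "{u, u'} = {v2, v3}" using u(3) by auto
        then show ?thesis using Np e u by auto
      qed
      have out: "v2 \<notin> D \<and> v3 \<notin> D"
      proof (rule ccontr)
        assume "\<not> (v2 \<notin> D \<and> v3 \<notin> D)"
        then have "N p \<subseteq> D" if "p \<in> D" for p using two_left[OF that] by blast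
        then have "D = V" using closed_eq_V[of D] D(1,2) by blast
        then show False using D(3) by blast
      qed
      have "v1 \<in> D" "v2 \<notin> D" using D(1) out by blast+
      then obtain p p' where p: "p \<in> D" "p' \<notin> D" "p' \<in> N p" "p \<noteq> r"
        using avoid_exit[OF cross, of D] by (metis singletonI)
      then have Np: "N p - D = {v2, v3}" using two_left by blast
      have "\<phi> p \<noteq> r" using \<phi>(2) p(4) A_inj[OF \<phi>(1), of p r] by simp
      \<comment> \<open>The image under \<open>\<phi>\<close> sees \<open>v1\<close> and
        \<open>v2\<close>. If it is in \<open>D\<close>, it must see \<open>v3\<close> as well and
        is a twin of \<open>r\<close>; if not, it is missing at \<open>v1\<close>, and then
        \<open>v2\<close> is a twin of \<open>r\<close>.\<close>
      have adj: "v2 \<in> N (\<phi> p)" "v1 \<in> N (\<phi> p)"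
        using A_N[OF \<phi>(1), of v2 p] A_N[OF \<phi>(1), of v3 p] Np \<phi> by auto
      show False
      proof (cases "\<phi> p \<in> D")
        case True
        then have "N (\<phi> p) - D = {v2, v3}" using two_left adj out by blast
        then have "v3 \<in> N (\<phi> p)" by blast
        then have "N (\<phi> p) = N r" using N3_eq[of v1 "\<phi> p" v2 v3] adj N v(3) by simp
        moreover have "v1 \<noteq> \<phi> p" using adj N_neq by blast
        ultimately show False using no_twin[of "\<phi> p" v1] N_V(2)[OF adj(1)] \<open>\<phi> p \<noteq> r\<close> v(1) N_irrefl
          by auto
      next
        case False
        have "v1 \<in> D" using D(1) by blast
        moreover have "\<phi> p \<in> N v1" using adj N_sym by blast
        ultimately have "N v1 - D = {v2, v3}" using two_left False by blast
        then have 1: "v2 \<in> N v1" "v3 \<in> N v1" by blast+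
        then have "v3 \<in> N v2" using A_N[OF \<phi>(1), of v1 v2] \<phi> N_sym by simp
        moreover have "r \<in> N v2" using v(2) N_sym by blast
        moreover have "v1 \<in> N v2" using 1 N_sym by blast
        ultimately have "N v2 = {r, v1, v3}" using N3_eq[of r v2 v1 v3] vr N by simp
        then have "N r - {v2} = N v2 - {r}" using N vr v(3) by auto
        then show False using no_twin[of v2 v1] N_V(1)[OF v(2)] vr v by blast
      qed
    qed
  qed (auto simp: F_def)
  then obtain c where c: "good_coloring F Q ?q {} c" by blast
  note cQ = good_coloringD(1)[OF c] and cF = good_coloringD(3)[OF c]
  have nv: "v1 \<notin> orb r" "v2 \<notin> orb r" "v3 \<notin> orb r" using orb_not_two root_N N by blast+
  show ?thesis
  proof (rule distinguishing_number_le_2I[of c])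
    fix f assume f: "f \<in> A" "\<And>x. x \<in> V \<Longrightarrow> c (f x) = c x"
    have fo: "f r \<in> orb r" using orbI[OF f(1)] .
    have "c (f r)" using f(2)[OF rV] cQ[of r] orb_refl unfolding Q_def by blast
    then have fr: "f r = r" using cQ[of "f r"] fo nv unfolding Q_def by blast
    have "c v1" "\<not> c v2" "\<not> c v3" using cQ[of v1] cQ[of v2] cQ[of v3] N v(3) vr unfolding Q_def
      by auto
    moreover have "c (f v1) = c v1" using f(2) N_V(1)[OF v(1)] by blast
    moreover have "f v1 \<in> N r" using A_N[OF f(1), of v1 r] fr v(1) by simp
    ultimately have "f v1 = v1" using N by auto
    then have "f \<in> F" unfolding F_def using f(1) fr by blast
    then show "\<forall>x\<in>V. f x = x" using cF f(2) by blast
  qed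
qed

text \<open>The vertex \<open>r'\<close> marks the branch of \<open>v2\<close>: once
  \<open>r\<close> and \<open>r'\<close> are fixed, so is \<open>v2\<close>, and \<open>v1\<close>
  and \<open>v3\<close> differ in color. The color of \<open>v2\<close> remains for preventing that
  \<open>r\<close> is moved to \<open>r'\<close>.\<close>

lemma second_root:
  assumes nc: "\<And>u v. u \<in> N r \<Longrightarrow> v \<in> N r \<Longrightarrow> (u, v) \<in> (avoid {r})\<^sup>* \<Longrightarrow> u = v"
    and r': "r' \<in> orb r" "r' \<noteq> r"
  shows "distinguishing_number G \<le> 2"
proof -
  have r'V: "r' \<in> V" using r'(1) orb_V[OF rV] by blast
  obtain v2 where v2: "v2 \<in> N r" "(v2, r') \<in> (avoid {r})\<^sup>*"
  proof -
    define D where "D = insert r {x. \<exists>v\<in>N r. (v, x) \<in> (avoid {r})\<^sup>*}"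
    have "D \<subseteq> V"
    proof
      fix x assume "x \<in> D"
      then consider "x = r" | v where "v \<in> N r" "(v, x) \<in> (avoid {r})\<^sup>*" unfolding D_def by blast
      then show "x \<in> V"
      proof cases
        case 2
        then show ?thesis using avoid_exit[OF 2(2), of V] N_V(1) by metis
      qed (use rV in simp)
    qed
    moreover have "N p \<subseteq> D" if "p \<in> D" for p
    proof
      fix x assume x: "x \<in> N p"
      show "x \<in> D"
      proof (cases "p = r \<or> x = r")
        case True
        then show ?thesis using x unfolding D_def by blast
      next
        case False
        then obtain v where "v \<in> N r" "(v, p) \<in> (avoid {r})\<^sup>*" using \<open>p \<in> D\<close> unfolding D_def
          by blast
        then show ?thesis using avoid_step[of v p "{r}" x] False x unfolding D_def by blast
      qed
    qed
    ultimately have "D = V" using closed_eq_V[of D] unfolding D_def by blast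
    then show thesis using that r'V r'(2) unfolding D_def by blast
  qed
  obtain v1 v3 where N: "N r = {v2, v1, v3}" "v2 \<noteq> v1" "v2 \<noteq> v3" "v1 \<noteq> v3" using N3[OF rV v2(1)]
    by metis
  have vr: "v1 \<noteq> r" "v2 \<noteq> r" "v3 \<noteq> r" using N N_neq by blast+
  have NrV: "N r \<subseteq> V" using N_V by blast
  define Q where "Q = orb r \<union> N r"
  define F where "F = {f \<in> A. f r = r \<and> (\<forall>x\<in>N r. f x = x)}"
  let ?q = "\<lambda>x. x = r \<or> x = r' \<or> x = v1"
  have "\<exists>c. good_coloring F Q ?q {} c"
  proof (rule extend_coloring[where ?D0.0 = "insert r (N r)"])
    show "insert r (N r) \<subseteq> Q" unfolding Q_def using orb_refl by blast
    show "Q \<subseteq> V" unfolding Q_def using orb_V[OF rV] NrV by blast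
    show "N x \<inter> insert r (N r) \<noteq> {}" if "x \<in> insert r (N r)" for x using that v2 N_sym by blast
    fix D assume D: "insert r (N r) \<subseteq> D" "D \<subseteq> V" "D \<noteq> V" "\<And>x. x \<in> D \<Longrightarrow> N x \<inter> D \<noteq> {}"
    have "D \<noteq> {}" using D(1) by blast
    then obtain p where p: "p \<in> D" "N p - D \<noteq> {}" using frontier D(2,3) by blast
    have "f u = u" if u: "u \<in> N p - D" "u \<in> Q" "f \<in> F" "\<forall>x\<in>D. f x = x" for u f
    proof -
      have "u \<in> orb r" using u D(1) unfolding Q_def by blast
      then have "two p" "s p = u" using orb_N[of u p] u(1) N_sym by blast+
      then show ?thesis using s_A[of f p] u p unfolding F_def by simp
    qed
    then show "\<exists>p\<in>D. N p - D \<noteq> {} \<and> (\<forall>u\<in>N p - D. \<forall>u'\<in>N p - D. u \<noteq> u' \<longrightarrow> u \<in> Q \<longrightarrow> u' \<in> Q \<longrightarrow>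
        ?q u = ?q u' \<longrightarrow> (\<forall>f\<in>F. (\<forall>x\<in>D. f x = x) \<longrightarrow> f u = u))"
      using p by blast
  qed (auto simp: F_def)
  then obtain c where c: "good_coloring F Q ?q {} c" by blast
  note cQ = good_coloringD(1)[OF c] and cF = good_coloringD(3)[OF c]
  have nv: "v1 \<notin> orb r" "v2 \<notin> orb r" "v3 \<notin> orb r" using orb_not_two root_N N by blast+
  have v2r': "v2 \<notin> N r'" using orb_N[OF r'(1), of v2] root_N[OF v2(1)] r'(2) by auto
  define k where "k c x = card {y \<in> N x. c y}" for c :: "'a \<Rightarrow> bool" and x
  have cv2: "\<not> c v2" using cQ[of v2] N vr nv r' orb_A unfolding Q_def by auto
  \<comment> \<open>Recoloring \<open>v2\<close> changes the number of black neighbors of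
    \<open>r\<close> but not that of \<open>r'\<close>, so one of the two colors makes these numbers
    different.\<close>
  obtain c' where c': "\<And>x. x \<noteq> v2 \<Longrightarrow> c' x = c x" "k c' r \<noteq> k c' r'"
  proof (cases "k c r = k c r'")
    case True
    let ?c = "\<lambda>x. x = v2 \<or> c x"
    have "{y \<in> N r'. ?c y} = {y \<in> N r'. c y}" using v2r' by blast
    moreover have "{y \<in> N r. ?c y} = insert v2 {y \<in> N r. c y}" using v2 by blast
    then have "k ?c r = Suc (k c r)" unfolding k_def using cv2 finite_N[of r] by simp
    ultimately have "k ?c r \<noteq> k ?c r'" using True unfolding k_def by simp
    then show thesis using that[of ?c] by blast
  next
    case False
    then show thesis using that[of c] by blast
  qed
  show ?thesis
  proof (rule distinguishing_number_le_2I[of c'])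
    fix f assume f: "f \<in> A" "\<And>x. x \<in> V \<Longrightarrow> c' (f x) = c' x"
    have bl: "f x = r \<or> f x = r'" if x: "x = r \<or> x = r'" for x
    proof -
      have fo: "f x \<in> orb r" "x \<in> orb r" "x \<in> V" using orb_A[OF f(1)] x orb_refl r' rV r'V by auto
      have "c' x" using cQ[of x] c'(1)[of x] x fo nv unfolding Q_def by auto
      then have "c' (f x)" using f(2) fo(3) by simp
      then have "c (f x)" using c'(1)[of "f x"] fo(1) nv by auto
      then show ?thesis using cQ[of "f x"] fo(1) nv unfolding Q_def by auto
    qed
    have fr: "f r = r"
    proof (rule ccontr)
      assume "f r \<noteq> r"
      then have "f r = r'" using bl by blast
      have "{y \<in> N r'. c' y} = f ` {y \<in> N r. c' y}"
        using A_N_image[OF f(1), of r] \<open>f r = r'\<close> f(2) NrV by auto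
      then have "k c' r' = k c' r" unfolding k_def using card_image[of f] A_inj[OF f(1)]
        by (simp add: inj_on_def)
      then show False using c'(2) by simp
    qed
    have "f r' \<noteq> r" using fr r'(2) A_inj[OF f(1), of r' r] by simp
    then have fr': "f r' = r'" using bl by blast
    have fN: "f x \<in> N r" if "x \<in> N r" for x using A_N[OF f(1), of x r] fr that by simp
    have "(f v2, r') \<in> (avoid {r})\<^sup>*" using avoid_A[OF f(1) _ v2(2)] fr fr' by simp
    then have "(f v2, v2) \<in> (avoid {r})\<^sup>*" using avoid_sym[OF v2(2)] by (meson rtrancl_trans)
    then have fv2: "f v2 = v2" using nc fN v2(1) by blast
    have "c' v1" "\<not> c' v3" using cQ[of v1] cQ[of v3] c'(1)[of v1] c'(1)[of v3] N vr nv r'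
      unfolding Q_def by auto
    moreover have "c' (f v1) = c' v1" using f(2) NrV N by blast
    moreover have "f v1 \<in> N r" "f v3 \<in> N r" using fN N by auto
    moreover have "f v1 \<noteq> v2" "f v3 \<noteq> v2" "f v1 \<noteq> f v3" using fv2 A_inj[OF f(1)] N by metis+
    ultimately have "f v1 = v1" "f v3 = v3" using N(1) by auto
    then have "f \<in> F" unfolding F_def using f(1) fr fv2 N(1) by simp
    \<comment> \<open>The extension property belongs to \<open>c\<close>. It transfers because
      \<open>c'\<close> differs from \<open>c\<close> only at \<open>v2\<close>, which is fixed by
      now.\<close>
    moreover have "c (f x) = c x" if "x \<in> V" for x
    proof (cases "x = v2")
      case False
      then have "f x \<noteq> v2" using fv2 A_inj[OF f(1)] by metis
      then show ?thesis using c'(1) False f(2)[OF that] by simp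
    qed (use fv2 in simp)
    ultimately show "\<forall>x\<in>V. f x = x" using cF by blast
  qed
qed

end

section \<open>Levels below a fixed vertex\<close>

locale fixed_root = six_root +
  assumes orb_root: "orb r = {r}"
    and separated: "\<And>u v. u \<in> N r \<Longrightarrow> v \<in> N r \<Longrightarrow> (u, v) \<in> (avoid {r})\<^sup>* \<Longrightarrow> u = v"
begin

lemma fr: "f \<in> A \<Longrightarrow> f r = r"
proof -
  assume "f \<in> A"
  then have "f r \<in> orb r" by (rule orbI)
  then show ?thesis unfolding orb_root by simp
qed

text \<open>Level \<open>n\<close> is not a sphere around \<open>r\<close>: it collects the vertices
  whose walk along \<open>s\<close> arrives at \<open>r\<close> after \<open>n\<close>
  steps.\<close>

primrec L :: "nat \<Rightarrow> 'a set" where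
  "L 0 = {r}"
| "L (Suc n) = {x. two x \<and> s x \<in> L n}"

lemma not_two_r: "\<not> two r"
  using orb_not_two[OF orb_refl] .

lemma L1: "L (Suc 0) = N r"
proof
  show "N r \<subseteq> L (Suc 0)" using root_N by auto
  show "L (Suc 0) \<subseteq> N r" using s_N N_sym by fastforce
qed

lemma L_unique: "x \<in> L m \<Longrightarrow> x \<in> L n \<Longrightarrow> m = n"
proof (induction m arbitrary: n x)
  case 0
  then show ?case using not_two_r by (cases n) auto
next
  case (Suc m)
  then obtain k where "n = Suc k" using not_two_r by (cases n) auto
  then show ?case using Suc by auto
qed

lemma L_two: "x \<in> L (Suc n) \<Longrightarrow> two x"
  by simp

lemma L_V: "x \<in> L n \<Longrightarrow> x \<in> V"
proof (cases n)
  case (Suc m)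
  assume "x \<in> L n"
  then show ?thesis using Suc two_V[of x] by simp
qed (use rV in simp)

lemma L_A: "f \<in> A \<Longrightarrow> f x \<in> L n \<longleftrightarrow> x \<in> L n"
proof (induction n arbitrary: x)
  case 0
  then show ?case using fr[OF 0] A_inj[OF 0, of x r] by auto
next
  case (Suc n)
  then show ?case using two_A[OF Suc(2)] s_A[OF Suc(2)] by auto
qed

lemma s_L: "x \<in> L (Suc n) \<Longrightarrow> s x \<in> L n"
  by simp

lemma L_t: "x \<in> L (Suc (Suc n)) \<Longrightarrow> x \<in> t (s x)"
proof -
  assume x: "x \<in> L (Suc (Suc n))"
  have "x \<in> N (s x)" using s_N[of x] x N_sym by auto
  moreover have "x \<noteq> s (s x)" using L_unique[OF x, of n] x by auto
  ultimately show ?thesis using t_iff by blast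
qed

lemma L_transitive:
  assumes "x \<in> L n" "y \<in> L n"
  obtains f where "f \<in> A" "f x = y"
proof -
  have "\<exists>f\<in>A. f x = y" using assms
  proof (induction n arbitrary: x y)
    case 0
    then show ?case using A_id by (metis L.simps(1) id_apply singletonD)
  next
    case (Suc n)
    have "s x \<in> L n" "s y \<in> L n" using Suc(2,3) by auto
    then obtain f where f: "f \<in> A" "f (s x) = s y" using Suc(1) by blast
    have "f x \<in> L (Suc n)" using L_A[OF f(1), of x "Suc n"] Suc(2) by blast
    moreover have "s (f x) = s y" using s_A[OF f(1) L_two[OF Suc(2)]] f(2) by simp
    ultimately have fx: "f x \<in> L (Suc n)" "s (f x) = s y" by blast+
    show ?case
    proof (cases n)
      case 0
      then have "f x \<in> N r" "y \<in> N r" using fx(1) Suc(3) L1 by auto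
      then obtain g where g: "g \<in> A" "g (f x) = y" using transitiveD[OF root(1)] by metis
      then show ?thesis using A_comp[OF g(1) f(1)] by (metis comp_apply)
    next
      case n: (Suc m)
      have "f x \<in> t (s y)" "y \<in> t (s y)" using L_t[of "f x" m] L_t[of y m] fx Suc(3) n by auto
      moreover have "two (s y)" using Suc(3) n by auto
      ultimately obtain b g where "t (s y) = {f x, b}" "g \<in> A" "g (f x) = b" "y \<in> {f x, b}"
        using t_cases'[of "s y" "f x"] by metis
      then show ?thesis using f(1) A_comp[of g f] by (metis comp_apply insertE singletonD)
    qed
  qed
  then show thesis using that by blast
qed

text \<open>Some vertex of the level has a child in the next one. Since automorphisms are transitive
  on a level and flip the two lower neighbors, all vertices have two such children.\<close>

lemma t_L:
  assumes "L (Suc (Suc n)) \<noteq> {}" "y \<in> L (Suc n)"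
  shows "t y \<subseteq> L (Suc (Suc n))"
proof -
  obtain z where z: "z \<in> L (Suc (Suc n))" using assms(1) by blast
  then obtain f where f: "f \<in> A" "f (s z) = y" using L_transitive[of "s z" "Suc n" y] assms(2)
    by auto
  have fz: "f z \<in> L (Suc (Suc n))" using L_A[OF f(1)] z by blast
  have "f z \<in> t y" using L_t[OF fz] s_A[OF f(1) L_two[OF z]] f(2) by simp
  then obtain b g where g: "t y = {f z, b}" "g \<in> A" "g (f z) = b"
    using t_cases'[OF L_two[OF assms(2)]] by metis
  then have "b \<in> L (Suc (Suc n))" using L_A[OF g(2)] fz by blast
  then show ?thesis unfolding g(1) using fz by blast
qed

lemma L_down: "L n \<noteq> {} \<Longrightarrow> m \<le> n \<Longrightarrow> L m \<noteq> {}"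
proof (induction n)
  case (Suc n)
  then have "L n \<noteq> {}" by auto
  then show ?case using Suc by (cases "m = Suc n") simp_all
qed simp

lemma infinite_levels:
  assumes "\<And>n. L n \<noteq> {}"
  shows "distinguishing_number G \<le> 2"
proof -
  obtain x where x: "x \<in> L (Suc 0)" using assms by blast
  show ?thesis
  proof (rule infinite_binary_tree[of x "\<Union>n. L (Suc n)"])
    show "a \<in> (\<Union>n. L (Suc n)) \<and> s a = y" if y: "y \<in> (\<Union>n. L (Suc n))" and a: "a \<in> t y" for y a
    proof -
      obtain n where n: "y \<in> L (Suc n)" using y by blast
      then have "a \<in> L (Suc (Suc n))" using t_L assms a by blast
      moreover have "s a = y"
      proof -
        have "s a \<in> L (Suc n)" "two a" using calculation by auto
        moreover have "y \<in> N a" using a t_iff N_sym by blast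
        moreover have "y \<notin> t a"
        proof
          assume "y \<in> t a"
          then have "y \<in> L (Suc (Suc (Suc n)))" using t_L assms \<open>a \<in> L (Suc (Suc n))\<close> by blast
          then show False using L_unique[OF n] by fastforce
        qed
        ultimately show ?thesis using t_iff by metis
      qed
      ultimately show ?thesis by blast
    qed
    show "f y \<in> (\<Union>n. L (Suc n))" if "f \<in> A" "y \<in> (\<Union>n. L (Suc n))" for f y
      using that L_A[OF that(1)] by blast
    show "x \<in> (\<Union>n. L (Suc n))" using x by blast
  qed auto
qed

text \<open>The vertex \<open>(s ^^ j) x\<close> names the branch at \<open>r\<close> that contains
  \<open>x\<close>.\<close>

lemma top_N: "x \<in> L (Suc j) \<Longrightarrow> (s ^^ j) x \<in> N r"
proof (induction j arbitrary: x)
  case 0 then show ?case by (simp add: L1 del: L.simps)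
next
  case (Suc j)
  have "(s ^^ j) (s x) \<in> N r" using Suc(1)[of "s x"] Suc(2) by simp
  then show ?case by (simp add: funpow_Suc_right del: funpow.simps(2))
qed

lemma top_A: "f \<in> A \<Longrightarrow> x \<in> L (Suc j) \<Longrightarrow> (s ^^ j) (f x) = f ((s ^^ j) x)"
proof (induction j arbitrary: x)
  case (Suc j)
  have "(s ^^ j) (f (s x)) = f ((s ^^ j) (s x))" using Suc(1)[OF Suc(2), of "s x"] Suc(3) by simp
  moreover have "s (f x) = f (s x)" using s_A[OF Suc(2)] Suc(3) by simp
  ultimately show ?case by (simp add: funpow_Suc_right del: funpow.simps(2))
qed simp

lemma top_avoid: "x \<in> L (Suc j) \<Longrightarrow> ((s ^^ j) x, x) \<in> (avoid {r})\<^sup>*"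
proof (induction j arbitrary: x)
  case (Suc j)
  have sx: "s x \<in> L (Suc j)" and x2: "two x" using Suc(2) by auto
  have "((s ^^ j) (s x), s x) \<in> (avoid {r})\<^sup>*" using Suc(1)[OF sx] .
  moreover have "x \<in> N (s x)" using s_N[OF x2] N_sym by blast
  moreover have "x \<noteq> r" "s x \<noteq> r" using x2 sx not_two_r by auto
  ultimately show ?case using avoid_step[of "(s ^^ j) (s x)" "s x" "{r}" x]
    by (simp add: funpow_Suc_right del: funpow.simps(2))
qed simp

lemma reach_L:
  assumes "\<And>i. i < m \<Longrightarrow> L i \<inter> B = {}" "r \<notin> B" "x \<in> L j" "j \<le> m" "x \<notin> B"
  shows "(r, x) \<in> (avoid B)\<^sup>*"
  using assms(3-5)
proof (induction j arbitrary: x)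
  case 0 then show ?case by simp
next
  case (Suc j)
  have sx: "s x \<in> L j" and x2: "two x" using Suc(2) by auto
  then have "s x \<notin> B" using assms(1)[of j] Suc(3) by auto
  then have "(r, s x) \<in> (avoid B)\<^sup>*" using Suc sx by simp
  moreover have "x \<in> N (s x)" using s_N[OF x2] N_sym by blast
  ultimately show ?case using avoid_step \<open>s x \<notin> B\<close> Suc(4) by blast
qed

lemma N_root_cases:
  assumes "v2 \<in> N r"
  obtains v1 v3 where "N r = {v2, v1, v3}" "v2 \<noteq> v1" "v2 \<noteq> v3" "v1 \<noteq> v3" "v1 \<noteq> r" "v2 \<noteq> r" "v3 \<noteq> r"
proof -
  obtain v1 v3 where N: "N r = {v2, v1, v3}" "v2 \<noteq> v1" "v2 \<noteq> v3" "v1 \<noteq> v3" using N3[OF rV assms]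
    by metis
  moreover have "v1 \<in> N r" "v3 \<in> N r" using N(1) by simp_all
  ultimately show thesis using that[of v1 v3] N_neq assms by metis
qed

text \<open>The pair \<open>y, y'\<close> is white while the other pairs have both colors, so it is
  preserved and with it the branch \<open>v2\<close>; black \<open>v1\<close> and white
  \<open>v3\<close> settle the rest. Giving \<open>y\<close> and \<open>y'\<close> the same color
  must not block the growth. A blocked set would have \<open>y\<close> and \<open>y'\<close> as its
  only exits, so it contains \<open>p\<close>, and \<open>p\<close> offers the exit \<open>y\<close>
  alone.\<close>

lemma mono_pair:
  assumes PPV: "\<And>x y. {x, y} \<in> PP \<Longrightarrow> x \<in> V \<and> x \<noteq> r \<and> x \<notin> N r \<and> x \<noteq> y"
    and disj: "\<And>x y z. {x, y} \<in> PP \<Longrightarrow> {x, z} \<in> PP \<Longrightarrow> y = z"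
    and inv: "\<And>f x y. f \<in> A \<Longrightarrow> {x, y} \<in> PP \<Longrightarrow> {f x, f y} \<in> PP"
    and y: "{y, y'} \<in> PP"
    and p: "(r, p) \<in> (avoid {y, y'})\<^sup>*" "y \<in> N p" "y' \<notin> N p"
    and v2: "v2 \<in> N r" "\<And>f. f \<in> A \<Longrightarrow> {f y, f y'} = {y, y'} \<Longrightarrow> f v2 = v2"
  shows "distinguishing_number G \<le> 2"
proof -
  obtain v1 v3
    where N: "N r = {v2, v1, v3}" "v2 \<noteq> v1" "v2 \<noteq> v3" "v1 \<noteq> v3" "v1 \<noteq> r" "v2 \<noteq> r" "v3 \<noteq> r"
    using N_root_cases[OF v2(1)] by metis
  have NrV: "N r \<subseteq> V" using N_V by blast
  have y'y: "{y', y} \<in> PP" using y by (simp add: insert_commute)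
  have yV: "y \<in> V" "y' \<in> V" "y \<noteq> y'" "y \<noteq> r" "y' \<noteq> r" "y \<notin> N r" "y' \<notin> N r"
    using PPV[OF y] PPV[OF y'y] by auto
  define D0 where "D0 = insert r (N r)"
  define Q where "Q = D0 \<union> {y, y'}"
  define F where "F = {f \<in> A. \<forall>x\<in>N r. f x = x}"
  let ?q = "\<lambda>x. x = v1"
  have "\<exists>c. good_coloring F Q ?q PP c"
  proof (rule extend_coloring[where ?D0.0 = D0])
    show "F \<subseteq> A" unfolding F_def by blast
    show "D0 \<subseteq> Q" unfolding Q_def by blast
    show "Q \<subseteq> V" unfolding Q_def D0_def using rV NrV yV by blast
    show "D0 \<noteq> {}" unfolding D0_def by blast
    show "f x = x" if "f \<in> F" "x \<in> D0" for f x using that fr unfolding F_def D0_def by blast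
    show "N x \<inter> D0 \<noteq> {}" if "x \<in> D0" for x using that v2(1) N_sym unfolding D0_def by blast
    show "x \<in> V" if "{x, z} \<in> PP" for x z using PPV[OF that] by blast
    show "u = z" if "{x, u} \<in> PP" "{x, z} \<in> PP" for x u z using disj[OF that] .
    show "{f x, f z} \<in> PP" if "f \<in> F" "{x, z} \<in> PP" for f x z using inv that unfolding F_def
      by blast
    fix D assume D: "D0 \<subseteq> D" "D \<subseteq> V" "D \<noteq> V" "\<And>x. x \<in> D \<Longrightarrow> N x \<inter> D \<noteq> {}"
    show "\<exists>p\<in>D. N p - D \<noteq> {} \<and> (\<forall>u\<in>N p - D. \<forall>u'\<in>N p - D. u \<noteq> u' \<longrightarrow> u \<in> Q \<longrightarrow> u' \<in> Q \<longrightarrow>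
        ?q u = ?q u' \<longrightarrow> (\<forall>f\<in>F. (\<forall>x\<in>D. f x = x) \<longrightarrow> f u = u))"
    proof (rule ccontr)
      assume ng: "\<not> ?thesis"
      have left: "N x - D = {y, y'}" if x: "x \<in> D" "N x - D \<noteq> {}" for x
      proof -
        obtain u u' where u: "u \<in> N x - D" "u' \<in> N x - D" "u \<noteq> u'" "u \<in> Q" "u' \<in> Q" using ng x
          by blast
        obtain e where e: "e \<in> N x" "e \<in> D" using D(4)[OF x(1)] by blast
        have "N x = {e, u, u'}" using N3_eq[of e x u u'] e u by blast
        moreover have "u \<in> {y, y'}" "u' \<in> {y, y'}" using u D(1) unfolding Q_def by blast+
        ultimately show ?thesis using e u by auto
      qed
      have "y \<notin> D \<and> y' \<notin> D"
      proof (rule ccontr)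
        assume "\<not> (y \<notin> D \<and> y' \<notin> D)"
        then have "N x \<subseteq> D" if "x \<in> D" for x using left[OF that] by blast
        then have "D = V" using closed_eq_V[of D] D(1,2) unfolding D0_def by blast
        then show False using D(3) by blast
      qed
      then have yD: "y \<notin> D" "y' \<notin> D" by blast+
      have "p \<in> D"
      proof (rule ccontr)
        assume "p \<notin> D"
        moreover have "r \<in> D" using D(1) unfolding D0_def by blast
        ultimately obtain x x' where x: "x \<in> D" "x' \<notin> D" "x' \<in> N x" "x' \<notin> {y, y'}"
          using avoid_exit[OF p(1), of D] by metis
        then show False using left[of x] by blast
      qed
      then show False using left[of p] p(2,3) yD by blast
    qed
  qed
  then obtain c where c: "good_coloring F Q ?q PP c" by blast
  note cQ = good_coloringD(1)[OF c] and cP = good_coloringD(2)[OF c] and cF = good_coloringD(3)[OF c]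
  show ?thesis
  proof (rule distinguishing_number_le_2I[of c])
    fix f assume f: "f \<in> A" "\<And>x. x \<in> V \<Longrightarrow> c (f x) = c x"
    have fy: "{f y, f y'} \<in> PP" using inv[OF f(1) y] .
    have fy': "{f y', f y} \<in> PP" using fy by (simp add: insert_commute)
    have "c y = False" "c y' = False" using cQ[of y] cQ[of y'] yV N unfolding Q_def by auto
    then have "c (f y) = c (f y')" using f(2) yV by simp
    then have "f y \<in> Q \<or> f y' \<in> Q" using cP[OF fy] A_inj[OF f(1), of y y'] yV(3) by blast
    then have "f y \<in> {y, y'} \<or> f y' \<in> {y, y'}" using PPV[OF fy] PPV[OF fy'] unfolding Q_def D0_def
      by blast
    then consider "f y = y" | "f y = y'" | "f y' = y" | "f y' = y'" by blast
    then have "{f y, f y'} = {y, y'}"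
    proof cases
      case 1 then show ?thesis using disj[of y "f y'" y'] fy y by simp
    next
      case 2 then show ?thesis using disj[of y' "f y'" y] fy y'y by auto
    next
      case 3 then show ?thesis using disj[of y "f y" y'] fy' y by auto
    next
      case 4 then show ?thesis using disj[of y' "f y" y] fy' y'y by simp
    qed
    then have fv2: "f v2 = v2" using v2(2) f(1) by blast
    have "f v1 \<in> N r" "f v3 \<in> N r" using A_N[OF f(1), of _ r] fr[OF f(1)] N by auto
    moreover have "f v1 \<noteq> v2" "f v3 \<noteq> v2" "f v1 \<noteq> f v3" using fv2 A_inj[OF f(1)] N by metis+
    moreover have "c v1" "\<not> c v3" using cQ[of v1] cQ[of v3] N unfolding Q_def D0_def by auto
    moreover have "c (f v1) = c v1" using f(2) NrV N by blast
    ultimately have "f v1 = v1" "f v3 = v3" using N(1) by auto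
    then have "f \<in> F" unfolding F_def using f(1) fv2 N(1) by simp
    then show "\<forall>x\<in>V. f x = x" using cF f(2) by blast
  qed
qed

end

locale leaf_level = fixed_root +
  fixes n :: nat
  assumes n: "n \<ge> 1" "L n \<noteq> {}" "L (Suc n) = {}"
begin

section \<open>The finite tree of levels and its surroundings\<close>

definition T :: "'a set" where "T = (\<Union>j\<le>n. L j)"

definition O' :: "'a set" where "O' = (\<Union>x\<in>L n. t x)"

text \<open>The bound \<open>1 \<le> j\<close> leaves out the three neighbors of \<open>r\<close>,
  which do not form a pair.\<close>

definition siblings :: "'a set set" where
  "siblings = {t q | q j. 1 \<le> j \<and> j < n \<and> q \<in> L j}"

lemma T_I: "x \<in> L j \<Longrightarrow> j \<le> n \<Longrightarrow> x \<in> T"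
  unfolding T_def by blast

lemma leaf_two: "x \<in> L n \<Longrightarrow> two x"
proof -
  assume x: "x \<in> L n"
  obtain m where "n = Suc m" using n(1) by (cases n) auto
  then show ?thesis using x by simp
qed

lemma N_T: "j < n \<Longrightarrow> x \<in> L j \<Longrightarrow> N x \<subseteq> T"
proof (cases j)
  case 0
  assume "x \<in> L j"
  then have "N x = L (Suc 0)" using 0 L1 by simp
  moreover have "Suc 0 \<in> {..n}" using n(1) by simp
  ultimately show ?thesis unfolding T_def by blast
next
  case (Suc i)
  assume *: "j < n" "x \<in> L j"
  have "t x \<subseteq> L (Suc j)" using t_L[of i x] L_down[OF n(2), of "Suc j"] * Suc by simp
  then have "t x \<subseteq> T" using T_I[of _ "Suc j"] *(1) by auto
  moreover have "s x \<in> T" using T_I[of "s x" i] * Suc by simp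
  moreover have "N x = insert (s x) (t x)" using * Suc N_two by simp
  ultimately show ?thesis by simp
qed

lemma t_down: "1 \<le> j \<Longrightarrow> j < n \<Longrightarrow> x \<in> L j \<Longrightarrow> a \<in> t x \<Longrightarrow> a \<in> L (Suc j) \<and> s a = x"
proof -
  assume *: "1 \<le> j" "j < n" "x \<in> L j" "a \<in> t x"
  obtain i where i: "j = Suc i" using *(1) by (cases j) auto
  have a: "a \<in> L (Suc j)" using t_L[of i x] L_down[OF n(2), of "Suc j"] * i by auto
  have "x \<in> N a" "two a" using * a N_sym t_N by auto
  moreover have "x \<notin> t a"
  proof
    assume x: "x \<in> t a"
    show False
    proof (cases "Suc j < n")
      case True
      then have "x \<in> L (Suc (Suc j))" using t_L[of j a] L_down[OF n(2), of "Suc (Suc j)"] a x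
        by auto
      then show False using L_unique[OF *(3)] by fastforce
    next
      case False
      \<comment> \<open>On the last level no deeper level gives a contradiction. Instead,
        homogeneity yields an automorphism that fixes \<open>a\<close> and takes \<open>x\<close> to
        \<open>s a\<close>. It fixes \<open>s a\<close> as well, so \<open>x\<close> and
        \<open>s a\<close> would coincide.\<close>
      have "s a \<in> L j" "s a \<noteq> x" using a x t_iff by auto
      have "x \<in> t a" "a \<in> t x" using x *(4) .
      have "a \<in> t (s a)" using L_t[of a i] a i by simp
      obtain f where f: "f \<in> A" "f x = s a" using L_transitive[OF *(3) \<open>s a \<in> L j\<close>] by metis
      have "f a \<in> t (s a)" using t_A_iff[OF f(1), of x a] f(2) *(3,4) i by simp
      moreover have "two (s a)" using \<open>s a \<in> L j\<close> i by simp
      ultimately obtain g where g: "g \<in> A" "g (s a) = s a" "g (f a) = a"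
        using t_cases'[of "s a" "f a"] \<open>a \<in> t (s a)\<close> A_id by (metis id_apply insertE singletonD)
      have "(g \<circ> f) a = a" "(g \<circ> f) x = s a" "g \<circ> f \<in> A" using g f A_comp by simp_all
      then have "(g \<circ> f) (s a) = s a" using s_A[of "g \<circ> f" a] \<open>two a\<close> by simp
      then show False using \<open>(g \<circ> f) x = s a\<close> A_inj[OF \<open>g \<circ> f \<in> A\<close>] \<open>s a \<noteq> x\<close> by metis
    qed
  qed
  ultimately show ?thesis using t_iff a by blast
qed

lemma T_A: "f \<in> A \<Longrightarrow> f x \<in> T \<longleftrightarrow> x \<in> T"
  unfolding T_def by (simp add: L_A)

lemma r_T: "r \<in> T"
  using T_I[of r 0] by simp

lemma O'_A: "f \<in> A \<Longrightarrow> x \<in> O' \<Longrightarrow> f x \<in> O'"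
proof -
  assume f: "f \<in> A" "x \<in> O'"
  then obtain q where q: "q \<in> L n" "x \<in> t q" unfolding O'_def by blast
  have "f q \<in> L n" using L_A[OF f(1)] q(1) by blast
  moreover have "f x \<in> t (f q)" using t_A_iff[OF f(1) leaf_two[OF q(1)]] q(2) by blast
  ultimately show ?thesis unfolding O'_def by blast
qed

lemma s_T: "x \<in> T \<Longrightarrow> x \<noteq> r \<Longrightarrow> two x \<and> s x \<in> T"
proof -
  assume x: "x \<in> T" "x \<noteq> r"
  then obtain j where j: "j \<le> n" "x \<in> L j" unfolding T_def by blast
  then obtain i where "j = Suc i" using x(2) by (cases j) auto
  then show ?thesis using j T_I[of "s x" i] by simp
qed

lemma T_leaf: "x \<in> T \<Longrightarrow> y \<in> N x \<Longrightarrow> y \<notin> T \<Longrightarrow> x \<in> L n \<and> y \<in> t x"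
proof -
  assume *: "x \<in> T" "y \<in> N x" "y \<notin> T"
  then obtain j where j: "j \<le> n" "x \<in> L j" unfolding T_def by blast
  then have "j = n" using N_T[of j x] * by fastforce
  then have x: "x \<in> L n" using j by simp
  moreover have "x \<noteq> r" using x leaf_two not_two_r by blast
  then have "y \<noteq> s x" using s_T *(1,3) by metis
  ultimately show ?thesis using *(2) t_iff by blast
qed

lemma t_leaf_T: "x \<in> L n \<Longrightarrow> a \<in> t x \<Longrightarrow> a \<in> T \<Longrightarrow> a \<in> L n"
proof -
  assume *: "x \<in> L n" "a \<in> t x" "a \<in> T"
  obtain j where j: "j \<le> n" "a \<in> L j" using *(3) unfolding T_def by blast
  show "a \<in> L n"
  proof (rule ccontr)
    assume "a \<notin> L n"
    then have jn: "j < n" using j by (cases "j = n") auto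
    have xa: "x \<in> N a" using *(2) t_N N_sym by blast
    show False
    proof (cases j)
      case 0
      then have "a = r" using j by simp
      then show False using root_N xa *(2) t_iff by blast
    next
      case (Suc i)
      have tw: "two a" using j Suc by simp
      consider "x = s a" | "x \<in> t a" using xa N_two[OF tw] by blast
      then show False
      proof cases
        case 1
        then have "x \<in> L i" using j Suc by simp
        then show False using L_unique *(1) jn Suc by fastforce
      next
        case 2
        then have "s x = a" using t_down[of j a x] j Suc jn by simp
        then show False using *(2) t_iff by blast
      qed
    qed
  qed
qed

text \<open>Homogeneity takes \<open>x\<close> to \<open>x'\<close>; if \<open>a\<close> then goes
  to the other lower neighbor of \<open>x'\<close>, a flip at \<open>x'\<close> brings it
  back.\<close>

lemma common_leaf_neighbor:
  assumes "x \<in> L n" "x' \<in> L n" "a \<in> t x" "a \<in> t x'"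
  obtains k where "k \<in> A" "k a = a" "k x = x'"
proof -
  obtain f where f: "f \<in> A" "f x = x'" using L_transitive[OF assms(1,2)] by metis
  have "f a \<in> t x'" using t_A_iff[OF f(1) leaf_two[OF assms(1)]] f(2) assms(3) by metis
  then obtain b g where g: "t x' = {f a, b}" "g \<in> A" "g x' = x'" "g (f a) = b"
    using t_cases'[OF leaf_two[OF assms(2)]] by metis
  then have "f a = a \<or> g (f a) = a" using assms(4) by auto
  then consider "f a = a" | "g (f a) = a" by blast
  then show thesis
  proof cases
    case 1 then show thesis using that f by blast
  next
    case 2 then show thesis using that[of "g \<circ> f"] A_comp[OF g(2) f(1)] f(2) g(3) by simp
  qed
qed

text \<open>A vertex of \<open>T\<close> adjacent to \<open>a\<close> would be a leaf above
  \<open>a\<close>, and some automorphism fixing \<open>a\<close> takes \<open>x\<close> to it, so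
  it is not pinned.\<close>

lemma pinned_off_tree:
  assumes "x \<in> L n" "a \<in> t x" "a \<notin> T" "e \<in> N a" "pinned a e" "e \<noteq> x"
  shows "e \<notin> T"
proof
  assume "e \<in> T"
  then have e: "e \<in> L n" "a \<in> t e" using T_leaf[of e a] assms(3,4) N_sym by blast+
  then obtain k where k: "k \<in> A" "k a = a" "k x = e" using common_leaf_neighbor assms by metis
  then have "k e = e" using assms(5) pinnedD by blast
  then show False using k A_inj[OF k(1)] assms(6) by metis
qed

section \<open>Pairs and vertices that single out a branch\<close>

lemma siblings_elem:
  assumes "{x, y} \<in> siblings"
  obtains j where "1 \<le> j" "j < n" "s x \<in> L j" "x \<in> L (Suc j)" "t (s x) = {x, y}" "two (s x)" "x \<noteq> y"
proof -
  obtain q j where q: "1 \<le> j" "j < n" "q \<in> L j" "{x, y} = t q" using assms unfolding siblings_def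
    by blast
  have x: "x \<in> L (Suc j) \<and> s x = q" using t_down q by blast
  have tq: "two q" using q(1,3) by (cases j) auto
  then have "x \<noteq> y" using t_cases q(4) by (metis doubleton_eq_iff)
  then show thesis using that[of j] q x tq by simp
qed

lemma siblings_pairs:
  shows "{x, y} \<in> siblings \<Longrightarrow> x \<in> V \<and> x \<noteq> r \<and> x \<notin> N r \<and> x \<noteq> y"
    and "{x, y} \<in> siblings \<Longrightarrow> {x, z} \<in> siblings \<Longrightarrow> y = z"
    and "f \<in> A \<Longrightarrow> {x, y} \<in> siblings \<Longrightarrow> {f x, f y} \<in> siblings"
proof -
  show "x \<in> V \<and> x \<noteq> r \<and> x \<notin> N r \<and> x \<noteq> y" if xy: "{x, y} \<in> siblings"
  proof -
    obtain j where j: "1 \<le> j" "x \<in> L (Suc j)" "x \<noteq> y" using siblings_elem[OF xy] by metis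
    have "x \<notin> L 0" "x \<notin> L (Suc 0)" using L_unique[OF j(2), of 0] L_unique[OF j(2), of "Suc 0"] j(1)
      by auto
    then show ?thesis using L_V[OF j(2)] j(3) unfolding L1 by simp
  qed
  show "y = z" if "{x, y} \<in> siblings" "{x, z} \<in> siblings"
    using siblings_elem[OF that(1)] siblings_elem[OF that(2)] by (metis doubleton_eq_iff)
  show "{f x, f y} \<in> siblings" if f: "f \<in> A" and xy: "{x, y} \<in> siblings"
  proof -
    obtain j where j: "1 \<le> j" "j < n" "s x \<in> L j" "t (s x) = {x, y}" "two (s x)"
      using siblings_elem[OF xy] by metis
    have "{f x, f y} = t (f (s x))" using t_A[OF f j(5)] j(4) by simp
    then show ?thesis unfolding siblings_def using j L_A[OF f] by blast
  qed
qed

lemma top_fixed: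
  assumes "f \<in> A" "x \<in> L (Suc j)" "f x = x"
  shows "f ((s ^^ j) x) = (s ^^ j) x"
  using top_A[OF assms(1,2)] unfolding assms(3) by (rule sym)

text \<open>Members of a sibling pair have the same parent, so an automorphism preserving the pair
  keeps its branch, and \<open>mono_pair\<close> applies.\<close>

lemma sibling_pair:
  assumes y: "{y, y'} \<in> siblings" and p: "(r, p) \<in> (avoid {y, y'})\<^sup>*" "y \<in> N p" "y' \<notin> N p"
  shows "distinguishing_number G \<le> 2"
proof -
  obtain j where j: "1 \<le> j" "j < n" "s y \<in> L j" "y \<in> L (Suc j)" "t (s y) = {y, y'}"
    using siblings_elem[OF y] by metis
  obtain i where i: "j = Suc i" using j(1) by (cases j) auto
  have y': "s y' = s y" "two y'" using t_down[OF j(1-3), of y'] j(5) by auto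
  show ?thesis
  proof (rule mono_pair[of siblings y y' p "(s ^^ i) (s y)"])
    show "(s ^^ i) (s y) \<in> N r" using top_N[of "s y" i] j(3) i by simp
    show "f ((s ^^ i) (s y)) = (s ^^ i) (s y)" if f: "f \<in> A" "{f y, f y'} = {y, y'}" for f
    proof -
      have "f y = y \<or> f y = y'" using f(2) by blast
      then have "f (s y) = s y" using s_A[OF f(1), of y] y' j(4) by auto
      then show ?thesis using top_fixed[OF f(1), of "s y" i] j(3) i by simp
    qed
    show "{y, y'} \<in> siblings" "(r, p) \<in> (avoid {y, y'})\<^sup>*" "y \<in> N p" "y' \<notin> N p" by (fact y p)+
    show "u \<in> V \<and> u \<noteq> r \<and> u \<notin> N r \<and> u \<noteq> w" if "{u, w} \<in> siblings" for u w
      using siblings_pairs(1) that .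
    show "w = w'" if "{u, w} \<in> siblings" "{u, w'} \<in> siblings" for u w w'
      using siblings_pairs(2) that .
    show "{f u, f w} \<in> siblings" if "f \<in> A" "{u, w} \<in> siblings" for f u w
      using siblings_pairs(3) that .
  qed
qed

text \<open>The analogue for a white pair below a leaf, with both colors on all sibling pairs and
  all other pairs below leaves. Several leaves may lie above the same pair, hence \<open>top\<close>
  is a separate condition.\<close>

lemma leaf_pair:
  assumes disj: "O' \<inter> T = {}" and uniq: "\<And>x x'. x \<in> L n \<Longrightarrow> x' \<in> L n \<Longrightarrow> t x \<inter> t x' \<noteq> {} \<Longrightarrow> t x = t x'"
    and x: "x \<in> L n" "t x = {y, y'}"
    and p: "p \<in> O'" "p \<notin> {y, y'}" "y \<in> N p" "y' \<notin> N p"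
    and top: "\<And>f. f \<in> A \<Longrightarrow> {f y, f y'} = {y, y'} \<Longrightarrow> f ((s ^^ (n - 1)) x) = (s ^^ (n - 1)) x"
  shows "distinguishing_number G \<le> 2"
proof -
  have O'E: "u \<in> V \<and> u \<notin> T" if "u \<in> O'" for u using that disj t_N N_V(1) unfolding O'_def by blast
  have T0: "N r \<subseteq> T" using N_T[of 0 r] n(1) by simp
  let ?P = "siblings \<union> {t x | x. x \<in> L n}"
  have sT: "u \<in> T" if uw: "{u, w} \<in> siblings" for u w
  proof -
    obtain j where "j < n" "u \<in> L (Suc j)" using siblings_elem[OF uw] by metis
    then show ?thesis using T_I[of u "Suc j"] by simp
  qed
  have lO: "u \<in> O' \<and> u \<noteq> w" if uw: "{u, w} = t q" "q \<in> L n" for u w q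
  proof -
    have "u \<noteq> w" using t_cases[OF leaf_two[OF uw(2)]] uw(1) by (metis doubleton_eq_iff)
    then show ?thesis unfolding O'_def using uw by blast
  qed
  obtain m where m: "n = Suc m" using n(1) by (cases n) auto
  show ?thesis
  proof (rule mono_pair[of ?P y y' p "(s ^^ (n - 1)) x"])
    show "(s ^^ (n - 1)) x \<in> N r" using top_N[of x m] x(1) m by simp
    show "{y, y'} \<in> ?P" using x by blast
    show "u \<in> V \<and> u \<noteq> r \<and> u \<notin> N r \<and> u \<noteq> w" if uw: "{u, w} \<in> ?P" for u w
    proof (cases "{u, w} \<in> siblings")
      case True then show ?thesis by (rule siblings_pairs(1))
    next
      case False
      then obtain q where "{u, w} = t q" "q \<in> L n" using uw by blast
      then show ?thesis using lO O'E r_T T0 by blast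
    qed
    show "w = w'" if uw: "{u, w} \<in> ?P" and uw': "{u, w'} \<in> ?P" for u w w'
    proof (cases "u \<in> T")
      case True
      then have "\<not> (\<exists>q. {u, z} = t q \<and> q \<in> L n)" for z using lO O'E by blast
      then have "{u, w} \<in> siblings" "{u, w'} \<in> siblings" using uw uw' by blast+
      then show ?thesis by (rule siblings_pairs(2))
    next
      case False
      then have "{u, w} \<notin> siblings" "{u, w'} \<notin> siblings" using sT by blast+
      then obtain q q' where q: "{u, w} = t q" "q \<in> L n" "{u, w'} = t q'" "q' \<in> L n" using uw uw'
        by blast
      then have "t q = t q'" using uniq by blast
      then show ?thesis using q by (metis doubleton_eq_iff)
    qed
    show "{f u, f w} \<in> ?P" if f: "f \<in> A" and uw: "{u, w} \<in> ?P" for f u w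
    proof (cases "{u, w} \<in> siblings")
      case True then show ?thesis using siblings_pairs(3)[OF f] by blast
    next
      case False
      then obtain q where q: "{u, w} = t q" "q \<in> L n" using uw by blast
      then have "{f u, f w} = t (f q)" using t_A[OF f leaf_two[OF q(2)]]
        by (metis image_empty image_insert)
      then show ?thesis using q(2) L_A[OF f] by blast
    qed
    show "(r, p) \<in> (avoid {y, y'})\<^sup>*"
    proof -
      obtain q where q: "q \<in> L n" "p \<in> t q" using p(1) unfolding O'_def by blast
      have yO: "y \<notin> T" "y' \<notin> T" using x O'E unfolding O'_def by blast+
      have "(r, q) \<in> (avoid {y, y'})\<^sup>*"
      proof (rule reach_L[OF _ _ q(1)])
        show "L i \<inter> {y, y'} = {}" if "i < n" for i using yO that unfolding T_def by auto
        show "r \<notin> {y, y'}" using r_T yO by blast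
        show "q \<notin> {y, y'}" using yO q(1) unfolding T_def by auto
      qed simp
      then show ?thesis using avoid_step[of r q "{y, y'}" p] q t_N yO p(2) unfolding T_def by auto
    qed
    show "y \<in> N p" "y' \<notin> N p" by (fact p)+
    show "f ((s ^^ (n - 1)) x) = (s ^^ (n - 1)) x" if "f \<in> A" "{f y, f y'} = {y, y'}" for f
      using top that .
  qed
qed

text \<open>In its orbit only \<open>z0\<close> is black, so it is fixed, and with it the branch
  that contains it.\<close>

lemma marked_vertex:
  assumes disj: "O' \<inter> T = {}" and x0: "x0 \<in> L n" "a0 \<in> t x0"
    and z0: "z0 \<in> N a0" "pinned a0 z0" "z0 \<notin> O'" "z0 \<notin> T"
  shows "distinguishing_number G \<le> 2"
proof -
  obtain m where m: "n = Suc m" using n(1) by (cases n) auto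
  define v2 where "v2 = (s ^^ m) x0"
  have v2: "v2 \<in> N r" unfolding v2_def using top_N[of x0 m] x0(1) m by simp
  have a0: "a0 \<in> O'" "a0 \<notin> T" using x0 disj unfolding O'_def by blast+
  have v2z: "(v2, z0) \<in> (avoid {r})\<^sup>*"
  proof -
    have "(v2, x0) \<in> (avoid {r})\<^sup>*" unfolding v2_def using top_avoid[of x0 m] x0(1) m by simp
    moreover have "x0 \<noteq> r" using leaf_two[OF x0(1)] not_two_r by blast
    moreover have "a0 \<noteq> r" "z0 \<noteq> r" using r_T a0 z0 by blast+
    ultimately show ?thesis
      using avoid_step[of v2 x0 "{r}" a0] avoid_step[of v2 a0 "{r}" z0] t_N[OF x0(2)] z0(1) by blast
  qed
  obtain v1 v3
    where N: "N r = {v2, v1, v3}" "v2 \<noteq> v1" "v2 \<noteq> v3" "v1 \<noteq> v3" "v1 \<noteq> r" "v2 \<noteq> r" "v3 \<noteq> r"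
    using N_root_cases[OF v2] by metis
  have NrV: "N r \<subseteq> V" using N_V by blast
  have NrT: "N r \<subseteq> T" using N_T[of 0 r] n(1) by simp
  define Zs where "Zs = orb z0"
  have Zs: "z \<notin> O'" "z \<notin> T" if "z \<in> Zs" for z
  proof -
    obtain f where f: "f \<in> A" "z = f z0" using \<open>z \<in> Zs\<close> unfolding Zs_def by (rule orbE)
    obtain g where g: "g \<in> A" "g z = z0" using A_inv[OF f(1)] f(2) by metis
    show "z \<notin> O'" using O'_A[OF g(1)] g(2) z0(3) by metis
    show "z \<notin> T" using T_A[OF f(1)] f(2) z0(4) by metis
  qed
  define D0 where "D0 = insert r (N r)"
  have D0T: "D0 \<subseteq> T" unfolding D0_def using NrT r_T by blast
  define Q where "Q = D0 \<union> Zs"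
  define F where "F = {f \<in> A. \<forall>x\<in>N r. f x = x}"
  let ?q = "\<lambda>x. x = v1 \<or> x = z0"
  have "\<exists>c. good_coloring F Q ?q {} c"
  proof (rule extend_coloring[where ?D0.0 = D0])
    show "Q \<subseteq> V" unfolding Q_def D0_def Zs_def using rV NrV orb_V[OF N_V(1)[OF z0(1)]] by blast
    show "f x = x" if "f \<in> F" "x \<in> D0" for f x using that fr unfolding F_def D0_def by blast
    show "N x \<inter> D0 \<noteq> {}" if "x \<in> D0" for x using that v2 N_sym unfolding D0_def by blast
    fix D assume D: "D0 \<subseteq> D" "D \<subseteq> V" "D \<noteq> V" "\<And>x. x \<in> D \<Longrightarrow> N x \<inter> D \<noteq> {}"
    let ?good = "\<lambda>p. N p - D \<noteq> {} \<and> (\<forall>u\<in>N p - D. \<forall>u'\<in>N p - D. u \<noteq> u' \<longrightarrow> u \<in> Q \<longrightarrow> u' \<in> Q \<longrightarrow>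
        ?q u = ?q u' \<longrightarrow> (\<forall>f\<in>F. (\<forall>x\<in>D. f x = x) \<longrightarrow> f u = u))"
    have goodI: "?good p" if "N p - D \<noteq> {}" "(N p - D) \<inter> Zs = {}" for p
      using that D(1) unfolding Q_def by blast
    have rD: "r \<in> D" using D(1) unfolding D0_def by blast
    show "\<exists>p\<in>D. ?good p"
    \<comment> \<open>Growth is directed through \<open>T\<close>, then \<open>O'\<close>, then the
      orbit of \<open>z0\<close>. In the first two phases no missing neighbor lies in this orbit. In
      the third, the missing member at \<open>p\<close> is pinned by \<open>p\<close>, so no two
      neighbors can be confused.\<close>
    proof (cases "T \<subseteq> D")
      case False
      then obtain j where j: "j \<le> n" "\<not> L j \<subseteq> D" unfolding T_def by blast
      define k where "k = (LEAST k. \<not> L k \<subseteq> D)"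
      have k: "\<not> L k \<subseteq> D" "k \<le> j" unfolding k_def
        using LeastI[of "\<lambda>k. \<not> L k \<subseteq> D"] Least_le[of "\<lambda>k. \<not> L k \<subseteq> D"] j(2) by blast+
      then obtain i where i: "k = Suc i" using rD by (cases k) auto
      have Li: "L i \<subseteq> D" using not_less_Least[of i "\<lambda>k. \<not> L k \<subseteq> D"] i unfolding k_def by auto
      obtain u where u: "u \<in> L (Suc i)" "u \<notin> D" using k(1) i by blast
      have su: "s u \<in> L i" "u \<in> N (s u)" using u(1) s_N[of u] N_sym by auto
      have "N (s u) \<subseteq> T" using N_T[of i "s u"] su(1) k(2) i j(1) by simp
      then have "?good (s u)" using goodI[of "s u"] Zs(2) u(2) su(2) by blast
      then show ?thesis using su(1) Li by blast
    next
      case TD: True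
      show ?thesis
      proof (cases "O' \<subseteq> D")
        case False
        then obtain x u where u: "x \<in> L n" "u \<in> t x" "u \<notin> D" unfolding O'_def by blast
        have xT: "x \<in> T" using u(1) unfolding T_def by blast
        have xr: "x \<noteq> r" using leaf_two[OF u(1)] not_two_r by blast
        have "N x - D \<subseteq> t x" using s_T[OF xT xr] TD N_two[OF leaf_two[OF u(1)]] by auto
        moreover have "t x \<subseteq> O'" using u(1) unfolding O'_def by blast
        ultimately have "(N x - D) \<inter> Zs = {}" using Zs(1) by blast
        then have "?good x" using goodI[of x] t_N[OF u(2)] u(3) by blast
        then show ?thesis using xT TD by blast
      next
        case OD: True
        show ?thesis
        proof (cases "Zs \<subseteq> D")
          case False
          then obtain h where h: "h \<in> A" "h z0 \<notin> D" unfolding Zs_def by (auto elim: orbE)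
          define p where "p = h a0"
          have p: "p \<in> D" "h z0 \<in> N p" using OD O'_A[OF h(1) a0(1)] A_N[OF h(1)] z0(1)
            unfolding p_def by auto
          obtain e where e: "e \<in> N p" "e \<in> D" using D(4)[OF p(1)] by blast
          have pin: "pinned p (h z0)" using pinned_A[OF h(1)] z0(2) unfolding p_def by blast
          have "f u = u" if u: "u \<in> N p - D" and f: "f \<in> F" "\<forall>x\<in>D. f x = x" for u f
          proof -
            have fA: "f \<in> A" "f p = p" "f e = e" using f p e unfolding F_def by blast+
            have fz: "f (h z0) = h z0" using pinnedD[OF pin fA(1,2)] .
            show ?thesis
            proof (rule ccontr)
              assume ne: "f u \<noteq> u"
              then have "u \<noteq> h z0" "u \<noteq> e" "h z0 \<noteq> e" using fz e u h(2) by auto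
              then have Np: "N p = {u, h z0, e}" using N3_eq[of u p "h z0" e] u p(2) e by blast
              have "f u \<in> N p" using A_N[OF fA(1), of u p] fA(2) u by simp
              moreover have "f u \<noteq> h z0" "f u \<noteq> e" using fz fA A_inj[OF fA(1)] \<open>u \<noteq> h z0\<close> \<open>u \<noteq> e\<close>
                by metis+
              ultimately show False using Np ne by auto
            qed
          qed
          then have "?good p" using p h(2) by blast
          then show ?thesis using p(1) by blast
        next
          case ZD: True
          obtain p where p: "p \<in> D" "N p - D \<noteq> {}" using frontier[of D] D rD by blast
          then have "?good p" using goodI[of p] ZD by blast
          then show ?thesis using p(1) by blast
        qed
      qed
    qed
  qed (auto simp: F_def Q_def D0_def)
  then obtain c where c: "good_coloring F Q ?q {} c" by blast
  note cQ = good_coloringD(1)[OF c] and cF = good_coloringD(3)[OF c]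
  have z0Z: "z0 \<in> Zs" unfolding Zs_def by (rule orb_refl)
  have v1Z: "v1 \<notin> Zs" "v3 \<noteq> z0" using Zs(2)[of v1] Zs(2)[OF z0Z] NrT N by blast+
  show ?thesis
  proof (rule distinguishing_number_le_2I[of c])
    fix f assume f: "f \<in> A" "\<And>x. x \<in> V \<Longrightarrow> c (f x) = c x"
    have "c z0" using cQ[of z0] z0Z unfolding Q_def by blast
    then have "c (f z0)" using f(2) N_V(1)[OF z0(1)] by blast
    moreover have fZ: "f z0 \<in> Zs" unfolding Zs_def using orbI[OF f(1)] .
    ultimately have fz: "f z0 = z0" using cQ[of "f z0"] v1Z unfolding Q_def by blast
    have fN: "f x \<in> N r" if "x \<in> N r" for x using A_N[OF f(1), of x r] fr[OF f(1)] that by simp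
    have "(f v2, z0) \<in> (avoid {r})\<^sup>*" using avoid_A[OF f(1) _ v2z] fr[OF f(1)] fz by simp
    then have "(f v2, v2) \<in> (avoid {r})\<^sup>*" using avoid_sym[OF v2z] by (meson rtrancl_trans)
    then have fv2: "f v2 = v2" using separated fN v2 by blast
    have "f v1 \<in> N r" "f v3 \<in> N r" using fN N by auto
    moreover have "f v1 \<noteq> v2" "f v3 \<noteq> v2" "f v1 \<noteq> f v3" using fv2 A_inj[OF f(1)] N by metis+
    moreover have "c v1" "\<not> c v3" using cQ[of v1] cQ[of v3] N v1Z unfolding Q_def D0_def by auto
    moreover have "c (f v1) = c v1" using f(2) NrV N by blast
    ultimately have "f v1 = v1" "f v3 = v3" using N(1) by auto
    then have "f \<in> F" unfolding F_def using f(1) fv2 N(1) by simp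
    then show "\<forall>x\<in>V. f x = x" using cF f(2) by blast
  qed
qed

section \<open>The last level\<close>

text \<open>\<open>L n\<close> consists of the leaves of \<open>T\<^sub>n\<close>, and the neighbors below two sibling leaves form a pair \<open>x, y\<close> as in
  the construction of \<open>R\<^sup>2\<^sub>n\<close>.\<close>

definition R2_shape :: bool where
  "R2_shape \<longleftrightarrow> 2 \<le> n \<and> O' \<inter> T = {} \<and> (\<forall>x\<in>L n. \<forall>a\<in>t x. two a \<and> t a = t (s x) \<and> s a \<in> t x)"

text \<open>Now \<open>L (n - 1)\<close> consists of the leaves of \<open>T\<^sub>n\<^sub>-\<^sub>1\<close>, and \<open>L n\<close> of the vertices \<open>x, y, z, w\<close> added in the
  construction of \<open>R\<^sup>3\<^sub>n\<^sub>-\<^sub>1\<close>.\<close>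

definition R3_shape :: bool where
  "R3_shape \<longleftrightarrow> 3 \<le> n \<and>
    (\<forall>x\<in>L n. \<forall>y\<in>t x. y \<in> L n \<and> t x = t (s y) \<and> s x \<noteq> s y \<and> s (s x) = s (s y))"

lemma sibling:
  assumes "x \<in> L (Suc (Suc k))" "Suc (Suc k) \<le> n"
  obtains x' where "t (s x) = {x, x'}" "x \<noteq> x'" "{x, x'} \<in> siblings" "x' \<in> L (Suc (Suc k))" "s x' = s x"
proof -
  have sx: "s x \<in> L (Suc k)" "two (s x)" using assms(1) by auto
  obtain x' where x': "t (s x) = {x, x'}" "x \<noteq> x'" using t_cases'[OF sx(2) L_t[OF assms(1)]]
    by metis
  have "x' \<in> L (Suc (Suc k)) \<and> s x' = s x" using t_down[of "Suc k" "s x" x'] assms(2) sx(1) x'(1)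
    by auto
  moreover have "{x, x'} \<in> siblings"
    unfolding siblings_def using x'(1)[symmetric] sx(1) assms(2)
    by (intro CollectI exI[of _ "s x"] exI[of _ "Suc k"]) (simp add: Suc_le_eq del: L.simps)
  ultimately show thesis using that x' by blast
qed

lemma leaf_sibling:
  assumes "n \<ge> 2" "x \<in> L n"
  obtains x' where "t (s x) = {x, x'}" "x \<noteq> x'" "{x, x'} \<in> siblings" "x' \<in> L n" "s x' = s x"
proof -
  obtain k where k: "Suc (Suc k) = n" using assms(1) by (metis add_2_eq_Suc le_Suc_ex)
  have "x \<in> L (Suc (Suc k))" unfolding k by (rule assms(2))
  moreover have "Suc (Suc k) \<le> n" unfolding k by simp
  ultimately show thesis using sibling[of x k] that unfolding k by metis
qed

lemma leaf_t:
  assumes "n \<ge> 2" "x \<in> L n"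
  shows "x \<in> t (s x)" "two (s x)"
proof -
  obtain k where k: "Suc (Suc k) = n" using assms(1) by (metis add_2_eq_Suc le_Suc_ex)
  have x: "x \<in> L (Suc (Suc k))" unfolding k by (rule assms(2))
  show "x \<in> t (s x)" using L_t[OF x] .
  show "two (s x)" using x by simp
qed

lemma leaf_neq_root: "x \<in> L n \<Longrightarrow> x \<noteq> r"
  using leaf_two not_two_r by blast

text \<open>For \<open>n = 1\<close> the leaves are the neighbors of \<open>r\<close>, which are
  separated by \<open>r\<close>.\<close>

lemma n_ge_2:
  assumes "x \<in> L n" "x' \<in> L n" "x \<noteq> x'" "(x, x') \<in> (avoid {r})\<^sup>*"
  shows "n \<ge> 2"
proof (rule ccontr)
  assume "\<not> n \<ge> 2"
  then have "n = Suc 0" using n(1) by simp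
  then have "x \<in> N r" "x' \<in> N r" using assms(1,2) L1 by metis+
  then show False using separated assms(3,4) by blast
qed

lemma n_ge_2_common:
  assumes "x \<in> L n" "x' \<in> L n" "x \<noteq> x'" "a \<in> N x" "a \<in> N x'" "a \<noteq> r"
  shows "n \<ge> 2"
proof -
  have "(x, a) \<in> (avoid {r})\<^sup>*"
    using avoid_step[of x x "{r}" a] assms leaf_neq_root by blast
  then have "(x, x') \<in> (avoid {r})\<^sup>*"
    using avoid_step[of x a "{r}" x'] assms leaf_neq_root N_sym by blast
  then show ?thesis using n_ge_2 assms by blast
qed

text \<open>The ancestors of the leaf \<open>x\<close> lie in earlier levels and thus lead from
  \<open>r\<close> to \<open>x\<close> without meeting \<open>y\<close> or
  \<open>y'\<close>.\<close>

lemma leaf_sibling_pair: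
  assumes "n \<ge> 2" "y \<in> L n" "t (s y) = {y, y'}" and x: "x \<in> L n" "x \<noteq> y" "x \<noteq> y'"
    and p: "p = x \<or> p \<in> N x \<and> p \<noteq> y \<and> p \<noteq> y'" "y \<in> N p" "y' \<notin> N p"
  shows "distinguishing_number G \<le> 2"
proof -
  obtain z where z: "t (s y) = {y, z}" "y \<noteq> z" "{y, z} \<in> siblings" "z \<in> L n"
    using leaf_sibling[OF assms(1,2)] by metis
  then have "z = y'" using assms(3) by (auto simp: doubleton_eq_iff)
  then have y': "{y, y'} \<in> siblings" "y' \<in> L n" using z by simp_all
  have "(r, x) \<in> (avoid {y, y'})\<^sup>*"
  proof (rule reach_L[OF _ _ x(1)])
    show "L i \<inter> {y, y'} = {}" if "i < n" for i
      using L_unique[OF assms(2), of i] L_unique[OF y'(2), of i] that by auto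
    show "r \<notin> {y, y'}" using leaf_neq_root assms(2) y'(2) by blast
    show "x \<notin> {y, y'}" using x by blast
  qed simp
  then have "(r, p) \<in> (avoid {y, y'})\<^sup>*" using avoid_step[of r x "{y, y'}" p] x p(1) by blast
  then show ?thesis using sibling_pair[OF y'(1)] p(2,3) by blast
qed

text \<open>By homogeneity all lower neighbors of leaves are leaves. Wherever they deviate from
  \<open>R3_shape\<close>, some leaf sees exactly one member of a sibling pair, on the last level or
  on the one above.\<close>

lemma leaf_neighbors_in_tree:
  assumes x0: "x0 \<in> L n" "a0 \<in> t x0" "a0 \<in> T"
  obtains "distinguishing_number G \<le> 2" | "R3_shape"
proof -
  have inL: "t x \<subseteq> L n" if x: "x \<in> L n" for x
  proof -
    obtain f where f: "f \<in> A" "f x0 = x" using L_transitive[OF x0(1) x] by metis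
    obtain b g where g: "t x0 = {a0, b}" "g \<in> A" "g a0 = b"
      using t_cases'[OF leaf_two[OF x0(1)] x0(2)] by metis
    have a0: "a0 \<in> L n" using t_leaf_T[OF x0] .
    then have b: "b \<in> L n" using L_A[OF g(2)] g(3) by blast
    have "t x = {f a0, f b}" using t_A[OF f(1) leaf_two[OF x0(1)]] f(2) g(1) by simp
    then show ?thesis using L_A[OF f(1)] a0 b by simp
  qed
  have a0: "a0 \<in> L n" "a0 \<in> N x0" "a0 \<noteq> x0" using inL x0 t_N N_neq by blast+
  have n2: "n \<ge> 2"
  proof (rule n_ge_2[OF x0(1) a0(1)])
    show "(x0, a0) \<in> (avoid {r})\<^sup>*" using avoid_step[of x0 x0 "{r}" a0] a0 leaf_neq_root x0(1)
      by blast
  qed (use a0 in blast)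
  then obtain k where k: "n = Suc (Suc k)" by (metis add_2_eq_Suc le_Suc_ex)
  \<comment> \<open>The flip of \<open>t x\<close> fixes \<open>x\<close> and its parent, hence also
    the sibling of \<open>x\<close>; but it moves both members of \<open>t x\<close>.\<close>
  have not_sib: "s y \<noteq> s x" if x: "x \<in> L n" and y: "y \<in> t x" for x y
  proof
    assume eq: "s y = s x"
    obtain b g where g: "t x = {y, b}" "y \<noteq> b" "g \<in> A" "g x = x" "g y = b"
      using t_cases'[OF leaf_two[OF x] y] by metis
    have yL: "y \<in> L n" using inL x y by blast
    have "x \<in> t (s x)" "y \<in> t (s x)" using leaf_t(1)[OF n2 x] leaf_t(1)[OF n2 yL] eq by simp_all
    moreover have "two (s x)" using leaf_t(2)[OF n2 x] .
    moreover have "g (s x) = s x" using s_A[OF g(3) leaf_two[OF x]] g(4) by simp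
    ultimately have "g y = y" using two_stab[of "s x" g x y] g t_N by blast
    then show False using g by simp
  qed
  show thesis
  proof (cases "\<exists>x\<in>L n. \<exists>y\<in>t x. \<exists>z\<in>t x. s y \<noteq> s z")
    case True
    then obtain x y z where x: "x \<in> L n" "y \<in> t x" "z \<in> t x" "s y \<noteq> s z" by blast
    have yL: "y \<in> L n" using inL x by blast
    obtain y' where y': "t (s y) = {y, y'}" "y' \<in> L n" "s y' = s y"
      using leaf_sibling[OF n2 yL] by metis
    have tx: "t x = {y, z}" using t_cases[OF leaf_two[OF x(1)]] x
      by (metis insertE singletonD doubleton_eq_iff)
    have "y' \<notin> N x"
    proof
      assume "y' \<in> N x"
      then consider "y' = s x" | "y' = y" | "y' = z" using N_two[OF leaf_two[OF x(1)]] tx by blast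
      then show False
      proof cases
        case 1
        have "s x \<in> L (Suc k)" using x(1) k by simp
        then show False using y'(2) L_unique[of "s x" "Suc k" n] 1 k by simp
      next
        case 2
        obtain y'' where "t (s y) = {y, y''}" "y \<noteq> y''" using leaf_sibling[OF n2 yL] by metis
        then show False using y'(1) 2 by (auto simp: doubleton_eq_iff)
      next
        case 3 then show False using y'(3) x(4) by simp
      qed
    qed
    moreover have "x \<noteq> y" "x \<noteq> y'" using not_sib[OF x(1,2)] y'(3) by auto
    ultimately have "distinguishing_number G \<le> 2"
      using leaf_sibling_pair[OF n2 yL y'(1) x(1), of x] t_N[OF x(2)] by blast
    then show thesis by (rule that(1))
  next
    case False
    have tt: "t x = t (s y)" if x: "x \<in> L n" and y: "y \<in> t x" for x y
    proof -
      obtain z where z: "t x = {y, z}" "y \<noteq> z" using t_cases'[OF leaf_two[OF x] y] by metis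
      have yz: "y \<in> L n" "z \<in> L n" "s z = s y" using inL[OF x] z False x y by auto
      obtain y' where y': "t (s y) = {y, y'}" using leaf_sibling[OF n2 yz(1)] by metis
      have "z \<in> t (s y)" using leaf_t(1)[OF n2 yz(2)] yz(3) by simp
      then show ?thesis using y' z by auto
    qed
    show thesis
    proof (cases "\<exists>x\<in>L n. \<exists>y\<in>t x. s (s x) \<noteq> s (s y)")
      case True
      then obtain x y where x: "x \<in> L n" "y \<in> t x" "s (s x) \<noteq> s (s y)" by blast
      have yL: "y \<in> L n" using inL x by blast
      have "s (s x) \<in> L k" "s (s y) \<in> L k" using x(1) yL k by simp_all
      then have "k \<noteq> 0" using x(3) by (metis L.simps(1) singletonD)
      then obtain m where m: "k = Suc m" by (cases k) auto
      have sy: "s y \<in> L (Suc (Suc m))" "s x \<in> L (Suc (Suc m))" using yL x(1) k m by auto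
      \<comment> \<open>The white pair consists of \<open>s y\<close> and its sibling. From
        \<open>r\<close> one reaches \<open>y\<close> through \<open>s x\<close> and
        \<open>x\<close>, and \<open>y\<close> sees only \<open>s y\<close>.\<close>
      obtain u where u: "t (s (s y)) = {s y, u}" "s y \<noteq> u" "{s y, u} \<in> siblings" "u \<in> L (Suc (Suc m))" "s u = s (s y)"
        using sibling[OF sy(1)] k m by (metis Suc_le_eq lessI less_imp_le)
      have lv: "v \<notin> {s y, u}" if "v \<in> L j" "j \<noteq> Suc (Suc m)" for v j
        using L_unique[OF that(1)] sy(1) u(4) that(2) by blast
      have "s x \<notin> {s y, u}" using not_sib[OF x(1,2)] u(5) x(3) by auto
      then have "(r, s x) \<in> (avoid {s y, u})\<^sup>*"
      proof (rule reach_L[where m = "Suc (Suc m)", OF _ _ sy(2), rotated 3])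
        show "L i \<inter> {s y, u} = {}" if "i < Suc (Suc m)" for i using lv that by fastforce
        show "r \<notin> {s y, u}" using lv[of r 0] by simp
      qed simp
      moreover have xn: "x \<notin> {s y, u}" "y \<notin> {s y, u}" using lv[OF x(1)] lv[OF yL] k m by auto
      moreover have "x \<in> N (s x)" using s_N[OF leaf_two[OF x(1)]] N_sym by blast
      ultimately have "(r, x) \<in> (avoid {s y, u})\<^sup>*"
        using avoid_step[of r "s x" "{s y, u}" x] \<open>s x \<notin> {s y, u}\<close> by blast
      then have "(r, y) \<in> (avoid {s y, u})\<^sup>*"
        using avoid_step[of r x "{s y, u}" y] xn t_N[OF x(2)] by blast
      moreover have "u \<notin> N y"
      proof
        assume "u \<in> N y"
        then have "u \<in> t y" using u(2) t_iff by blast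
        then have "u \<in> L n" using inL yL by blast
        then show False using L_unique[OF u(4)] k m by fastforce
      qed
      ultimately have "distinguishing_number G \<le> 2"
        using sibling_pair[OF u(3)] s_N[OF leaf_two[OF yL]] by blast
      then show thesis by (rule that(1))
    next
      case same: False
      \<comment> \<open>For \<open>n = 2\<close> the parents of \<open>x0\<close> and
        \<open>a0\<close> are neighbors of \<open>r\<close> in the same branch, so they would
        coincide, against \<open>not_sib\<close>.\<close>
      have "k \<noteq> 0"
      proof
        assume "k = 0"
        then have sL: "s x0 \<in> N r" "s a0 \<in> N r" using x0(1) a0(1) k L1
          by (auto simp del: L.simps dest: s_L)
        have "(s x0, x0) \<in> (avoid {r})\<^sup>*"
          using avoid_step[of "s x0" "s x0" "{r}" x0] sL N_neq leaf_neq_root[OF x0(1)] s_N[OF leaf_two[OF x0(1)]] N_sym by blast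
        then have "(s x0, a0) \<in> (avoid {r})\<^sup>*"
          using avoid_step[of "s x0" x0 "{r}" a0] a0 leaf_neq_root x0(1) by blast
        then have "(s x0, s a0) \<in> (avoid {r})\<^sup>*"
          using avoid_step[of "s x0" a0 "{r}" "s a0"] sL N_neq leaf_neq_root[OF a0(1)] s_N[OF leaf_two[OF a0(1)]] by blast
        then show False using separated sL not_sib[OF x0(1,2)] by metis
      qed
      then have "3 \<le> n" using k by simp
      then have "R3_shape" unfolding R3_shape_def using inL tt not_sib same by (metis subsetD)
      then show thesis by (rule that(2))
    qed
  qed
qed

text \<open>By \<open>move\<close> all lower neighbors of leaves are equivalent, so the local group
  at one of them decides between the cases. \<open>R2_shape\<close> is what survives when it has
  order 2.\<close>

lemma leaf_neighbors_off_tree: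
  assumes disj: "O' \<inter> T = {}"
  obtains "distinguishing_number G \<le> 2" | "R2_shape"
proof -
  obtain x0 where x0: "x0 \<in> L n" using n(2) by blast
  obtain a0 where a0: "a0 \<in> t x0" using t_cases[OF leaf_two[OF x0]] by blast
  have off: "a \<notin> T" "a \<noteq> r" "a \<in> O'" if "x \<in> L n" "a \<in> t x" for x a
    using that disj r_T unfolding O'_def by blast+
  have LT: "x \<in> T" if "x \<in> L n" for x using T_I that by blast
  have move: "\<exists>f\<in>A. f x0 = x \<and> f a0 = a" if x: "x \<in> L n" and a: "a \<in> t x" for x a
  proof -
    obtain f where f: "f \<in> A" "f x0 = x" using L_transitive[OF x0 x] by metis
    have "f a0 \<in> t x" using t_A_iff[OF f(1) leaf_two[OF x0], of a0] f(2) a0 by simp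
    then obtain b g where g: "t x = {f a0, b}" "g \<in> A" "g x = x" "g (f a0) = b"
      using t_cases'[OF leaf_two[OF x]] by metis
    then have "f a0 = a \<or> g (f a0) = a" using a by auto
    then show ?thesis using f g A_comp[OF g(2) f(1)] by (metis comp_apply)
  qed
  have "a0 \<in> V" using a0 t_N N_V by blast
  then show thesis
  proof (rule trichotomy)
    assume tr: "transitive a0"
    have x0N: "x0 \<in> N a0" using t_N[OF a0] N_sym by blast
    have allL: "x \<in> L n \<and> a0 \<in> t x" if x: "x \<in> N a0" for x
    proof -
      obtain f where "f \<in> A" "f x0 = x" using transitiveD[OF tr x0N x] by metis
      then have "x \<in> L n" using L_A x0 by blast
      then show ?thesis using T_leaf[OF LT, of x a0] x N_sym off[OF x0 a0] by blast
    qed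
    obtain x2 x3 where N: "N a0 = {x0, x2, x3}" "x0 \<noteq> x2" "x0 \<noteq> x3" "x2 \<noteq> x3"
      using N3[OF \<open>a0 \<in> V\<close> x0N] by metis
    have x23: "x2 \<in> L n" "x3 \<in> L n" using allL N by auto
    have n2: "n \<ge> 2"
      using n_ge_2_common[OF x0 x23(1) N(2), of a0] N N_sym t_N[OF a0] off[OF x0 a0] by blast
    then obtain k where k: "n = Suc (Suc k)" by (metis add_2_eq_Suc le_Suc_ex)
    have two_only: "\<not> (s u = s u' \<and> s u = s u'')"
      if u: "u \<in> L n" "u' \<in> L n" "u'' \<in> L n" "u \<noteq> u'" "u \<noteq> u''" "u' \<noteq> u''" for u u' u''
    proof
      assume eq: "s u = s u' \<and> s u = s u''"
      obtain z where z: "t (s u) = {u, z}" using leaf_sibling[OF n2 u(1)] by metis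
      have "u' \<in> t (s u)" using leaf_t(1)[OF n2 u(2)] conjunct1[OF eq] by metis
      moreover have "u'' \<in> t (s u)" using leaf_t(1)[OF n2 u(3)] conjunct2[OF eq] by metis
      ultimately show False using u(4-6) unfolding z by simp
    qed
    \<comment> \<open>If two of the three leaves around \<open>a0\<close> were siblings, moving one
      of them to the third would make all three siblings.\<close>
    have diff: "s u \<noteq> s u'" if u: "u \<in> N a0" "u' \<in> N a0" "u \<noteq> u'" for u u'
    proof
      assume eq: "s u = s u'"
      obtain u'' where N': "N a0 = {u, u', u''}" "u \<noteq> u''" "u' \<noteq> u''" using N3'[OF \<open>a0 \<in> V\<close> u]
        by metis
      have uL: "u \<in> L n" "u' \<in> L n" "u'' \<in> L n" using allL N' by auto
      obtain f where f: "f \<in> A" "f a0 = a0" "f u = u''" using transitiveD[OF tr u(1), of u''] N'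
        by auto
      have "f u' \<in> N a0" "f u' \<noteq> u''"
        using A_N[OF f(1), of u' a0] f u(2) A_inj[OF f(1), of u' u] u(3) by auto
      then have "f u' = u \<or> f u' = u'" using N' by blast
      moreover have "s (f u') = s u''" using s_A[OF f(1)] leaf_two uL eq f(3) by metis
      ultimately show False using eq two_only[OF uL u(3) N'(2,3)] by metis
    qed
    obtain x2' where x2': "t (s x2) = {x2, x2'}" "x2 \<noteq> x2'" "s x2' = s x2" "x2' \<in> L n"
      using leaf_sibling[OF n2 x23(1)] by metis
    have "x2' \<notin> N a0" using diff[of x2 x2'] N x2' by auto
    moreover have "x0 \<noteq> x2'" using calculation x0N by blast
    moreover have "a0 \<noteq> x2" "a0 \<noteq> x2'" using off[OF x0 a0] LT x23(1) x2'(4) by blast+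
    ultimately have "distinguishing_number G \<le> 2"
      using leaf_sibling_pair[OF n2 x23(1) x2'(1) x0 N(2), of a0] t_N[OF a0] N(1) by blast
    then show thesis by (rule that(1))
  next
    assume tw0: "two a0"
    have tw: "two a" if "x \<in> L n" "a \<in> t x" for x a using move[OF that] two_A tw0 by blast
    \<comment> \<open>If \<open>x\<close> were the fixed neighbor of \<open>a\<close>, then
      \<open>a\<close> would belong to the level after the last.\<close>
    have sx: "x \<in> t a" if xa: "x \<in> L n" "a \<in> t x" for x a
    proof -
      have "s a \<noteq> x"
      proof
        assume "s a = x"
        then have "a \<in> L (Suc n)" using tw[OF xa] xa(1) by simp
        then show False using n(3) by blast
      qed
      then show ?thesis using t_iff t_N[OF xa(2)] N_sym by metis
    qed
    have sT: "s a \<notin> T" if xa: "x \<in> L n" "a \<in> t x" for x a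
      using pinned_off_tree[OF xa off(1)[OF xa] s_N[OF tw[OF xa]] s_pinned[OF tw[OF xa]]] sx[OF xa] t_iff by blast
    have taL: "t a \<subseteq> L n" if xa: "x \<in> L n" "a \<in> t x" for x a
    proof -
      obtain b g where g: "t a = {x, b}" "g \<in> A" "g x = b" using t_cases'[OF tw[OF xa] sx[OF xa]]
        by metis
      then show ?thesis using xa(1) L_A by auto
    qed
    obtain x2 where x2: "t a0 = {x0, x2}" "x0 \<noteq> x2" using t_cases'[OF tw0 sx[OF x0 a0]] by metis
    have n2: "n \<ge> 2"
      using n_ge_2_common[OF x0 _ x2(2), of a0] taL[OF x0 a0] x2 t_N[OF a0] t_N[of x2 a0] N_sym off[OF x0 a0] by blast
    then obtain k where k: "n = Suc (Suc k)" by (metis add_2_eq_Suc le_Suc_ex)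
    show thesis
    proof (cases "\<exists>x\<in>L n. \<exists>a\<in>t x. t a \<noteq> t (s x)")
      case True
      then obtain x a where x: "x \<in> L n" "a \<in> t x" "t a \<noteq> t (s x)" by blast
      obtain y where y: "t a = {x, y}" "x \<noteq> y" using t_cases'[OF tw[OF x(1,2)] sx[OF x(1,2)]]
        by metis
      have yL: "y \<in> L n" using taL[OF x(1,2)] y by blast
      obtain y' where y': "t (s y) = {y, y'}" "y \<noteq> y'" "y' \<in> L n" "s y' = s y"
        using leaf_sibling[OF n2 yL] by metis
      have xy': "x \<noteq> y'"
      proof
        assume eq: "x = y'"
        then have "t (s x) = t (s y)" using y'(4) by metis
        then show False using x(3) unfolding y'(1) y(1) eq by (simp add: insert_commute)
      qed
      have "y' \<notin> N a"
      proof
        assume "y' \<in> N a"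
        then have "y' = s a \<or> y' \<in> t a" using t_iff by blast
        then show False using sT[OF x(1,2)] LT[OF y'(3)] y'(2) xy' unfolding y(1)
          by (metis insertE singletonD)
      qed
      moreover have "a \<noteq> y" "a \<noteq> y'" using off[OF x(1,2)] LT yL y'(3) by blast+
      moreover have "y \<in> N a" using y(1) t_N by blast
      ultimately have "distinguishing_number G \<le> 2"
        using leaf_sibling_pair[OF n2 yL y'(1) x(1) y(2) xy', of a] t_N[OF x(2)] by blast
      then show thesis by (rule that(1))
    next
      case False
      then have ta: "t a = t (s x)" if "x \<in> L n" "a \<in> t x" for x a using that by blast
      have sub: "t x \<subseteq> t x'" if x: "x \<in> L n" "x' \<in> L n" and a: "a \<in> t x" "a \<in> t x'" for x x' a
      proof
        fix b assume b: "b \<in> t x"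
        have "x' \<in> t a" using sx x(2) a(2) by blast
        then have "x' \<in> t b" using ta[OF x(1) a(1)] ta[OF x(1) b] by simp
        then have "b \<in> N x'" using t_N N_sym by blast
        then show "b \<in> t x'" using T_leaf[OF LT[OF x(2)]] off[OF x(1) b] by blast
      qed
      have uniq: "t x = t x'" if x: "x \<in> L n" "x' \<in> L n" and ne: "t x \<inter> t x' \<noteq> {}" for x x'
        using sub[OF x] sub[OF x(2,1)] ne by blast
      show thesis
      proof (cases "\<exists>x\<in>L n. \<exists>a\<in>t x. s a \<notin> t x")
        case True
        then obtain x a where x: "x \<in> L n" "a \<in> t x" "s a \<notin> t x" by blast
        have xo: "a \<in> N (s a)" using s_N[OF tw[OF x(1,2)]] N_sym by blast
        have "distinguishing_number G \<le> 2"
        proof (cases "s a \<in> O'")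
          case inO: True
          then obtain q where q: "q \<in> L n" "s a \<in> t q" unfolding O'_def by blast
          obtain b where b: "t x = {a, b}" "a \<noteq> b" using t_cases'[OF leaf_two[OF x(1)] x(2)]
            by metis
          \<comment> \<open>As a member of \<open>O'\<close>, the vertex \<open>s a\<close> has
            leaves as its lower neighbors, so it has just one neighbor off the tree and cannot see
            both \<open>a\<close> and \<open>b\<close>.\<close>
          have only: "c = s (s a)" if "c \<in> N (s a)" "c \<notin> T" for c
            using that taL[OF q] LT t_iff by blast
          show ?thesis
          proof (rule leaf_pair[OF disj uniq x(1) b(1), of "s a"])
            show "s a \<in> O'" by (rule inO)
            show "s a \<notin> {a, b}" using x(3) b(1) by simp
            show "a \<in> N (s a)" by (rule xo)
            show "b \<notin> N (s a)"
            proof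
              assume "b \<in> N (s a)"
              then have "b = s (s a)" "a = s (s a)"
                using only[of b] only[of a] xo off[OF x(1)] b(1) x(2) by blast+
              then show False using b(2) by simp
            qed
            show "f ((s ^^ (n - 1)) x) = (s ^^ (n - 1)) x" if f: "f \<in> A" "{f a, f b} = {a, b}" for f
            proof -
              have "t (f x) = {a, b}" using t_A[OF f(1) leaf_two[OF x(1)]] b(1) f(2) by simp
              moreover have fx: "f x \<in> L n" using L_A[OF f(1)] x(1) by blast
              ultimately have "f x \<in> t a" using sx[of "f x" a] by blast
              then have "f x \<in> t (s x)" using ta[OF x(1,2)] by simp
              then have "s (f x) = s x" using t_down[of "Suc k" "s x" "f x"] x(1) k by simp
              then have fs: "f (s x) = s x" using s_A[OF f(1) leaf_two[OF x(1)]] by simp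
              have "f ((s ^^ k) (s x)) = (s ^^ k) (s x)"
                using top_fixed[OF f(1), of "s x" k] fs x(1) k by simp
              moreover have "n - 1 = Suc k" using k by simp
              ultimately show ?thesis by (simp add: funpow_Suc_right del: funpow.simps(2))
            qed
          qed
        next
          case notO: False
          show ?thesis
            using marked_vertex[OF disj x(1,2) s_N[OF tw[OF x(1,2)]] s_pinned[OF tw[OF x(1,2)]] notO sT[OF x(1,2)]] .
        qed
        then show thesis by (rule that(1))
      next
        case False
        then have "R2_shape" unfolding R2_shape_def using n2 disj tw ta by blast
        then show thesis by (rule that(2))
      qed
    qed
  next
    assume rg0: "rigid a0"
    have rg: "rigid a" if "a \<in> O'" for a
    proof -
      obtain x where "x \<in> L n" "a \<in> t x" using \<open>a \<in> O'\<close> unfolding O'_def by blast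
      then show ?thesis using move[of x a] rigid_A rg0 by blast
    qed
    have uniq0: "x = x'" if x: "x \<in> L n" "x' \<in> L n" "a \<in> t x" "a \<in> t x'" for x x' a
    proof -
      obtain k where k: "k \<in> A" "k a = a" "k x = x'" using common_leaf_neighbor[OF x] by metis
      have "pinned a x" using rigidD[OF rg] off(3)[OF x(1,3)] t_N[OF x(3)] N_sym by blast
      then show ?thesis using pinnedD k by metis
    qed
    have uniq: "t x = t x'" if "x \<in> L n" "x' \<in> L n" "t x \<inter> t x' \<noteq> {}" for x x'
      using uniq0 that by blast
    have x0N: "x0 \<in> N a0" using t_N[OF a0] N_sym by blast
    obtain e e' where N: "N a0 = {x0, e, e'}" "x0 \<noteq> e" "x0 \<noteq> e'" "e \<noteq> e'" using N3[OF \<open>a0 \<in> V\<close> x0N]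
      by metis
    have pin: "pinned a0 u" if "u \<in> N a0" for u using rigidD[OF rg0 that] .
    have uT: "u \<notin> T" if "u \<in> N a0" "u \<noteq> x0" for u
      using pinned_off_tree[OF x0 a0 off(1)[OF x0 a0] that(1) pin[OF that(1)] that(2)] .
    have marked: "distinguishing_number G \<le> 2" if "u \<in> N a0" "u \<noteq> x0" "u \<notin> O'" for u
      using marked_vertex[OF disj x0 a0 \<open>u \<in> N a0\<close> pin[OF \<open>u \<in> N a0\<close>] \<open>u \<notin> O'\<close> uT[OF \<open>u \<in> N a0\<close> \<open>u \<noteq> x0\<close>]] .
    show thesis
    proof (cases "e \<in> O' \<and> e' \<in> O'")
      case False
      then have "distinguishing_number G \<le> 2" using marked[of e] marked[of e'] N by auto
      then show thesis by (rule that(1))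
    next
      case True
      obtain b where b: "t x0 = {a0, b}" "a0 \<noteq> b" using t_cases'[OF leaf_two[OF x0] a0] by metis
      have bN: "x0 \<in> N b" "b \<in> V" using b(1) t_N N_sym N_V by blast+
      \<comment> \<open>Exchanging twins \<open>a0\<close> and \<open>b\<close> would fix the rigid
        vertex \<open>u\<close>, and hence its neighbor \<open>a0\<close>.\<close>
      have twin: False if tN: "N a0 - {b} = N b - {a0}" and u: "u \<in> O'" "u \<in> N a0" "u \<noteq> b" for u
      proof -
        have \<tau>: "Transposition.transpose a0 b \<in> A" using transpose_in_A[OF \<open>a0 \<in> V\<close> bN(2) tN] .
        have "u \<noteq> a0" using u(2) N_neq by blast
        then have "Transposition.transpose a0 b u = u" using u(3) by simp
        moreover have "pinned u a0" using rigidD[OF rg[OF u(1)]] u(2) N_sym by blast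
        ultimately have "Transposition.transpose a0 b a0 = a0" using pinnedD \<tau> by blast
        then show False using b(2) by simp
      qed
      \<comment> \<open>The vertex needed for \<open>leaf_pair\<close> sees \<open>a0\<close> but
        not \<open>b\<close>. If neither \<open>e\<close> nor \<open>e'\<close> qualified,
        \<open>a0\<close> and \<open>b\<close> would be twins.\<close>
      obtain p where p: "p \<in> {e, e'}" "p \<noteq> b" "b \<notin> N p"
      proof (cases "b \<in> {e, e'}")
        case bee: True
        then obtain u where u: "{e, e'} = {b, u}" "u \<noteq> b" "u \<in> {e, e'}" using N(4)
          by (metis doubleton_eq_iff insertCI insertE singletonD)
        have Na: "N a0 = {x0, b, u}" using N(1) u(1) by simp
        have "b \<notin> N u"
        proof
          assume "b \<in> N u"
          then have Nb: "N b = {x0, a0, u}"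
            using N3_eq[of x0 b a0 u] bN(1) Na N_sym N N_neq[OF x0N] u
              by (metis insertCI N_neq insertE singletonD)
          have "x0 \<noteq> a0" "u \<noteq> a0" "x0 \<noteq> b" using N_neq[of x0 a0] N_neq[of u a0] N_neq[OF bN(1)] Na
            by simp_all
          then have "N a0 - {b} = N b - {a0}" using u(2) unfolding Na Nb
            by (simp add: insert_Diff_if)
          moreover have "u \<in> O'" using True u(3) by blast
          moreover have "u \<in> N a0" unfolding Na by simp
          ultimately show False using twin u(2) by blast
        qed
        then show thesis using that u by blast
      next
        case False
        have "\<not> (b \<in> N e \<and> b \<in> N e')"
        proof
          assume "b \<in> N e \<and> b \<in> N e'"
          then have "N b = N a0" using N3_eq[of x0 b e e'] bN(1) N N_sym by metis
          then have "N a0 - {b} = N b - {a0}" using N_irrefl by blast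
          moreover have "e \<in> N a0" unfolding N(1) by simp
          ultimately show False using twin[of e] True False by blast
        qed
        then show thesis using that[of e] that[of e'] False by blast
      qed
      have pN: "p \<in> N a0" "p \<in> O'" using p(1) N(1) True by auto
      have "distinguishing_number G \<le> 2"
      proof (rule leaf_pair[OF disj uniq x0 b(1), of p])
        show "p \<in> O'" by (rule pN(2))
        show "p \<notin> {a0, b}" using p(2) pN(1) N_neq by blast
        show "a0 \<in> N p" using pN(1) N_sym by blast
        show "b \<notin> N p" by (rule p(3))
        show "f ((s ^^ (n - 1)) x0) = (s ^^ (n - 1)) x0" if f: "f \<in> A" "{f a0, f b} = {a0, b}" for f
        proof -
          have "t (f x0) = {a0, b}" using t_A[OF f(1) leaf_two[OF x0]] b(1) f(2) by simp
          then have "f x0 = x0" using uniq0[of "f x0" x0 a0] L_A[OF f(1)] x0 a0 by simp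
          then show ?thesis using top_fixed[OF f(1), of x0 "n - 1"] x0 n(1) by simp
        qed
      qed
      then show thesis by (rule that(1))
    qed
  qed
qed

theorem leaf_cases:
  obtains "distinguishing_number G \<le> 2" | "R2_shape" | "R3_shape"
proof (cases "O' \<inter> T = {}")
  case True
  then show thesis using leaf_neighbors_off_tree that by metis
next
  case False
  then obtain x a where "x \<in> L n" "a \<in> t x" "a \<in> T" unfolding O'_def by blast
  then show thesis using leaf_neighbors_in_tree that by metis
qed

end

section \<open>Trees given by levels\<close>

lemma valence_conv: "valence H x = card (neighbors H x)"
proof -
  have "out_arcs (with_proj H) x = Pair x ` neighbors H x"
    by (auto simp: out_arcs_def neighbors_def)
  then show ?thesis by (simp add: valence_def out_degree_def card_image inj_on_def)
qed

text \<open>A parent map with a level function encodes the tree so that distances from the root,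
  leaves and the absence of cycles can be read off from the levels.\<close>

locale rooted_levels =
  fixes U :: "'b set" and r :: 'b and p :: "'b \<Rightarrow> 'b" and l :: "'b \<Rightarrow> nat" and m :: nat
  assumes finite_U: "finite U"
    and root: "r \<in> U" "l r = 0"
    and parent: "\<And>x. x \<in> U \<Longrightarrow> x \<noteq> r \<Longrightarrow> p x \<in> U \<and> l x = Suc (l (p x))"
    and level_le: "\<And>x. x \<in> U \<Longrightarrow> l x \<le> m"
    and m: "m \<ge> 1"
    and children: "\<And>x. x \<in> U \<Longrightarrow> l x < m \<Longrightarrow> card {y \<in> U. y \<noteq> r \<and> p y = x} = (if x = r then 3 else 2)"
begin

definition level_tree :: "'b pair_pre_digraph" where
  "level_tree = \<lparr>pverts = U, parcs = {(x, y). x \<in> U \<and> y \<in> U \<and> (x \<noteq> r \<and> y = p x \<or> y \<noteq> r \<and> x = p y)}\<rparr>"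

lemma pverts_tree [simp]: "pverts level_tree = U"
  by (simp add: level_tree_def)

lemma parcs_tree: "(x, y) \<in> parcs level_tree \<longleftrightarrow> x \<in> U \<and> y \<in> U \<and> (x \<noteq> r \<and> y = p x \<or> y \<noteq> r \<and> x = p y)"
  by (simp add: level_tree_def)

lemma bidirected_tree: "pair_bidirected_digraph level_tree"
proof
  show "fst e \<in> pverts level_tree" "snd e \<in> pverts level_tree" if "e \<in> parcs level_tree" for e
    using that by (cases e; simp add: parcs_tree)+
  show "symmetric (with_proj level_tree)"
    unfolding symmetric_def by (auto intro!: symI simp: parcs_tree)
  show "fst e \<noteq> snd e" if "e \<in> parcs level_tree" for e
    using that parent by (cases e) (fastforce simp: parcs_tree)
qed

sublocale pair_bidirected_digraph level_tree by (rule bidirected_tree)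

lemma walk_to_root:
  assumes "x \<in> U"
  shows "\<exists>q. pre_digraph.awalk (with_proj level_tree) x q r \<and> length q = l x"
  using assms
proof (induction "l x" arbitrary: x)
  case 0
  then have "x = r" using parent by force
  then show ?case using root by (intro exI[of _ "[]"]) (simp add: awalk_def)
next
  case (Suc k)
  then have "x \<noteq> r" using root by auto
  then have px: "p x \<in> U" "l x = Suc (l (p x))" using parent Suc by auto
  obtain q where q: "awalk (p x) q r" "length q = l (p x)" using Suc(1)[of "p x"] Suc(2) px by auto
  then have "awalk x ((x, p x) # q) r"
    using Suc(3) \<open>x \<noteq> r\<close> px by (auto simp: awalk_def parcs_tree)
  then show ?case using q px by (intro exI[of _ "(x, p x) # q"]) simp
qed

lemma connected_tree: "Digraph_Component.connected (with_proj level_tree)"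
proof -
  have 1: "x \<rightarrow>\<^sup>*\<^bsub>with_proj level_tree\<^esub> r" if "x \<in> U" for x
    using walk_to_root[OF that] reachable_awalk by blast
  then have 2: "r \<rightarrow>\<^sup>*\<^bsub>with_proj level_tree\<^esub> x" if "x \<in> U" for x
    using symmetric_reachable[OF pair_sym_arcs] that by blast
  have "strongly_connected (with_proj level_tree)"
    using root(1) reachable_trans[OF 1 2] by (intro strongly_connectedI) auto
  then show ?thesis
    unfolding connected_def strongly_connected_def
      by (simp add: reachable_mk_symmetric_eq[OF pair_sym_arcs])
qed

lemma level_walk: "pcas u q v \<Longrightarrow> set q \<subseteq> parcs level_tree \<Longrightarrow> l v \<le> l u + length q"
proof (induction q arbitrary: u)
  case (Cons e q)
  have "l (snd e) \<le> Suc (l (fst e))" using Cons(3) parent by (cases e) (force simp: parcs_tree)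
  then show ?case using Cons(1)[of "snd e"] Cons(2,3) by auto
qed simp

lemma dist_root:
  assumes "x \<in> U"
  shows "graph_dist level_tree r x = l x"
  unfolding graph_dist_def
proof (rule Least_equality)
  obtain q where q: "awalk x q r" "length q = l x" using walk_to_root[OF assms] by blast
  have "length (rev_path q) = length q" for q :: "('b \<times> 'b) list" by (induction q) auto
  then show "\<exists>q. pre_digraph.awalk (with_proj level_tree) r q x \<and> length q = l x"
    using q awalk_rev_path by metis
  show "l x \<le> k" if "\<exists>q. pre_digraph.awalk (with_proj level_tree) r q x \<and> length q = k" for k
    using that level_walk root(2) by (fastforce simp: awalk_def)
qed

text \<open>On a cycle, both neighbors of a vertex of maximal level would have to be its parent.\<close>

lemma acyclic_tree: "\<not> (\<exists>q. pre_digraph.cycle (with_proj level_tree) q \<and> 3 \<le> length q)"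
proof
  assume "\<exists>q. pre_digraph.cycle (with_proj level_tree) q \<and> 3 \<le> length q"
  then obtain q u where q: "awalk u q u" "distinct (tl (pawalk_verts u q))" "3 \<le> length q"
    by (auto simp: cycle_def)
  define w where "w i = snd (q ! i)" for i
  let ?k = "length q"
  have cas: "pcas u q u" "set q \<subseteq> parcs level_tree" using q(1) by (auto simp: awalk_def)
  have "pcas u q v \<Longrightarrow> q \<noteq> [] \<Longrightarrow> tl (pawalk_verts u q) = map snd q \<and> fst (q ! 0) = u \<and> snd (last q) = v \<and>
    (\<forall>i. Suc i < length q \<longrightarrow> fst (q ! Suc i) = snd (q ! i))" for u v :: 'b and q
  proof (induction q arbitrary: u)
    case (Cons e q)
    show ?case
    proof (cases q)
      case Nil
      then show ?thesis using Cons(2) by simp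
    next
      case (Cons e' q')
      then show ?thesis using Cons.IH[of "snd e"] Cons.prems(1)
        by (auto simp: nth_Cons split: nat.splits)
    qed
  qed simp
  note walk = this[OF cas(1)]
  have ne: "q \<noteq> []" using q(3) by auto
  have step: "(w i, w (Suc i mod ?k)) \<in> parcs level_tree" if "i < ?k" for i
  proof (cases "Suc i = ?k")
    case True
    have "q ! 0 \<in> parcs level_tree" using cas(2) ne by auto
    moreover have "fst (q ! 0) = w i" using walk[OF ne] True ne
      by (metis diff_Suc_1 last_conv_nth w_def)
    ultimately show ?thesis using True by (metis mod_self prod.collapse w_def)
  next
    case False
    then have i: "Suc i < ?k" using that by simp
    have "q ! Suc i \<in> parcs level_tree" using cas(2) i by auto
    moreover have "fst (q ! Suc i) = w i" using walk[OF ne] i by (simp add: w_def)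
    ultimately show ?thesis using i by (metis mod_less prod.collapse w_def)
  qed
  have inj: "i = j" if "i < ?k" "j < ?k" "w i = w j" for i j
    using q(2) walk[OF ne] that by (simp add: w_def distinct_conv_nth) metis
  define M where "M = Max ((\<lambda>i. l (w i)) ` {..<?k})"
  have "M \<in> (\<lambda>i. l (w i)) ` {..<?k}" unfolding M_def using ne by (intro Max_in) auto
  then obtain i where i: "i < ?k" "l (w i) = M" by blast
  have le: "l (w j) \<le> l (w i)" if "j < ?k" for j unfolding i(2) M_def using that
    by (intro Max_ge) auto
  \<comment> \<open>The indices \<open>a\<close> and \<open>Suc i mod ?k\<close> are next to
    \<open>i\<close> on the cycle, and they differ because its length is at least 3.\<close>
  define a where "a = (if i = 0 then ?k - 1 else i - 1)"
  have a: "a < ?k" "Suc a mod ?k = i" using i(1) ne by (auto simp: a_def)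
  have b: "Suc i mod ?k < ?k" using ne by simp
  have pa: "w j = p (w i)" if "j < ?k" "(w i, w j) \<in> parcs level_tree" for j
    using le[OF that(1)] that(2) parent by (fastforce simp: parcs_tree)
  have "(w i, w a) \<in> parcs level_tree" using step[OF a(1)] a(2) by (auto simp: parcs_tree)
  then have "w a = w (Suc i mod ?k)" using pa[OF a(1)] pa[OF b] step[OF i(1)] by simp
  then have "a = Suc i mod ?k" using inj a(1) b by blast
  then show False using q(3) i(1) by (cases "Suc i = ?k") (auto simp: a_def split: if_splits)
qed

lemma neighbors_tree:
  assumes "x \<in> U"
  shows "neighbors level_tree x = (if x = r then {} else {p x}) \<union> {y \<in> U. y \<noteq> r \<and> p y = x}"
  by (simp add: set_eq_iff neighbors_def parcs_tree) (use assms parent in blast)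

lemma valence_tree:
  assumes "x \<in> U"
  shows "valence level_tree x = (if l x = m then 1 else 3)"
proof (cases "l x = m")
  case True
  have "{y \<in> U. y \<noteq> r \<and> p y = x} = {}" using True level_le parent by fastforce
  moreover have "x \<noteq> r" using True root m by auto
  ultimately have "neighbors level_tree x = {p x}"
    by (simp only: neighbors_tree[OF assms] if_False Un_empty_right)
  then show ?thesis using True by (simp add: valence_conv)
next
  case False
  then have c: "card {y \<in> U. y \<noteq> r \<and> p y = x} = (if x = r then 3 else 2)"
    using children level_le assms by (simp add: order_less_le)
  have "p x \<notin> {y \<in> U. y \<noteq> r \<and> p y = x}" if "x \<noteq> r"
    using parent[OF assms that] parent[of "p x"] by auto
  then show ?thesis using False c finite_U by (auto simp: valence_conv neighbors_tree[OF assms])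
qed

lemma leaf_tree: "leaf level_tree x \<longleftrightarrow> x \<in> U \<and> l x = m"
  by (cases "x \<in> U") (simp_all add: leaf_def valence_tree)

lemma is_T_tree: "is_T m level_tree"
proof -
  have "\<forall>v. leaf level_tree v \<longrightarrow> graph_dist level_tree r v = m" using leaf_tree dist_root by simp
  then have "\<exists>r\<in>pverts level_tree. \<forall>v. leaf level_tree v \<longrightarrow> graph_dist level_tree r v = m"
    using root(1) by auto
  moreover have "\<forall>v\<in>pverts level_tree. valence level_tree v = 1 \<or> valence level_tree v = 3"
    using valence_tree by simp
  ultimately show ?thesis
    unfolding is_T_def undirected_tree_def
      using finite_U bidirected_tree connected_tree acyclic_tree by simp
qed

lemma leaf_not_root: "leaf level_tree x \<Longrightarrow> x \<noteq> r"
  using leaf_tree root m by auto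

lemma leaf_parent:
  assumes "leaf level_tree x"
  shows "(x, w) \<in> parcs level_tree \<longleftrightarrow> w = p x"
proof -
  have x: "x \<in> U" "l x = m" "x \<noteq> r" using assms leaf_tree leaf_not_root by auto
  have "\<not> (w \<in> U \<and> w \<noteq> r \<and> x = p w)" using parent level_le x(2) by fastforce
  then show ?thesis using x parent by (auto simp: parcs_tree)
qed

end

text \<open>Surjectivity need not be checked: by \<open>cover\<close> the image is closed under
  neighbors, hence everything. The isomorphism required runs from \<open>G\<close> to
  \<open>H\<close>, so it is the inverse of \<open>\<phi>\<close>.\<close>

lemma (in connected_cubic_graph) digraph_isoI:
  assumes ne: "pverts H \<noteq> {}" and wf: "\<And>h k. (h, k) \<in> parcs H \<Longrightarrow> h \<in> pverts H \<and> k \<in> pverts H"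
    and \<phi>: "inj_on \<phi> (pverts H)" "\<And>h. h \<in> pverts H \<Longrightarrow> \<phi> h \<in> V"
    and arc: "\<And>h k. (h, k) \<in> parcs H \<Longrightarrow> \<phi> k \<in> N (\<phi> h)"
    and cover: "\<And>h x. h \<in> pverts H \<Longrightarrow> x \<in> N (\<phi> h) \<Longrightarrow> \<exists>k. (h, k) \<in> parcs H \<and> \<phi> k = x"
  shows "digraph_iso (with_proj G) (with_proj H)"
proof -
  interpret pair_bidirected_digraph G by (rule bidirected)
  have V: "\<phi> ` pverts H = V"
  proof (rule closed_eq_V)
    show "N x \<subseteq> \<phi> ` pverts H" if x: "x \<in> \<phi> ` pverts H" for x
    proof
      fix y assume y: "y \<in> N x"
      obtain h where h: "h \<in> pverts H" "x = \<phi> h" using x by blast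
      obtain k where "(h, k) \<in> parcs H" "\<phi> k = y" using cover[OF h(1)] y h(2) by blast
      then show "y \<in> \<phi> ` pverts H" using wf by blast
    qed
  qed (use ne \<phi>(2) in auto)
  define \<psi> where "\<psi> = inv_into (pverts H) \<phi>"
  have \<psi>1: "\<psi> (\<phi> h) = h" if "h \<in> pverts H" for h using \<phi>(1) that by (simp add: \<psi>_def)
  have \<psi>2: "\<psi> x \<in> pverts H" "\<phi> (\<psi> x) = x" if "x \<in> V" for x
    using that V by (simp_all add: \<psi>_def inv_into_into f_inv_into_f)
  have arcs: "map_prod \<psi> \<psi> ` parcs G = parcs H"
  proof (intro set_eqI iffI)
    fix e assume "e \<in> map_prod \<psi> \<psi> ` parcs G"
    then obtain x y where e: "(x, y) \<in> parcs G" "e = (\<psi> x, \<psi> y)" by auto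
    then have xy: "y \<in> N x" "x \<in> V" using N_iff N_V by metis+
    obtain k where k: "(\<psi> x, k) \<in> parcs H" "\<phi> k = y" using cover[of "\<psi> x" y] \<psi>2 xy by auto
    then have "\<psi> y = k" using \<psi>1 wf by blast
    then show "e \<in> parcs H" using k(1) e(2) by simp
  next
    fix e assume e: "e \<in> parcs H"
    obtain h k where hk: "e = (h, k)" by (cases e)
    have "(\<phi> h, \<phi> k) \<in> parcs G" using arc e hk N_iff by blast
    moreover have "e = map_prod \<psi> \<psi> (\<phi> h, \<phi> k)" using wf[of h k] e hk \<psi>1 by simp
    ultimately show "e \<in> map_prod \<psi> \<psi> ` parcs G" by blast
  qed
  have inj: "inj_on \<psi> V" using \<psi>2(2) by (metis inj_onI)
  let ?f = "\<lparr>iso_verts = \<psi>, iso_arcs = map_prod \<psi> \<psi>, iso_head = snd, iso_tail = fst\<rparr>"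
  have "inj_on (map_prod \<psi> \<psi>) (parcs G)"
    by (rule inj_on_subset[OF map_prod_inj_on[OF inj inj]]) (auto dest: in_arcsD1 in_arcsD2)
  then have "digraph_isomorphism ?f"
    using inj unfolding digraph_isomorphism_def by (simp add: wf_digraph)
  moreover have "\<psi> ` V = pverts H" using V \<psi>1 \<psi>2(1) by force
  then have "with_proj H = app_iso ?f (with_proj G)"
    unfolding app_iso_def by (simp add: with_proj_def arcs)
  ultimately show ?thesis unfolding digraph_iso_def by blast
qed

section \<open>The levels of \<open>G\<close> as a tree on natural numbers\<close>

context leaf_level
begin

definition level :: "'a \<Rightarrow> nat" where
  "level x = (LEAST j. x \<in> L j)"

lemma level_eq: "x \<in> L j \<Longrightarrow> level x = j"
  unfolding level_def by (metis LeastI L_unique)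

lemma finite_L: "finite (L j)"
proof (induction j)
  case (Suc j)
  have "L (Suc j) \<subseteq> (\<Union>q\<in>L j. N q)" using s_N N_sym by fastforce
  then show ?case using Suc finite_N by (meson finite_UN_I finite_subset)
qed simp

lemma children_L:
  assumes "x \<in> L j" "j < n"
  shows "{y. two y \<and> s y = x} = (if x = r then N r else t x)"
proof (cases "j = 0")
  case True
  then have "x = r" using assms(1) by simp
  then show ?thesis using L1 by (auto simp: set_eq_iff)
next
  case False
  then have j: "1 \<le> j" "x \<noteq> r" using assms(1) not_two_r L_unique[of r j 0] by auto
  obtain k where k: "j = Suc k" using False by (cases j) auto
  have "y \<in> t x" if y: "two y" "s y = x" for y
    using L_t[of y k] y assms(1) unfolding k by simp
  moreover have "two y \<and> s y = x" if "y \<in> t x" for y using t_down[OF j(1) assms(2,1) that] by simp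
  ultimately show ?thesis using j(2) by auto
qed

text \<open>The levels up to \<open>m\<close> span a copy of the tree of depth \<open>m\<close>, with \<open>s\<close> as the parent map.\<close>

lemma tree_copy:
  fixes h :: "'a \<Rightarrow> nat"
  assumes m: "1 \<le> m" "m \<le> n" and h: "inj_on h T"
  obtains T' where "is_T m T'" "pverts T' = h ` (\<Union>j\<le>m. L j)"
    and "\<And>i k. (i, k) \<in> parcs T' \<longleftrightarrow> (\<exists>x y. i = h x \<and> k = h y \<and> x \<in> (\<Union>j\<le>m. L j) \<and> y \<in> (\<Union>j\<le>m. L j) \<and>
      (x \<noteq> r \<and> y = s x \<or> y \<noteq> r \<and> x = s y))"
    and "leaf_pairs T' = {(h u, h v) | u v. u \<in> L m \<and> v \<in> L m \<and> s u = s v \<and> h u < h v}"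
proof -
  define U where "U = (\<Union>j\<le>m. L j)"
  have UI: "x \<in> L j \<Longrightarrow> j \<le> m \<Longrightarrow> x \<in> U" for x j unfolding U_def by blast
  have UE: "\<exists>j\<le>m. x \<in> L j" if "x \<in> U" for x using that unfolding U_def by blast
  define g where "g = inv_into T h"
  have UT: "U \<subseteq> T" using m(2) unfolding T_def U_def by (intro UN_mono) auto
  have gh: "g (h x) = x" if "x \<in> U" for x using that UT h by (auto simp: g_def)
  have heq: "h x = h y \<longleftrightarrow> x = y" if "x \<in> U" "y \<in> U" for x y using gh that by metis
  have Us: "two x \<and> s x \<in> U \<and> level x = Suc (level (s x))" if x: "x \<in> U" "x \<noteq> r" for x
  proof -
    obtain j where j: "j \<le> m" "x \<in> L j" using UE x(1) by blast
    then obtain k where k: "j = Suc k" using x(2) by (cases j) auto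
    then have "two x" "s x \<in> L k" using j by auto
    then show ?thesis using j(1) level_eq[OF j(2)] level_eq[of "s x" k] k UI[of "s x" k] by simp
  qed
  have rU: "r \<in> U" using UI[of r 0] by simp
  have lU: "level x \<le> m \<and> x \<in> L (level x)" if "x \<in> U" for x using UE[OF that] level_eq by blast
  interpret RL: rooted_levels "h ` U" "h r" "\<lambda>i. h (s (g i))" "\<lambda>i. level (g i)" m
  proof
    show "finite (h ` U)" using finite_L by (simp add: U_def)
    show "h r \<in> h ` U" using rU by blast
    show "level (g (h r)) = 0" using gh[OF rU] level_eq[of r 0] by simp
    show "1 \<le> m" by (rule m(1))
    show "h (s (g i)) \<in> h ` U \<and> level (g i) = Suc (level (g (h (s (g i)))))"
      if i: "i \<in> h ` U" "i \<noteq> h r" for i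
    proof -
      obtain x where x: "x \<in> U" "i = h x" using i(1) by blast
      then have "two x \<and> s x \<in> U \<and> level x = Suc (level (s x))" using Us i(2) by blast
      then show ?thesis using x gh by (metis imageI)
    qed
    show "level (g i) \<le> m" if i: "i \<in> h ` U" for i
    proof -
      obtain x where x: "x \<in> U" "i = h x" using i by blast
      then show ?thesis using gh lU by simp
    qed
    show "card {k \<in> h ` U. k \<noteq> h r \<and> h (s (g k)) = i} = (if i = h r then 3 else 2)"
      if i: "i \<in> h ` U" "level (g i) < m" for i
    proof -
      obtain x where x: "x \<in> U" "i = h x" using i(1) by blast
      have lx: "x \<in> L (level x)" "level x < m" using lU[OF x(1)] i(2) gh[OF x(1)] x(2) by auto
      have "{k \<in> h ` U. k \<noteq> h r \<and> h (s (g k)) = i} = h ` {y \<in> U. h y \<noteq> h r \<and> h (s (g (h y))) = i}"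
        by (rule Compr_image_eq)
      also have "{y \<in> U. h y \<noteq> h r \<and> h (s (g (h y))) = i} = {y \<in> U. y \<noteq> r \<and> s y = x}"
      proof -
        have "(h y \<noteq> h r \<and> h (s (g (h y))) = i) \<longleftrightarrow> (y \<noteq> r \<and> s y = x)" if "y \<in> U" for y
          using gh[OF that] heq[OF that rU] heq[of "s y" x] Us[OF that] x by auto
        then show ?thesis by (intro Collect_cong) metis
      qed
      also have "{y \<in> U. y \<noteq> r \<and> s y = x} = {y. two y \<and> s y = x}"
      proof (intro set_eqI iffI)
        fix y assume "y \<in> {y. two y \<and> s y = x}"
        then have "two y" "s y = x" by auto
        then have "y \<in> L (Suc (level x))" "y \<noteq> r" using lx(1) not_two_r by auto
        then show "y \<in> {y \<in> U. y \<noteq> r \<and> s y = x}" using lx(2) \<open>s y = x\<close> UI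
          by (simp add: Suc_le_eq del: L.simps)
      qed (use Us in auto)
      finally have eq: "{k \<in> h ` U. k \<noteq> h r \<and> h (s (g k)) = i} = h ` {y. two y \<and> s y = x}" .
      have sub: "{y. two y \<and> s y = x} \<subseteq> U"
      proof
        fix y assume "y \<in> {y. two y \<and> s y = x}"
        then have "y \<in> L (Suc (level x))" using lx(1) by simp
        then show "y \<in> U" using lx(2) UI by (simp add: Suc_le_eq del: L.simps)
      qed
      have "card (h ` {y. two y \<and> s y = x}) = card {y. two y \<and> s y = x}"
        by (intro card_image inj_on_subset[OF h]) (use sub UT in blast)
      also have "\<dots> = (if x = r then 3 else 2)"
      proof (cases "x = r")
        case True
        then show ?thesis using children_L[OF lx(1)] lx(2) m(2) card_N rV by simp
      next
        case False
        then have "two x" using Us x by blast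
        then show ?thesis using False children_L[OF lx(1)] lx(2) m(2) t_cases[of x]
          by (metis card_2_iff le_trans less_le_trans)
      qed
      finally show ?thesis unfolding eq using heq[OF x(1) rU] x(2) by simp
    qed
  qed
  have leaf: "leaf RL.level_tree i \<longleftrightarrow> (\<exists>x\<in>L m. i = h x)" for i
    unfolding RL.leaf_tree using gh lU level_eq UI[of _ m] by (metis image_iff order_refl)
  show thesis
  proof (rule that[folded U_def])
    show "is_T m RL.level_tree" by (rule RL.is_T_tree)
    show "pverts RL.level_tree = h ` U" by simp
    show "(i, k) \<in> parcs RL.level_tree \<longleftrightarrow> (\<exists>x y. i = h x \<and> k = h y \<and> x \<in> U \<and> y \<in> U \<and>
      (x \<noteq> r \<and> y = s x \<or> y \<noteq> r \<and> x = s y))" (is "_ \<longleftrightarrow> ?R") for i k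
    proof
      assume "(i, k) \<in> parcs RL.level_tree"
      then have ik: "i \<in> h ` U" "k \<in> h ` U" "i \<noteq> h r \<and> k = h (s (g i)) \<or> k \<noteq> h r \<and> i = h (s (g k))"
        unfolding RL.parcs_tree by blast+
      then obtain x y where xy: "x \<in> U" "y \<in> U" "i = h x" "k = h y" by blast
      then have "x \<noteq> r \<and> y = s x \<or> y \<noteq> r \<and> x = s y" using ik(3) gh heq Us rU by metis
      then show ?R using xy by blast
    next
      assume ?R
      then obtain x y
        where xy: "x \<in> U" "y \<in> U" "i = h x" "k = h y" "x \<noteq> r \<and> y = s x \<or> y \<noteq> r \<and> x = s y" by blast
      then show "(i, k) \<in> parcs RL.level_tree" unfolding RL.parcs_tree using gh heq rU
        by (metis imageI)
    qed
    show "leaf_pairs RL.level_tree = {(h u, h v) | u v. u \<in> L m \<and> v \<in> L m \<and> s u = s v \<and> h u < h v}" (is "_ = ?S")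
    proof (intro set_eqI iffI)
      fix e assume "e \<in> leaf_pairs RL.level_tree"
      then obtain i k w where e: "e = (i, k)" "i < k" "leaf RL.level_tree i" "leaf RL.level_tree k"
        "(i, w) \<in> parcs RL.level_tree" "(k, w) \<in> parcs RL.level_tree"
        unfolding leaf_pairs_def by blast
      obtain u v where uv: "u \<in> L m" "v \<in> L m" "i = h u" "k = h v" using e(3,4) leaf by blast
      have U': "u \<in> U" "v \<in> U" "u \<noteq> r" "v \<noteq> r" using uv m(1) L_unique[of r m 0] UI[of _ m] by auto
      have "h (s (g i)) = h (s (g k))" using e RL.leaf_parent by metis
      then have "s u = s v" using gh heq Us U' uv by simp
      then show "e \<in> ?S" using uv e(1,2) by blast
    next
      fix e assume "e \<in> ?S"
      then obtain u v where uv: "e = (h u, h v)" "u \<in> L m" "v \<in> L m" "s u = s v" "h u < h v"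
        by blast
      have U': "u \<in> U" "v \<in> U" "u \<noteq> r" "v \<noteq> r" using uv m(1) L_unique[of r m 0] UI[of _ m] by auto
      have lf: "leaf RL.level_tree (h u)" "leaf RL.level_tree (h v)" using leaf uv by blast+
      have "(h u, h (s u)) \<in> parcs RL.level_tree" "(h v, h (s u)) \<in> parcs RL.level_tree"
        using RL.leaf_parent[OF lf(1)] RL.leaf_parent[OF lf(2)] gh U' uv(4) by auto
      then show "e \<in> leaf_pairs RL.level_tree"
        unfolding leaf_pairs_def using lf uv Us U' by auto
    qed
  qed
qed

end

section \<open>The exceptional graphs\<close>

lemma verts_R2: "a \<in> pverts (R2 T) \<longleftrightarrow> (\<exists>i\<in>pverts T. a = Old i) \<or> (\<exists>e\<in>leaf_pairs T. a = X e \<or> a = Y e)"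
  unfolding R2_def by auto

lemma verts_R3: "a \<in> pverts (R3 T) \<longleftrightarrow> (\<exists>i\<in>pverts T. a = Old i) \<or>
    (\<exists>e\<in>leaf_pairs T. a = X e \<or> a = Y e \<or> a = Z e \<or> a = W e)"
  unfolding R3_def by auto

definition R2_gadget :: "'a \<times> 'a \<Rightarrow> ('a rvertex \<times> 'a rvertex) set" where
  "R2_gadget e = {(Old (fst e), X e), (X e, Old (snd e)), (Old (snd e), Y e), (Y e, Old (fst e)), (X e, Y e)}"

definition R3_gadget :: "'a \<times> 'a \<Rightarrow> ('a rvertex \<times> 'a rvertex) set" where
  "R3_gadget e = {(Old (fst e), X e), (X e, Z e), (Z e, Old (snd e)), (Old (snd e), Y e), (Y e, W e),
     (W e, Old (fst e)), (X e, Y e), (Z e, W e)}"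

lemma arcs_R2: "(a, b) \<in> parcs (R2 T) \<longleftrightarrow> (\<exists>i j. (i, j) \<in> parcs T \<and> a = Old i \<and> b = Old j) \<or>
    (\<exists>e\<in>leaf_pairs T. (a, b) \<in> R2_gadget e \<or> (b, a) \<in> R2_gadget e)"
proof -
  have "(\<Union>(u, v) \<in> leaf_pairs T.
         let x = X (u, v); y = Y (u, v)
         in {(Old u, x), (x, Old v), (Old v, y), (y, Old u), (x, y)}) = (\<Union>e\<in>leaf_pairs T. R2_gadget e)"
    by (intro SUP_cong refl) (auto simp: R2_gadget_def Let_def)
  then have "parcs (R2 T) = map_prod Old Old ` parcs T \<union> undirected (\<Union>e\<in>leaf_pairs T. R2_gadget e)"
    unfolding R2_def by simp
  then show ?thesis unfolding undirected_def by auto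
qed

lemma arcs_R3: "(a, b) \<in> parcs (R3 T) \<longleftrightarrow> (\<exists>i j. (i, j) \<in> parcs T \<and> a = Old i \<and> b = Old j) \<or>
    (\<exists>e\<in>leaf_pairs T. (a, b) \<in> R3_gadget e \<or> (b, a) \<in> R3_gadget e)"
proof -
  have "(\<Union>(u, v) \<in> leaf_pairs T.
         let x = X (u, v); y = Y (u, v); z = Z (u, v); w = W (u, v)
         in {(Old u, x), (x, z), (z, Old v), (Old v, y), (y, w), (w, Old u), (x, y), (z, w)}) =
       (\<Union>e\<in>leaf_pairs T. R3_gadget e)"
    by (intro SUP_cong refl) (auto simp: R3_gadget_def Let_def)
  then have "parcs (R3 T) = map_prod Old Old ` parcs T \<union> undirected (\<Union>e\<in>leaf_pairs T. R3_gadget e)"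
    unfolding R3_def by simp
  then show ?thesis unfolding undirected_def by auto
qed

context leaf_level
begin

lemma siblings_t:
  assumes "2 \<le> m" "m \<le> n" "u \<in> L m" "v \<in> L m" "u \<noteq> v" "s u = s v"
  shows "t (s u) = {u, v}"
proof -
  obtain k where k: "m = Suc (Suc k)" using assms(1) by (metis add_2_eq_Suc le_Suc_ex)
  obtain u' where u': "t (s u) = {u, u'}" using sibling[of u k] assms(2,3) unfolding k by metis
  have "v \<in> t (s u)" using L_t[of v k] assms(4,6) unfolding k by simp
  then show ?thesis using assms(5) unfolding u' by simp
qed

lemma sibling_ex:
  assumes "2 \<le> m" "m \<le> n" "u \<in> L m"
  obtains v where "v \<in> L m" "u \<noteq> v" "s u = s v"
proof -
  obtain k where k: "m = Suc (Suc k)" using assms(1) by (metis add_2_eq_Suc le_Suc_ex)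
  show thesis using sibling[of u k] assms(2,3) that unfolding k by metis
qed

lemma inner_N:
  assumes "x \<in> L j" "j < m" "m \<le> n" "y \<in> N x"
  shows "y \<in> (\<Union>j\<le>m. L j) \<and> (x \<noteq> r \<and> y = s x \<or> y \<noteq> r \<and> x = s y)"
proof (cases "x \<noteq> r \<and> y = s x")
  case True
  then obtain k where k: "j = Suc k" using assms(1) by (cases j) auto
  then have "y \<in> L k" using assms(1) True by simp
  then show ?thesis using True assms(2) k by (auto simp del: L.simps)
next
  case False
  have "y \<in> (if x = r then N r else t x)" using False assms(4) t_iff by auto
  then have "two y \<and> s y = x" using children_L[OF assms(1)] assms(2,3) by (auto simp: set_eq_iff)
  then have "y \<in> L (Suc j)" "y \<noteq> r" "x = s y" using assms(1) not_two_r by auto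
  then show ?thesis using assms(2) by (auto simp: Suc_le_eq simp del: L.simps)
qed

lemma tree_arc_N:
  assumes "x \<in> T" "y \<in> T" "x \<noteq> r \<and> y = s x \<or> y \<noteq> r \<and> x = s y"
  shows "y \<in> N x"
  using assms s_T s_N N_sym by blast

text \<open>Sibling leaves have the same two lower neighbors. These become \<open>X e\<close> and
  \<open>Y e\<close>, and each of them is the fixed neighbor of the other.\<close>

lemma isomorphic_R2:
  assumes R2_shape
  shows "isomorphic_to_R2 G n"
proof -
  have n2: "2 \<le> n" and disj: "O' \<inter> T = {}"
    and sh: "\<And>x a. x \<in> L n \<Longrightarrow> a \<in> t x \<Longrightarrow> two a \<and> t a = t (s x) \<and> s a \<in> t x"
    using assms unfolding R2_shape_def by blast+
  have "finite T" unfolding T_def using finite_L by simp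
  then obtain h :: "'a \<Rightarrow> nat" where h: "inj_on h T" using finite_imp_inj_to_nat_seg by metis
  obtain T' where T': "is_T n T'" "pverts T' = h ` T"
    "\<And>i k. (i, k) \<in> parcs T' \<longleftrightarrow> (\<exists>x y. i = h x \<and> k = h y \<and> x \<in> T \<and> y \<in> T \<and> (x \<noteq> r \<and> y = s x \<or> y \<noteq> r \<and> x = s y))"
    "leaf_pairs T' = {(h u, h v) | u v. u \<in> L n \<and> v \<in> L n \<and> s u = s v \<and> h u < h v}"
  proof (rule tree_copy[OF n(1) order_refl h, folded T_def], goal_cases)
    case (1 T')
    show ?case by (rule 1(1)[OF 1(2,3) 1(4) 1(5)])
  qed
  define g where "g = inv_into T h"
  have gh: "g (h x) = x" if "x \<in> T" for x using that h by (auto simp: g_def)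
  have LT: "x \<in> T" if "x \<in> L n" for x using T_I that by blast
  have "\<forall>x. \<exists>a b. two x \<longrightarrow> t x = {a, b} \<and> a \<noteq> b" using t_cases by metis
  then obtain \<alpha> \<beta> where "\<forall>x. two x \<longrightarrow> t x = {\<alpha> x, \<beta> x} \<and> \<alpha> x \<noteq> \<beta> x" by metis
  then have t: "t x = {\<alpha> x, \<beta> x}" "\<alpha> x \<noteq> \<beta> x" if "x \<in> L n" for x using leaf_two[OF that] by auto
  have t': "\<alpha> x \<in> t x" "\<beta> x \<in> t x" if "x \<in> L n" for x using t[OF that] by auto
  define pr where "pr u v \<longleftrightarrow> u \<in> L n \<and> v \<in> L n \<and> s u = s v \<and> h u < h v" for u v
  have prL: "u \<in> L n" "v \<in> L n" "s u = s v" "u \<noteq> v" if "pr u v" for u v using that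
    by (auto simp: pr_def)
  have prt: "t (s u) = {u, v}" if "pr u v" for u v using siblings_t[OF n2 order_refl] prL[OF that]
    by blast
  have off: "a \<notin> T" if "x \<in> L n" "a \<in> t x" for x a using that disj unfolding O'_def by blast
  have ta: "t a = {u, v}" "N a = {s a, u, v}" if "pr u v" "a \<in> t u" for u v a
    using sh[OF prL(1)[OF that(1)] that(2)] prt[OF that(1)] N_two[of a] by auto
  have tv: "t v = t u" if p: "pr u v" for u v
  proof -
    have "a \<in> t v" if a: "a \<in> t u" for a
    proof -
      have "a \<in> N v" using ta(2)[OF p a] N_sym by blast
      then show ?thesis using T_leaf[OF LT[OF prL(2)[OF p]]] off[OF prL(1)[OF p] a] by blast
    qed
    then have "\<alpha> u \<in> t v" "\<beta> u \<in> t v" using t'[OF prL(1)[OF p]] by blast+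
    then have "\<alpha> u = \<alpha> v \<or> \<alpha> u = \<beta> v" "\<beta> u = \<alpha> v \<or> \<beta> u = \<beta> v" unfolding t(1)[OF prL(2)[OF p]]
      by simp_all
    then show ?thesis unfolding t(1)[OF prL(1)[OF p]] t(1)[OF prL(2)[OF p]]
      using t(2)[OF prL(1)[OF p]] by auto
  qed
  have N\<alpha>: "N (\<alpha> u) = {\<beta> u, u, v}" "N (\<beta> u) = {\<alpha> u, u, v}" if p: "pr u v" for u v
  proof -
    have "s (\<alpha> u) \<in> t u" "s (\<beta> u) \<in> t u" "two (\<alpha> u)" "two (\<beta> u)"
      using sh[OF prL(1)[OF p]] t'[OF prL(1)[OF p]] by blast+
    moreover have "s (\<alpha> u) \<noteq> \<alpha> u" "s (\<beta> u) \<noteq> \<beta> u" using calculation s_N N_neq by blast+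
    ultimately have "s (\<alpha> u) = \<beta> u" "s (\<beta> u) = \<alpha> u" using t[OF prL(1)[OF p]] by auto
    then show "N (\<alpha> u) = {\<beta> u, u, v}" "N (\<beta> u) = {\<alpha> u, u, v}" using ta(2)[OF p] t'[OF prL(1)[OF p]]
      by auto
  qed
  have same: "u = u' \<and> v = v'" if p: "pr u v" "pr u' v'" and a: "a \<in> t u" "a \<in> t u'" for u v u' v' a
  proof -
    have "{u, v} = {u', v'}" using ta(1) p a by metis
    then show ?thesis using p by (auto simp: doubleton_eq_iff pr_def)
  qed
  \<comment> \<open>The first member of the leaf pair determines both images, because siblings have
    the same lower neighbors; vertices \<open>Z\<close> and \<open>W\<close> do not occur in
    \<open>R2 T'\<close>.\<close>
  define \<phi>
    where "\<phi> a = (case a of Old i \<Rightarrow> g i | X e \<Rightarrow> \<alpha> (g (fst e)) | Y e \<Rightarrow> \<beta> (g (fst e)) | _ \<Rightarrow> r)" for a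
  have \<phi>: "x \<in> T \<Longrightarrow> \<phi> (Old (h x)) = x" "pr u v \<Longrightarrow> \<phi> (X (h u, h v)) = \<alpha> u" "pr u v \<Longrightarrow> \<phi> (Y (h u, h v)) = \<beta> u" for x u v
    using gh LT prL by (simp_all add: \<phi>_def)
  have lp: "e \<in> leaf_pairs T' \<longleftrightarrow> (\<exists>u v. e = (h u, h v) \<and> pr u v)" for e
    unfolding T'(4) pr_def by blast
  have verts: "a \<in> pverts (R2 T') \<longleftrightarrow> (\<exists>x\<in>T. a = Old (h x)) \<or> (\<exists>u v. pr u v \<and> (a = X (h u, h v) \<or> a = Y (h u, h v)))" for a
    unfolding verts_R2 T'(2) Bex_def lp by blast
  define B where B: "B u v = R2_gadget (h u, h v)" for u v
  have arcs: "(a, b) \<in> parcs (R2 T') \<longleftrightarrow> (\<exists>x y. a = Old (h x) \<and> b = Old (h y) \<and> x \<in> T \<and> y \<in> T \<and> (x \<noteq> r \<and> y = s x \<or> y \<noteq> r \<and> x = s y)) \<or>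
    (\<exists>u v. pr u v \<and> ((a, b) \<in> B u v \<or> (b, a) \<in> B u v))" for a b
    unfolding arcs_R2 T'(3) Bex_def lp B by blast
  have B_def: "B u v = {(Old (h u), X (h u, h v)), (X (h u, h v), Old (h v)), (Old (h v), Y (h u, h v)),
      (Y (h u, h v), Old (h u)), (X (h u, h v), Y (h u, h v))}" for u v
    by (simp add: B R2_gadget_def)
  have "digraph_iso (with_proj G) (with_proj (R2 T'))"
  proof (rule digraph_isoI[where \<phi> = \<phi>])
    show "pverts (R2 T') \<noteq> {}" using verts r_T by blast
    have B: "a \<in> pverts (R2 T') \<and> b \<in> pverts (R2 T') \<and> \<phi> b \<in> N (\<phi> a)"
      if p: "pr u v" and ab: "(a, b) \<in> B u v" for u v a b
    proof -
      have uv: "u \<in> T" "v \<in> T" using prL[OF p] LT by blast+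
      have "\<alpha> u \<in> N u" "\<beta> u \<in> N u" using t'[OF prL(1)[OF p]] t_N by blast+
      moreover have "v \<in> N (\<alpha> u)" "\<beta> u \<in> N (\<alpha> u)" "u \<in> N (\<beta> u)" "\<beta> u \<in> N v"
        using N\<alpha>[OF p] N_sym[of "\<beta> u" v] by auto
      ultimately show ?thesis
        using ab uv p \<phi>(1)[OF uv(1)] \<phi>(1)[OF uv(2)] \<phi>(2,3)[OF p] verts unfolding B_def by auto
    qed
    show "a \<in> pverts (R2 T') \<and> b \<in> pverts (R2 T')" if "(a, b) \<in> parcs (R2 T')" for a b
      using that B verts unfolding arcs by blast
    show "\<phi> b \<in> N (\<phi> a)" if "(a, b) \<in> parcs (R2 T')" for a b
      using that unfolding arcs
    proof (elim disjE exE conjE)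
      fix x y assume "a = Old (h x)" "b = Old (h y)" "x \<in> T" "y \<in> T" "x \<noteq> r" "y = s x"
      then show ?thesis using tree_arc_N[of x y] \<phi>(1) by simp
    next
      fix x y assume "a = Old (h x)" "b = Old (h y)" "x \<in> T" "y \<in> T" "y \<noteq> r" "x = s y"
      then show ?thesis using tree_arc_N[of x y] \<phi>(1) by simp
    qed (use B N_sym in blast)+
    show "\<phi> a \<in> V" if "a \<in> pverts (R2 T')" for a
      using that unfolding verts
    proof (elim disjE bexE exE conjE)
      fix x assume "x \<in> T" "a = Old (h x)"
      then show ?thesis using \<phi>(1) L_V unfolding T_def by auto
    next
      fix u v assume "pr u v" "a = X (h u, h v)"
      then show ?thesis using \<phi>(2) t'(1) prL(1) t_N N_V by metis
    next
      fix u v assume "pr u v" "a = Y (h u, h v)"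
      then show ?thesis using \<phi>(3) t'(2) prL(1) t_N N_V by metis
    qed
    show "inj_on \<phi> (pverts (R2 T'))"
    proof (rule inj_onI)
      fix a b assume ab: "a \<in> pverts (R2 T')" "b \<in> pverts (R2 T')" and eq: "\<phi> a = \<phi> b"
      have notT: "\<alpha> u \<notin> T \<and> \<beta> u \<notin> T" if "pr u v" for u v using off t' prL(1)[OF that] by blast
      have new: "a = b" if p: "pr u v" "a = X (h u, h v) \<or> a = Y (h u, h v)"
          and q: "pr u' v'" "b = X (h u', h v') \<or> b = Y (h u', h v')" for u v u' v'
      proof -
        have "\<phi> a \<in> t u" "\<phi> b \<in> t u'" using p q \<phi>(2,3) t' prL(1) by metis+
        then have "u = u' \<and> v = v'" using same p(1) q(1) eq by metis
        then show ?thesis using p q eq \<phi>(2,3) t(2)[OF prL(1)[OF p(1)]] by metis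
      qed
      show "a = b" using ab unfolding verts
      proof (elim disjE bexE)
        fix x y assume "x \<in> T" "a = Old (h x)" "y \<in> T" "b = Old (h y)"
        then show ?thesis using \<phi>(1) eq by metis
      next
        fix x assume "x \<in> T" "a = Old (h x)" "\<exists>u v. pr u v \<and> (b = X (h u, h v) \<or> b = Y (h u, h v))"
        then show ?thesis using \<phi> eq notT by metis
      next
        fix x assume "x \<in> T" "b = Old (h x)" "\<exists>u v. pr u v \<and> (a = X (h u, h v) \<or> a = Y (h u, h v))"
        then show ?thesis using \<phi> eq notT by metis
      next
        assume "\<exists>u v. pr u v \<and> (a = X (h u, h v) \<or> a = Y (h u, h v))"
          "\<exists>u v. pr u v \<and> (b = X (h u, h v) \<or> b = Y (h u, h v))"
        then show ?thesis using new by metis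
      qed
    qed
    show "\<exists>k. (a, k) \<in> parcs (R2 T') \<and> \<phi> k = y"
      if a: "a \<in> pverts (R2 T')" and y: "y \<in> N (\<phi> a)" for a y
      using a unfolding verts
    proof (elim disjE bexE exE conjE)
      fix x assume x: "x \<in> T" "a = Old (h x)"
      then have yx: "y \<in> N x" using y \<phi>(1) by simp
      have old: ?thesis if "y \<in> T \<and> (x \<noteq> r \<and> y = s x \<or> y \<noteq> r \<and> x = s y)"
        using that x \<phi>(1) arcs by (intro exI[of _ "Old (h y)"]) blast
      obtain j where j: "j \<le> n" "x \<in> L j" using x(1) unfolding T_def by blast
      show ?thesis
      proof (cases "j < n")
        case True
        then show ?thesis using old inner_N[OF j(2) _ order_refl yx] unfolding T_def by blast
      next
        case False
        then have xn: "x \<in> L n" using j by simp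
        show ?thesis
        proof (cases "y = s x")
          case True
          then show ?thesis using old s_T[OF x(1)] leaf_neq_root[OF xn] by blast
        next
          case False
          then have yt: "y \<in> t x" using yx t_iff by blast
          obtain v where v: "v \<in> L n" "x \<noteq> v" "s x = s v" using sibling_ex[OF n2 order_refl xn]
            by metis
          have "h x \<noteq> h v" using v x(1) LT gh by metis
          then consider "pr x v" | "pr v x" using xn v unfolding pr_def by (metis nat_neq_iff)
          then show ?thesis
          proof cases
            case 1
            then have "y = \<alpha> x \<or> y = \<beta> x" using yt t(1)[OF xn] by simp
            moreover have "(a, X (h x, h v)) \<in> parcs (R2 T')" "(a, Y (h x, h v)) \<in> parcs (R2 T')"
              using 1 x(2) unfolding arcs B_def by blast+
            ultimately show ?thesis using \<phi>(2,3)[OF 1] by blast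
          next
            case 2
            then have "y = \<alpha> v \<or> y = \<beta> v" using yt tv[OF 2] t(1)[OF v(1)] by simp
            moreover have "(a, X (h v, h x)) \<in> parcs (R2 T')" "(a, Y (h v, h x)) \<in> parcs (R2 T')"
              using 2 x(2) unfolding arcs B_def by blast+
            ultimately show ?thesis using \<phi>(2,3)[OF 2] by blast
          qed
        qed
      qed
    next
      fix u v assume p: "pr u v" and e: "a = X (h u, h v)"
      have uv: "u \<in> T" "v \<in> T" using prL[OF p] LT by blast+
      have "y = \<beta> u \<or> y = u \<or> y = v" using y e \<phi>(2)[OF p] N\<alpha>(1)[OF p] by simp
      moreover have "(a, Y (h u, h v)) \<in> parcs (R2 T')" "(a, Old (h u)) \<in> parcs (R2 T')" "(a, Old (h v)) \<in> parcs (R2 T')"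
        using p e unfolding arcs B_def by blast+
      ultimately show ?thesis using \<phi>(3)[OF p] \<phi>(1) uv by blast
    next
      fix u v assume p: "pr u v" and e: "a = Y (h u, h v)"
      have uv: "u \<in> T" "v \<in> T" using prL[OF p] LT by blast+
      have "y = \<alpha> u \<or> y = u \<or> y = v" using y e \<phi>(3)[OF p] N\<alpha>(2)[OF p] by simp
      moreover have "(a, X (h u, h v)) \<in> parcs (R2 T')" "(a, Old (h u)) \<in> parcs (R2 T')" "(a, Old (h v)) \<in> parcs (R2 T')"
        using p e unfolding arcs B_def by blast+
      ultimately show ?thesis using \<phi>(2)[OF p] \<phi>(1) uv by blast
    qed
  qed
  then show ?thesis using T'(1) unfolding isomorphic_to_R2_def by blast
qed

lemma isomorphic_R3:
  assumes R3_shape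
  shows "isomorphic_to_R3 G (n - 1)"
proof -
  obtain m where m: "n = Suc m" using n(1) by (cases n) auto
  have m2: "2 \<le> m" "1 \<le> m" "m \<le> n" "m < n" using assms m unfolding R3_shape_def by simp_all
  have sh: "\<And>x y. x \<in> L n \<Longrightarrow> y \<in> t x \<Longrightarrow> y \<in> L n \<and> t x = t (s y) \<and> s x \<noteq> s y \<and> s (s x) = s (s y)"
    using assms unfolding R3_shape_def by blast
  define U where "U = (\<Union>j\<le>m. L j)"
  have UT: "U \<subseteq> T" using m2(3) unfolding T_def U_def by (intro UN_mono) auto
  have "finite T" unfolding T_def using finite_L by simp
  then obtain h :: "'a \<Rightarrow> nat" where hT: "inj_on h T" using finite_imp_inj_to_nat_seg by metis
  then have h: "inj_on h U" using UT by (rule inj_on_subset)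
  obtain T' where T': "is_T m T'" "pverts T' = h ` U"
    "\<And>i k. (i, k) \<in> parcs T' \<longleftrightarrow> (\<exists>x y. i = h x \<and> k = h y \<and> x \<in> U \<and> y \<in> U \<and> (x \<noteq> r \<and> y = s x \<or> y \<noteq> r \<and> x = s y))"
    "leaf_pairs T' = {(h u, h v) | u v. u \<in> L m \<and> v \<in> L m \<and> s u = s v \<and> h u < h v}"
  proof (rule tree_copy[OF m2(2,3) hT, folded U_def], goal_cases)
    case (1 T')
    show ?case by (rule 1(1)[OF 1(2,3) 1(4) 1(5)])
  qed
  define g where "g = inv_into U h"
  have gh: "g (h x) = x" if "x \<in> U" for x using that h by (auto simp: g_def)
  have LU: "x \<in> U" if "x \<in> L m" for x using that unfolding U_def by blast
  have Ltwo: "two x" if "x \<in> L m" for x using that m2(2) by (cases m) auto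
  have Lr: "x \<noteq> r" if "x \<in> L m" for x using Ltwo[OF that] not_two_r by blast
  have rU: "r \<in> U" unfolding U_def using L.simps(1) by blast
  have "\<forall>x. \<exists>a b. two x \<longrightarrow> t x = {a, b} \<and> a \<noteq> b" using t_cases by metis
  then obtain \<alpha> \<beta> where "\<forall>x. two x \<longrightarrow> t x = {\<alpha> x, \<beta> x} \<and> \<alpha> x \<noteq> \<beta> x" by metis
  then have t: "t x = {\<alpha> x, \<beta> x}" "\<alpha> x \<noteq> \<beta> x" if "x \<in> L m" for x using Ltwo[OF that] by auto
  have t': "\<alpha> x \<in> t x" "\<beta> x \<in> t x" if "x \<in> L m" for x using t[OF that] by auto
  have down: "a \<in> L n" "s a = x" if "x \<in> L m" "a \<in> t x" for x a
    using t_down[OF m2(2,4) that] unfolding m by blast+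
  have notU: "a \<notin> U" if "a \<in> L n" for a
    using L_unique[OF that] m2(4) unfolding U_def by fastforce
  \<comment> \<open>For a lower neighbor \<open>y\<close> of \<open>a\<close>, the parent
    \<open>s y\<close> differs from \<open>u\<close> but has the same parent, so it is the sibling
    \<open>v\<close>; and \<open>t a\<close> is the pair of its children.\<close>
  have Nt: "N a = insert u (t v)"
    if uv: "u \<in> L m" "v \<in> L m" "u \<noteq> v" "s u = s v" and a: "a \<in> t u" for u v a
  proof -
    note aL = down[OF uv(1) a]
    obtain y where y: "y \<in> t a" using t_cases[OF leaf_two[OF aL(1)]] by blast
    note shy = sh[OF aL(1) y]
    have sy: "s y \<in> L m" "s y \<noteq> u" "s u = s (s y)" using shy aL(2) unfolding m by auto
    have "t (s u) = {u, s y}" using siblings_t[OF m2(1,3) uv(1) sy(1)] sy(2,3) by metis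
    moreover have "t (s u) = {u, v}" using siblings_t[OF m2(1,3) uv] .
    ultimately have "s y = v" using uv(3) by (metis doubleton_eq_iff)
    then have "t a = t v" using shy by metis
    then show ?thesis using N_two[OF leaf_two[OF aL(1)]] aL(2) by metis
  qed
  define pr where "pr u v \<longleftrightarrow> u \<in> L m \<and> v \<in> L m \<and> s u = s v \<and> h u < h v" for u v
  have prL: "u \<in> L m" "v \<in> L m" "s u = s v" "u \<noteq> v" if "pr u v" for u v using that
    by (auto simp: pr_def)
  have prt: "t (s u) = {u, v}" if "pr u v" for u v using siblings_t[OF m2(1,3)] prL[OF that]
    by blast
  have N\<alpha>: "N (\<alpha> u) = {u, \<alpha> v, \<beta> v}" "N (\<beta> u) = {u, \<alpha> v, \<beta> v}" "N (\<alpha> v) = {v, \<alpha> u, \<beta> u}" "N (\<beta> v) = {v, \<alpha> u, \<beta> u}"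
    if p: "pr u v" for u v
    using Nt[of u v "\<alpha> u"] Nt[of u v "\<beta> u"] Nt[of v u "\<alpha> v"] Nt[of v u "\<beta> v"] t(1) t' prL[OF p]
      by metis+
  have pair_eq: "u = u' \<and> v = v'"
    if p: "pr u v" "pr u' v'" and x: "x \<in> {u, v}" "x \<in> {u', v'}" for u v u' v' x
  proof -
    have "s u = s x" "s u' = s x" using x prL(3)[OF p(1)] prL(3)[OF p(2)] by auto
    then have "{u, v} = {u', v'}" using prt[OF p(1)] prt[OF p(2)] by metis
    then show ?thesis using p by (auto simp: doubleton_eq_iff pr_def)
  qed
  \<comment> \<open>In the construction \<open>x\<close> and \<open>w\<close> are adjacent to
    \<open>u\<close>, while \<open>z\<close> and \<open>y\<close> are adjacent to \<open>v\<close>;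
    hence \<open>W\<close> goes with the first member of the pair and \<open>Y\<close> with the
    second.\<close>
  define \<phi> where "\<phi> a = (case a of Old i \<Rightarrow> g i | X e \<Rightarrow> \<alpha> (g (fst e)) | W e \<Rightarrow> \<beta> (g (fst e))
    | Z e \<Rightarrow> \<alpha> (g (snd e)) | Y e \<Rightarrow> \<beta> (g (snd e)))" for a
  have \<phi>: "x \<in> U \<Longrightarrow> \<phi> (Old (h x)) = x" "pr u v \<Longrightarrow> \<phi> (X (h u, h v)) = \<alpha> u" "pr u v \<Longrightarrow> \<phi> (Y (h u, h v)) = \<beta> v"
    "pr u v \<Longrightarrow> \<phi> (Z (h u, h v)) = \<alpha> v" "pr u v \<Longrightarrow> \<phi> (W (h u, h v)) = \<beta> u" for x u v
    using gh LU prL by (simp_all add: \<phi>_def)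
  have lp: "e \<in> leaf_pairs T' \<longleftrightarrow> (\<exists>u v. e = (h u, h v) \<and> pr u v)" for e
    unfolding T'(4) pr_def by blast
  have verts: "a \<in> pverts (R3 T') \<longleftrightarrow> (\<exists>x\<in>U. a = Old (h x)) \<or>
      (\<exists>u v. pr u v \<and> (a = X (h u, h v) \<or> a = Y (h u, h v) \<or> a = Z (h u, h v) \<or> a = W (h u, h v)))" for a
    unfolding verts_R3 T'(2) Bex_def lp by blast
  define B where B: "B u v = R3_gadget (h u, h v)" for u v
  have arcs: "(a, b) \<in> parcs (R3 T') \<longleftrightarrow> (\<exists>x y. a = Old (h x) \<and> b = Old (h y) \<and> x \<in> U \<and> y \<in> U \<and> (x \<noteq> r \<and> y = s x \<or> y \<noteq> r \<and> x = s y)) \<or>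
    (\<exists>u v. pr u v \<and> ((a, b) \<in> B u v \<or> (b, a) \<in> B u v))" for a b
    unfolding arcs_R3 T'(3) Bex_def lp B by blast
  have B_def: "B u v = {(Old (h u), X (h u, h v)), (X (h u, h v), Z (h u, h v)), (Z (h u, h v), Old (h v)),
      (Old (h v), Y (h u, h v)), (Y (h u, h v), W (h u, h v)), (W (h u, h v), Old (h u)),
      (X (h u, h v), Y (h u, h v)), (Z (h u, h v), W (h u, h v))}" for u v
    by (simp add: B R3_gadget_def)
  have "digraph_iso (with_proj G) (with_proj (R3 T'))"
  proof (rule digraph_isoI[where \<phi> = \<phi>])
    show "pverts (R3 T') \<noteq> {}" using verts rU by blast
    have B: "a \<in> pverts (R3 T') \<and> b \<in> pverts (R3 T') \<and> \<phi> b \<in> N (\<phi> a)"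
      if p: "pr u v" and ab: "(a, b) \<in> B u v" for u v a b
    proof -
      have uv: "u \<in> U" "v \<in> U" using prL[OF p] LU by blast+
      have "\<alpha> u \<in> N u" "\<beta> v \<in> N v" using t' prL[OF p] t_N by blast+
      moreover have "\<alpha> v \<in> N (\<alpha> u)" "\<beta> v \<in> N (\<alpha> u)" "u \<in> N (\<beta> u)" "v \<in> N (\<alpha> v)" "\<beta> u \<in> N (\<beta> v)" "\<beta> u \<in> N (\<alpha> v)"
        using N\<alpha>[OF p] by simp_all
      ultimately show ?thesis
        using ab uv p \<phi>(1)[OF uv(1)] \<phi>(1)[OF uv(2)] \<phi>(2-5)[OF p] verts unfolding B_def by auto
    qed
    show "a \<in> pverts (R3 T') \<and> b \<in> pverts (R3 T')" if "(a, b) \<in> parcs (R3 T')" for a b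
      using that B verts unfolding arcs by blast
    show "\<phi> b \<in> N (\<phi> a)" if "(a, b) \<in> parcs (R3 T')" for a b
      using that unfolding arcs
    proof (elim disjE exE conjE)
      fix x y assume "a = Old (h x)" "b = Old (h y)" "x \<in> U" "y \<in> U" "x \<noteq> r" "y = s x"
      then show ?thesis using tree_arc_N[of x y] \<phi>(1) UT by auto
    next
      fix x y assume "a = Old (h x)" "b = Old (h y)" "x \<in> U" "y \<in> U" "y \<noteq> r" "x = s y"
      then show ?thesis using tree_arc_N[of x y] \<phi>(1) UT by auto
    qed (use B N_sym in blast)+
    have new: "\<exists>x\<in>{u, v}. \<phi> a \<in> t x \<and> x \<in> L m"
      if "pr u v" "a = X (h u, h v) \<or> a = Y (h u, h v) \<or> a = Z (h u, h v) \<or> a = W (h u, h v)" for u v a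
      using that \<phi>(2-5)[OF that(1)] t' prL[OF that(1)] by auto
    show "\<phi> a \<in> V" if "a \<in> pverts (R3 T')" for a
      using that unfolding verts
    proof (elim disjE bexE exE conjE)
      fix x assume "x \<in> U" "a = Old (h x)"
      then show ?thesis using \<phi>(1) L_V unfolding U_def by auto
    qed (use new t_N N_V in metis)+
    show "inj_on \<phi> (pverts (R3 T'))"
    proof (rule inj_onI)
      fix a b assume ab: "a \<in> pverts (R3 T')" "b \<in> pverts (R3 T')" and eq: "\<phi> a = \<phi> b"
      let ?new = "\<lambda>a u v. a = X (h u, h v) \<or> a = Y (h u, h v) \<or> a = Z (h u, h v) \<or> a = W (h u, h v)"
      have sU: "\<phi> a \<notin> U" if "pr u v" "?new a u v" for u v a
        using new[OF that] down(1) notU by blast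
      have same: "a = b" if p: "pr u v" "?new a u v" and q: "pr u' v'" "?new b u' v'" for u v u' v'
      proof -
        obtain x where x: "x \<in> {u, v}" "\<phi> a \<in> t x" "x \<in> L m" using new[OF p] by blast
        obtain y where y: "y \<in> {u', v'}" "\<phi> b \<in> t y" "y \<in> L m" using new[OF q] by blast
        have "x = y" using down(2)[OF x(3,2)] down(2)[OF y(3,2)] eq by simp
        then have e: "u = u'" "v = v'" using pair_eq[OF p(1) q(1) x(1)] y(1) by blast+
        have "s (\<alpha> u) = u" "s (\<beta> u) = u" "s (\<alpha> v) = v" "s (\<beta> v) = v" using down(2) t' prL[OF p(1)]
          by blast+
        then have "distinct [\<alpha> u, \<beta> u, \<alpha> v, \<beta> v]" using prL(4)[OF p(1)] t(2) prL(1,2)[OF p(1)]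
          by auto
        then show ?thesis using p q eq \<phi>(2-5)[OF p(1)] unfolding e[symmetric] by auto
      qed
      show "a = b" using ab unfolding verts
      proof (elim disjE bexE)
        fix x y assume "x \<in> U" "a = Old (h x)" "y \<in> U" "b = Old (h y)"
        then show ?thesis using \<phi>(1) eq by metis
      next
        fix x assume x: "x \<in> U" "a = Old (h x)" and "\<exists>u v. pr u v \<and> ?new b u v"
        then obtain u v where "pr u v" "?new b u v" by blast
        then show ?thesis using sU \<phi>(1)[OF x(1)] x eq by metis
      next
        fix x assume x: "x \<in> U" "b = Old (h x)" and "\<exists>u v. pr u v \<and> ?new a u v"
        then obtain u v where "pr u v" "?new a u v" by blast
        then show ?thesis using sU \<phi>(1)[OF x(1)] x eq by metis
      next
        assume "\<exists>u v. pr u v \<and> ?new a u v" "\<exists>u v. pr u v \<and> ?new b u v"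
        then show ?thesis using same by metis
      qed
    qed
    show "\<exists>k. (a, k) \<in> parcs (R3 T') \<and> \<phi> k = y"
      if a: "a \<in> pverts (R3 T')" and y: "y \<in> N (\<phi> a)" for a y
      using a unfolding verts
    proof (elim disjE bexE exE conjE)
      fix x assume x: "x \<in> U" "a = Old (h x)"
      then have yx: "y \<in> N x" using y \<phi>(1) by simp
      have old: ?thesis if "y \<in> U \<and> (x \<noteq> r \<and> y = s x \<or> y \<noteq> r \<and> x = s y)"
        using that x \<phi>(1) arcs by (intro exI[of _ "Old (h y)"]) blast
      obtain j where j: "j \<le> m" "x \<in> L j" using x(1) unfolding U_def by blast
      show ?thesis
      proof (cases "j < m")
        case True
        then show ?thesis using old inner_N[OF j(2) _ m2(3) yx] unfolding U_def by blast
      next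
        case False
        then have xm: "x \<in> L m" using j by simp
        show ?thesis
        proof (cases "y = s x")
          case True
          obtain k where k: "m = Suc k" using m2(2) by (cases m) auto
          have "s x \<in> L k" using xm unfolding k by simp
          then have "y \<in> U" using True k unfolding U_def by auto
          then show ?thesis using old Lr[OF xm] True by blast
        next
          case False
          then have yt: "y = \<alpha> x \<or> y = \<beta> x" using yx t_iff t(1)[OF xm] by blast
          obtain v where v: "v \<in> L m" "x \<noteq> v" "s x = s v" using sibling_ex[OF m2(1,3) xm] by metis
          have "h x \<noteq> h v" using v x(1) LU gh by metis
          then consider "pr x v" | "pr v x" using xm v unfolding pr_def by (metis nat_neq_iff)
          then show ?thesis
          proof cases
            case 1
            have "(a, X (h x, h v)) \<in> parcs (R3 T')" "(a, W (h x, h v)) \<in> parcs (R3 T')"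
              using 1 x(2) unfolding arcs B_def by blast+
            then show ?thesis using yt \<phi>(2,5)[OF 1] by blast
          next
            case 2
            have "(a, Z (h v, h x)) \<in> parcs (R3 T')" "(a, Y (h v, h x)) \<in> parcs (R3 T')"
              using 2 x(2) unfolding arcs B_def by blast+
            then show ?thesis using yt \<phi>(3,4)[OF 2] by blast
          qed
        qed
      qed
    next
      fix u v assume p: "pr u v" and e: "a = X (h u, h v)"
      have "y = u \<or> y = \<alpha> v \<or> y = \<beta> v" using y e \<phi>(2)[OF p] N\<alpha>(1)[OF p] by simp
      moreover have "(a, Old (h u)) \<in> parcs (R3 T')" "(a, Z (h u, h v)) \<in> parcs (R3 T')" "(a, Y (h u, h v)) \<in> parcs (R3 T')"
        using p e unfolding arcs B_def by blast+
      ultimately show ?thesis using \<phi>(3,4)[OF p] \<phi>(1)[OF LU[OF prL(1)[OF p]]] by blast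
    next
      fix u v assume p: "pr u v" and e: "a = Y (h u, h v)"
      have "y = v \<or> y = \<alpha> u \<or> y = \<beta> u" using y e \<phi>(3)[OF p] N\<alpha>(4)[OF p] by simp
      moreover have "(a, Old (h v)) \<in> parcs (R3 T')" "(a, X (h u, h v)) \<in> parcs (R3 T')" "(a, W (h u, h v)) \<in> parcs (R3 T')"
        using p e unfolding arcs B_def by blast+
      ultimately show ?thesis using \<phi>(2,5)[OF p] \<phi>(1)[OF LU[OF prL(2)[OF p]]] by blast
    next
      fix u v assume p: "pr u v" and e: "a = Z (h u, h v)"
      have "y = v \<or> y = \<alpha> u \<or> y = \<beta> u" using y e \<phi>(4)[OF p] N\<alpha>(3)[OF p] by simp
      moreover have "(a, Old (h v)) \<in> parcs (R3 T')" "(a, X (h u, h v)) \<in> parcs (R3 T')" "(a, W (h u, h v)) \<in> parcs (R3 T')"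
        using p e unfolding arcs B_def by blast+
      ultimately show ?thesis using \<phi>(2,5)[OF p] \<phi>(1)[OF LU[OF prL(2)[OF p]]] by blast
    next
      fix u v assume p: "pr u v" and e: "a = W (h u, h v)"
      have "y = u \<or> y = \<alpha> v \<or> y = \<beta> v" using y e \<phi>(5)[OF p] N\<alpha>(2)[OF p] by simp
      moreover have "(a, Old (h u)) \<in> parcs (R3 T')" "(a, Z (h u, h v)) \<in> parcs (R3 T')" "(a, Y (h u, h v)) \<in> parcs (R3 T')"
        using p e unfolding arcs B_def by blast+
      ultimately show ?thesis using \<phi>(3,4)[OF p] \<phi>(1)[OF LU[OF prL(1)[OF p]]] by blast
    qed
  qed
  then show ?thesis using T'(1) m unfolding isomorphic_to_R3_def by auto
qed

section \<open>Proof of the theorem\<close>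

text \<open>All vertices other than \<open>r\<close> have type 2, and \<open>r\<close> has type
  6.\<close>

lemma no_regular_R2:
  assumes R2_shape
  shows "\<not> regular w"
proof
  assume w: "regular w"
  have n2: "2 \<le> n" and sh: "\<And>x a. x \<in> L n \<Longrightarrow> a \<in> t x \<Longrightarrow> two a \<and> t a = t (s x) \<and> s a \<in> t x"
    using assms unfolding R2_shape_def by blast+
  have "T \<union> O' = V"
  proof (rule closed_eq_V)
    show "T \<union> O' \<noteq> {}" using r_T by blast
    show "T \<union> O' \<subseteq> V" unfolding T_def O'_def using L_V t_N N_V by blast
    show "N p \<subseteq> T \<union> O'" if p: "p \<in> T \<union> O'" for p
    proof (cases "p \<in> T")
      case True
      then show ?thesis using T_leaf unfolding O'_def by blast
    next
      case False
      then obtain x where x: "x \<in> L n" "p \<in> t x" using p unfolding O'_def by blast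
      obtain x' where "t (s x) = {x, x'}" "x' \<in> L n" using leaf_sibling[OF n2 x(1)] by metis
      then have "t (s x) \<subseteq> T" using x(1) T_I by auto
      then show ?thesis using sh[OF x] N_two[of p] x(1) unfolding O'_def by auto
    qed
  qed
  moreover have "transitive w" using w unfolding regular_def by blast
  ultimately have "w \<in> T \<or> two w" using sh unfolding O'_def transitive_def by blast
  then have "w = r" using s_T two_not_transitive \<open>transitive w\<close> by blast
  then show False using root(2) w by blast
qed

lemma no_regular_R3:
  assumes R3_shape
  shows "\<not> regular w"
proof
  assume w: "regular w"
  have "T = V"
  proof (rule closed_eq_V)
    show "T \<noteq> {}" using r_T by blast
    show "T \<subseteq> V" unfolding T_def using L_V by blast
    show "N p \<subseteq> T" if "p \<in> T" for p
      using T_leaf[OF that] T_I[of _ n] assms unfolding R3_shape_def by blast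
  qed
  moreover have "transitive w" using w unfolding regular_def by blast
  ultimately have "w \<in> T" unfolding transitive_def by blast
  then have "w = r" using s_T two_not_transitive \<open>transitive w\<close> by blast
  then show False using root(2) w by blast
qed

end

context connected_cubic_graph
begin

text \<open>The second conjunct serves the claim on type 3, which passes through
  \<open>two_vertex_cases\<close> when a regular vertex has a neighbor of type 2.\<close>

definition exceptional :: bool where
  "exceptional \<longleftrightarrow> (\<exists>n\<ge>1. isomorphic_to_R2 G n \<or> isomorphic_to_R3 G n) \<and> (\<forall>w. \<not> regular w)"

end

lemma (in leaf_level) leaf_level_cases: "distinguishing_number G \<le> 2 \<or> exceptional"
proof (rule leaf_cases)
  assume R: R2_shape
  then have "exceptional" unfolding exceptional_def using isomorphic_R2 no_regular_R2 n(1) by blast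
  then show ?thesis by blast
next
  assume R: R3_shape
  have "3 \<le> n" using R unfolding R3_shape_def by blast
  then have "n - 1 \<ge> 1" by simp
  then have "exceptional" unfolding exceptional_def using isomorphic_R3[OF R] no_regular_R3[OF R]
    by blast
  then show ?thesis by blast
qed blast

lemma (in six_root) six_root_cases: "distinguishing_number G \<le> 2 \<or> exceptional"
proof (cases "\<exists>u\<in>N r. \<exists>v\<in>N r. u \<noteq> v \<and> (u, v) \<in> (avoid {r})\<^sup>*")
  case True
  then show ?thesis using crossing by blast
next
  case False
  then have sep: "\<And>u v. u \<in> N r \<Longrightarrow> v \<in> N r \<Longrightarrow> (u, v) \<in> (avoid {r})\<^sup>* \<Longrightarrow> u = v" by blast
  show ?thesis
  proof (cases "orb r = {r}")
    case False
    then obtain r' where "r' \<in> orb r" "r' \<noteq> r" using orb_refl by blast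
    then show ?thesis using second_root[OF sep] by blast
  next
    case True
    interpret fixed_root G r by unfold_locales (use True sep in auto)
    show ?thesis
    proof (cases "\<forall>n. L n \<noteq> {}")
      case True
      then show ?thesis using infinite_levels by blast
    next
      case False
      then obtain k where k: "L k = {}" "\<And>j. j < k \<Longrightarrow> L j \<noteq> {}"
        using exists_least_iff[of "\<lambda>n. L n = {}"] by blast
      have "L 0 \<noteq> {}" by simp
      moreover have "L (Suc 0) \<noteq> {}" using L1 card_N[OF rV] by (metis card.empty zero_neq_numeral)
      ultimately have "k \<noteq> 0" "k \<noteq> Suc 0" using k(1) by metis+
      then obtain n where n: "k = Suc n" "n \<ge> 1" by (cases k) auto
      interpret leaf_level G r n
        by unfold_locales (use n k in \<open>auto simp del: L.simps\<close>)
      show ?thesis by (rule leaf_level_cases)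
    qed
  qed
qed

context connected_cubic_graph
begin

section \<open>Ends of the walk along fixed neighbors\<close>

lemma into_orbit:
  assumes "\<And>p. p \<in> N r \<Longrightarrow> two p \<and> s p = r" "u \<in> orb r" "p \<in> N u"
  shows "two p \<and> s p = u"
proof -
  obtain f where f: "f \<in> A" "u = f r" using assms(2) by (rule orbE)
  obtain g where g: "g \<in> A" "\<And>x. f (g x) = x" "\<And>x. g (f x) = x" using A_inv[OF f(1)] by metis
  have "g p \<in> N r" using A_N[OF f(1), of "g p" r] g(2) f(2) assms(3) by simp
  then have "two (g p)" "s (g p) = r" using assms(1) by blast+
  then show ?thesis using two_A[OF f(1), of "g p"] s_A[OF f(1), of "g p"] g(2) f(2) by simp
qed

text \<open>Each neighbor of a member of the orbit has it as its fixed neighbor. So no vertex sees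
  two members, and the ambiguity treated in \<open>free_orbit\<close> cannot arise.\<close>

lemma pinned_orbit:
  assumes r: "\<And>p. p \<in> N r \<Longrightarrow> two p \<and> s p = r" and a: "a \<in> N r" "a \<notin> orb r"
    and ra: "\<And>f y. f \<in> A \<Longrightarrow> f r = r \<Longrightarrow> f a = a \<Longrightarrow> y \<in> N r \<Longrightarrow> f y = y"
  shows "distinguishing_number G \<le> 2"
proof (rule free_orbit[OF _ a])
  show "r \<in> V" using a(1) N_V by blast
  show "f y = y" if "f \<in> A" "f r = r" "f a = a" "y \<in> N r" for f y using ra[OF that] .
next
  fix p e u u' f assume u: "u \<in> orb r" "u' \<in> orb r" "N p = {e, u, u'}" "u \<noteq> u'"
  then have "p \<in> N u" "p \<in> N u'" using N_sym by blast+
  then have "s p = u" "s p = u'" using into_orbit[OF r] u by blast+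
  then show "f u = u" using u(4) by simp
qed

text \<open>With \<open>z\<close> also its sibling has \<open>y\<close> as fixed neighbor, so all
  neighbors of \<open>y\<close> do. If \<open>z\<close> were equivalent to \<open>y\<close>, it
  would lie on a reversed edge itself, and this edge would have to be the one to
  \<open>y\<close>.\<close>

lemma semi_edge_tail:
  assumes y: "two y" "two (s y)" "s (s y) = y" "s y \<in> orb y" and z: "z \<in> t y" "two z" "s z = y"
  shows "distinguishing_number G \<le> 2"
proof (rule pinned_orbit[of y z])
  show "z \<in> N y" using z t_N by blast
  show "two p \<and> s p = y" if p: "p \<in> N y" for p
  proof (cases "p = s y")
    case False
    then have "p \<in> t y" using p t_iff by blast
    obtain b g where g: "t y = {z, b}" "g \<in> A" "g y = y" "g z = b" using t_cases'[OF y(1) z(1)]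
      by metis
    then have "p = z \<or> p = g z" using \<open>p \<in> t y\<close> by auto
    then show ?thesis using z(2,3) two_A[OF g(2)] s_A[OF g(2) z(2)] g(3) by metis
  qed (use y in simp)
  show "z \<notin> orb y"
  proof
    assume "z \<in> orb y"
    then obtain f where f: "f \<in> A" "z = f y" by (rule orbE)
    have "s z = f (s y)" using s_A[OF f(1) y(1)] f(2) by simp
    then have "s (s z) = f (s (s y))" using s_A[OF f(1) y(2)] by simp
    then have "s y = z" using y(3) z(3) f(2) by simp
    then show False using z(1) t_iff by blast
  qed
  show "f x = x" if "f \<in> A" "f y = y" "f z = z" "x \<in> N y" for f x
    using two_stab[OF y(1) that(1,2) z(1) that(3,4)] .
qed

text \<open>A rigid \<open>w\<close> yields an edge pinned from both of its inequivalent ends. A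
  transitive \<open>w\<close> is the fixed neighbor of all its neighbors: if it is regular, the
  orbit of \<open>w\<close> serves as the seed, otherwise it is a root of type 6.\<close>

lemma above_two:
  assumes y: "two y" and w: "w = s y" "\<not> two w"
  shows "distinguishing_number G \<le> 2 \<or> exceptional"
proof -
  have wN: "w \<in> N y" "y \<in> N w" "w \<in> V" using s_N[OF y] w(1) N_sym N_V by blast+
  have worb: "w \<notin> orb y"
  proof
    assume "w \<in> orb y"
    then obtain f where "f \<in> A" "w = f y" by (rule orbE)
    then show False using two_A y w(2) by metis
  qed
  show ?thesis
  proof (rule trichotomy[OF wN(3)])
    assume "rigid w"
    then have "pinned w y" using rigidD wN by blast
    then show ?thesis using inequivalent_pair[OF wN(1) _ _ worb] s_pinned[OF y] w(1) by blast
  next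
    assume tr: "transitive w"
    have all: "two p \<and> s p = w" if p: "p \<in> N w" for p
    proof -
      obtain f where f: "f \<in> A" "f w = w" "f y = p" using transitiveD[OF tr wN(2) p] by metis
      have "two (f y)" using two_A[OF f(1)] y by blast
      moreover have "s (f y) = f w" using s_A[OF f(1) y] w(1) by simp
      ultimately show ?thesis using f by simp
    qed
    show ?thesis
    proof (cases "regular w")
      case True
      have "y \<notin> orb w" using worb orb_sym by blast
      then show ?thesis using pinned_orbit[OF all wN(2)] regularD[OF True _ _ wN(2)] by blast
    next
      case False
      interpret six_root G w by unfold_locales (use tr False all in auto)
      show ?thesis by (rule six_root_cases)
    qed
  qed (use w in blast)
qed

text \<open>The walk fails to settle the matter only if it turns back at its first step and both
  ends of the edge have the same lower neighbors.\<close>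

lemma ascend:
  assumes v: "two v"
  obtains "distinguishing_number G \<le> 2 \<or> exceptional" | "two (s v)" "s (s v) = v" "t v = t (s v)"
proof -
  define x where "x i = (s ^^ i) v" for i
  have x: "x 0 = v" "s (x i) = x (Suc i)" for i by (simp_all add: x_def)
  define up where "up i \<longleftrightarrow> two (x (Suc i)) \<and> s (x (Suc i)) \<noteq> x i" for i
  have two_x: "two (x i)" if "\<And>j. j < i \<Longrightarrow> up j" for i
    using that v x(1) up_def by (cases i) auto
  show thesis
  proof (cases "\<forall>i. up i")
    case True
    have tx: "two (x i)" for i using two_x True by blast
    moreover have "x i \<in> t (x (Suc i))" for i
    proof -
      have "x i \<in> N (x (Suc i))" using s_N[OF tx[of i]] N_sym x(2) by metis
      then show ?thesis using True t_iff unfolding up_def by metis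
    qed
    ultimately show thesis using infinite_ascent[of x] x(2) that(1) by blast
  next
    case False
    then obtain i where i: "\<not> up i" "\<And>j. j < i \<Longrightarrow> up j" using exists_least_iff[of "\<lambda>i. \<not> up i"]
      by blast
    define y where "y = x i"
    have y: "two y" using two_x i(2) unfolding y_def by blast
    have sy: "s y = x (Suc i)" by (simp add: y_def x(2))
    show thesis
    proof (cases "two (s y)")
      case False
      then show thesis using above_two[OF y] that(1) by blast
    next
      case tw: True
      then have ssy: "s (s y) = y" using i(1) sy y_def unfolding up_def by metis
      show thesis
      proof (cases "s y \<in> orb y")
        case False
        have "pinned (s y) y" using s_pinned[OF tw] ssy by simp
        then show thesis using inequivalent_pair[OF s_N[OF y] s_pinned[OF y] _ False] that(1)
          by blast
      next
        case True
        show thesis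
        proof (cases i)
          case 0
          then have "y = v" using x(1) y_def by simp
          then show thesis using semi_edge_dichotomy[OF y tw ssy True] tw ssy that by metis
        next
          case (Suc j)
          have z: "two (x j)" using two_x i(2) Suc by simp
          have "s (x j) = y" using x(2) Suc y_def by simp
          moreover have "s y \<noteq> x j" using i(2)[of j] Suc y_def unfolding up_def by (metis lessI)
          ultimately have "x j \<in> t y" using s_N[OF z] N_sym t_iff by metis
          then show thesis using semi_edge_tail[OF y tw ssy True _ z \<open>s (x j) = y\<close>] that(1) by blast
        qed
      qed
    qed
  qed
qed

text \<open>In the case left by \<open>ascend\<close> the vertices \<open>v\<close> and
  \<open>w\<close> are twins with lower neighbors \<open>a\<close> and \<open>b\<close>. Then
  \<open>a\<close> has type 2 too, and the walk from \<open>a\<close> cannot end in the same way: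
  its fixed neighbor \<open>e\<close> does not see \<open>v\<close>.\<close>

theorem two_vertex_cases:
  assumes v: "two v"
  shows "distinguishing_number G \<le> 2 \<or> exceptional"
proof (rule ascend[OF v])
  assume w: "two (s v)" "s (s v) = v" "t v = t (s v)"
  obtain a b where ab: "t v = {a, b}" "a \<noteq> b" using t_cases[OF v] by metis
  define w where "w = s v"
  have Nv: "N v = {w, a, b}" using N_two[OF v] ab(1) w_def by simp
  have Nw: "N w = {v, a, b}" using N_two[OF w(1)] w(2,3) ab(1) w_def by simp
  have V: "v \<in> V" "w \<in> V" using two_V v w(1) w_def by auto
  have ne: "v \<noteq> w" "v \<noteq> a" "v \<noteq> b" "w \<noteq> a" "w \<noteq> b"
    using N_neq[of _ v] N_neq[of _ w] Nv Nw by auto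
  define \<tau> where "\<tau> = Transposition.transpose v w"
  have \<tau>: "\<tau> \<in> A" unfolding \<tau>_def
    by (rule transpose_in_A[OF V]) (use ne in \<open>simp add: Nv Nw insert_Diff_if\<close>)
  have \<tau>s: "\<tau> a = a" "\<tau> v = w" "\<tau> w = v" using ne by (simp_all add: \<tau>_def)
  have va: "v \<in> N a" "w \<in> N a" using Nv Nw N_sym by blast+
  have aV: "a \<in> V" using va N_V by blast
  \<comment> \<open>Otherwise \<open>G\<close> is complete, and exchanging \<open>a\<close> and
    \<open>v\<close> fixes \<open>w\<close>, although \<open>w\<close> pins
    \<open>v\<close>.\<close>
  have K4: "b \<notin> N a"
  proof
    assume ba: "b \<in> N a"
    have Na: "N a = {v, w, b}" using N3_eq[OF va ba] ne by blast
    define \<sigma> where "\<sigma> = Transposition.transpose a v"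
    have "\<sigma> \<in> A" unfolding \<sigma>_def
      by (rule transpose_in_A[OF aV V(1)]) (use ne ab(2) in \<open>simp add: Nv Na insert_Diff_if insert_commute\<close>)
    moreover have "\<sigma> w = w" "\<sigma> v = a" using ne by (simp_all add: \<sigma>_def)
    moreover have "pinned w v" using s_pinned[OF w(1)] w(2) w_def by simp
    ultimately show False using pinnedD ne(2) by metis
  qed
  obtain e where e: "N a = {v, w, e}" "v \<noteq> e" "w \<noteq> e" using N3'[OF aV va ne(1)] by metis
  have eN: "v \<notin> N e" "w \<notin> N e"
  proof -
    have "e \<noteq> a" "e \<noteq> b" using N_neq[of e a] e(1) K4 by auto
    then have "e \<notin> N v" "e \<notin> N w" unfolding Nv Nw using e(2,3) by auto
    then show "v \<notin> N e" "w \<notin> N e" using N_sym by blast+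
  qed
  have np: "\<not> pinned a v" "\<not> pinned a w" using pinnedD[OF _ \<tau> \<tau>s(1)] \<tau>s ne by metis+
  have "two a"
  proof (rule trichotomy[OF aV])
    assume "rigid a"
    then show ?thesis using rigidD va np by blast
  next
    assume "transitive a"
    moreover have "e \<in> N a" using e(1) by simp
    ultimately obtain f where f: "f \<in> A" "f a = a" "f v = e" using transitiveD va(1) by metis
    have "f w \<in> N a" using A_N[OF f(1), of w a] f(2) va by simp
    moreover have "f w \<noteq> e" using A_inj[OF f(1), of w v] f(3) ne(1) by metis
    moreover have "f w \<in> N e" using A_N[OF f(1), of w v] f(3) Nv by simp
    ultimately show ?thesis using e(1) eN by auto
  qed
  show ?thesis
  proof (rule ascend[OF \<open>two a\<close>])
    assume d: "two (s a)" "s (s a) = a" "t a = t (s a)"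
    have "s a \<noteq> v" "s a \<noteq> w" using s_pinned[OF \<open>two a\<close>] np by auto
    then have "s a = e" "v \<in> t a" using s_N[OF \<open>two a\<close>] e(1) va t_iff by auto
    then show ?thesis using d(3) t_N eN by metis
  qed
qed

text \<open>Apart from the three special situations around the neighbor \<open>w\<close>, the orbit
  of \<open>r\<close> meets the condition of \<open>free_orbit\<close>: a frontier vertex missing
  two of its members is equivalent to \<open>w\<close>, and nothing can be exchanged there.\<close>

theorem regular_vertex:
  assumes r: "regular r"
  shows "distinguishing_number G \<le> 2"
proof -
  have tr: "transitive r" and rV: "r \<in> V" using r unfolding regular_def transitive_def by blast+
  obtain w where w: "w \<in> N r" using card_N[OF rV] by fastforce
  show ?thesis
  proof (cases "w \<in> orb r \<or> two w \<or> (\<exists>\<phi>\<in>A. \<phi> w = w \<and> \<phi> r = r \<and> (\<exists>y\<in>N w \<inter> orb r. \<phi> y \<noteq> y))")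
    case True
    moreover have "\<not> exceptional" using r unfolding exceptional_def by blast
    ultimately show ?thesis
      using regular_adjacent_equivalent[OF r w] two_vertex_cases[of w] regular_beside_irregular[OF r w] by blast
  next
    case False
    then have worb: "w \<notin> orb r" and nt: "\<not> two w"
      and fix_w: "\<And>\<phi> y. \<phi> \<in> A \<Longrightarrow> \<phi> w = w \<Longrightarrow> \<phi> r = r \<Longrightarrow> y \<in> N w \<Longrightarrow> y \<in> orb r \<Longrightarrow> \<phi> y = y"
      by blast+
    have rw: "r \<in> N w" using w N_sym by blast
    have arc: "\<exists>k\<in>A. k w = p \<and> k r = u" if u: "u \<in> orb r" "p \<in> N u" for u p
    proof -
      obtain f where f: "f \<in> A" "u = f r" using u(1) by (rule orbE)
      obtain g where g: "g \<in> A" "\<And>x. f (g x) = x" "\<And>x. g (f x) = x" using A_inv[OF f(1)] by metis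
      have "g p \<in> N r" using A_N[OF f(1), of "g p" r] g(2) f(2) u(2) by simp
      then obtain k where k: "k \<in> A" "k r = r" "k w = g p" using transitiveD[OF tr w] by metis
      then show ?thesis using A_comp[OF f(1) k(1)] g(2) f(2) by (intro bexI[of _ "f \<circ> k"]) auto
    qed
    show ?thesis
    proof (rule free_orbit[OF rV w worb])
      show "f y = y" if "f \<in> A" "f r = r" "f w = w" "y \<in> N r" for f y
        using regularD[OF r that(1,2) w that(3,4)] .
    next
      fix p e u u' f
      assume u: "u \<in> orb r" "u' \<in> orb r" "N p = {e, u, u'}" "e \<noteq> u" "e \<noteq> u'" "u \<noteq> u'"
        and f: "f \<in> A" "f p = p" "f e = e"
      have pN: "p \<in> N u" "p \<in> N u'" "p \<in> N e" using u(3) N_sym by blast+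
      obtain k where k: "k \<in> A" "k w = p" "k r = u" using arc[OF u(1) pN(1)] by blast
      obtain k' where k': "k' \<in> A" "\<And>x. k (k' x) = x" "\<And>x. k' (k x) = x" using A_inv[OF k(1)]
        by metis
      have "p \<in> V" using pN N_V by blast
      show "f u = u"
      proof (cases "e \<in> orb r")
        \<comment> \<open>All three neighbors of \<open>p\<close> are then in the orbit.
          Transporting \<open>p\<close> and \<open>e\<close> to \<open>w\<close> and
          \<open>r\<close> turns \<open>f\<close> into a map covered by
          \<open>fix_w\<close>.\<close>
        case True
        obtain l where l: "l \<in> A" "l w = p" "l r = e" using arc[OF True pN(3)] by blast
        obtain l' where l': "l' \<in> A" "\<And>x. l (l' x) = x" "\<And>x. l' (l x) = x" using A_inv[OF l(1)]
          by metis
        have "l' \<circ> f \<circ> l \<in> A" using A_comp l(1) l'(1) f(1) by blast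
        moreover have "(l' \<circ> f \<circ> l) w = w" "(l' \<circ> f \<circ> l) r = r" using l l' f by (metis comp_apply)+
        moreover have "l' u \<in> N w" using A_N[OF l(1), of "l' u" w] l'(2) l(2) u(3) by simp
        moreover have "l' u \<in> orb r" using orb_A[OF l'(1)] u(1) by blast
        ultimately have "(l' \<circ> f \<circ> l) (l' u) = l' u" using fix_w by blast
        then show ?thesis using l'(2) by (metis comp_apply)
      next
        case eorb: False
        show ?thesis
        \<comment> \<open>As the only neighbor of \<open>p\<close> outside of the orbit,
          \<open>e\<close> is pinned. If \<open>u\<close> were moved, \<open>p\<close> would have
          type 2, and so would \<open>w\<close>.\<close>
        proof (rule ccontr)
          assume fu: "f u \<noteq> u"
          have "pinned p e"
            unfolding pinned_def
          proof (intro ballI impI)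
            fix g assume g: "g \<in> A" "g p = p"
            have "g e \<in> N p" using A_N[OF g(1), of e p] g(2) u(3) by simp
            moreover have "g e \<notin> orb r" using orb_A[OF g(1)] eorb by blast
            ultimately show "g e = e" using u(1-3) by blast
          qed
          moreover have "\<not> pinned p u" using pinnedD f(1,2) fu by blast
          ultimately have "two p" unfolding two_def using \<open>p \<in> V\<close> u(3) by blast
          then show False using two_A[OF k(1), of w] k(2) nt by simp
        qed
      qed
    qed
  qed
qed

end

theorem theorem5p6:
  fixes G :: "'a pair_pre_digraph"
  assumes "pair_bidirected_digraph G"
    and "Digraph_Component.connected (with_proj G)"
    and "cubic G"
  shows "((\<exists>v \<in> pverts G. vertex_type G v = 2) \<longrightarrow>
            distinguishing_number G \<le> 2 \<or>
            (\<exists>n \<ge> 1. isomorphic_to_R2 G n \<or> isomorphic_to_R3 G n)) \<and>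
         ((\<exists>v \<in> pverts G. vertex_type G v = 3) \<longrightarrow> distinguishing_number G \<le> 2)"
proof -
  interpret connected_cubic_graph G by (rule connected_cubic_graph.intro[OF assms])
  show ?thesis
    using two_if_vertex_type_2 two_vertex_cases regular_if_vertex_type_3 regular_vertex
    unfolding exceptional_def by metis
qed

end
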